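(* Let $p$ and $q$ be co-prime positive integers and let $C_{pq}\subset\mathbb{C}^2$ be the Schoen–Wolfson cone. Then there exist a corresponding Schoen–Wolfson cone $C_{pq}'\subset\mathbb{C}^2$ and a solution $V_t$, $-\infty<t<\infty$, of the Brakke motion in $\mathbb{C}^2=\mathbb{R}^4$ without mass loss such that $V_t$ is a smooth Hamiltonian stationary self-shrinker for every $t<0$, $V_t$ is a smooth Hamiltonian stationary self-expander for every $t>0$, and $V_t$ approaches the union $C_{pq}\cup C_{pq}'$ as $t\to 0$ from either direction.
   Context: Ambient space. $\mathbb{C}^2$ has coordinates $z^j=x^j+\sqrt{-1}\,y^j$, the Euclidean metric, symplectic form $\omega=\sum_j dx^j\wedge dy^j$, and complex structure $J$ with $J\partial_{x^j}=\partial_{y^j}$. Schoen–Wolfson cones. $C_{pq}$ is the cone $\{y\,\gamma_{pq}(\theta): y\ge 0,\ 0\le\theta<2\pi\}$ over the closed embedded curve $\gamma_{pq}(\theta)=\left(\sqrt{\tfrac{q}{p+q}}\,e^{ip\theta},\ i\sqrt{\tfrac{p}{p+q}}\,e^{-iq\theta}\right)$ in $S^3$. Any image of $C_{pq}$ under an element of $U(2)$ is also called a Schoen–Wolfson cone; the corresponding cone $C_{pq}'$ is such an image. The union $C_{pq}\cup C_{pq}'$ is regarded as a varifold, the sum of the two cones, each with multiplicity one. Lagrangian notions. For a Lagrangian submanifold $\Sigma$ (smoothly immersed, possibly non-orientable), the Lagrangian angle $\beta$ is defined (locally, up to an additive constant) by $*_\Sigma(dz^1\wedge dz^2)=e^{i\beta}$,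 where $*_\Sigma$ is the Hodge star operator of $\Sigma$; the mean curvature vector is $H=J\nabla\beta$. $\Sigma$ is Hamiltonian stationary if $\Delta\beta=0$, with $\Delta$ the Laplacian of $\Sigma$. $\Sigma$ is self-similar if $F^\perp=2cH$ for some constant $c$, where $F^\perp$ is the normal projection of the position vector $F$; it is a self-shrinker if this holds with $c<0$ and a self-expander if this holds with $c>0$. Brakke motion. For a varifold $V$, $\|V\|$ is its mass measure and $h(V)$ its generalized mean curvature vector, i.e. the first variation of $V$ along a compactly supported $C^1$ vector field $W$ is $-\int W\cdot h(V)\,d\|V\|$. Put $\delta(V,\phi)(h(V))=-\int\phi|h(V)|^2\,d\|V\|+\int D\phi\cdot h(V)\,d\|V\|$, with value $-\infty$ if $\int\phi|h(V)|^2d\|V\|=\infty$. A family of varifolds $V_t$ in $\mathbb{R}^n$ is a solution of the Brakke motion if $\bar D\|V_t\|(\phi)\le\delta(V_t,\phi)(h(V_t))$ for every $t$ and every $\phi\in C^1_0(\mathbb{R}^n)$ (compactly supported $C^1$) with $\phi\ge0$, where $\bar D\|V_t\|(\phi)=\limsup_{t_1\to t}\frac{\|V_{t_1}\|(\phi)-\|V_t\|(\phi)}{t_1-t}$. "Without mass loss" means that equality holds in this inequality for all $t$ and all such $\phi$. "$V_t$ approaches" a varifold $V_0$ as $t\to0$ means that $\|V_t\|$ converges to $\|V_0\|$ as Radon measures. *)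

theory Defs
  imports "HOL-Analysis.Analysis"
begin

section \<open>The ambient space\<close>

text \<open>The inner product of the product type is the Euclidean metric of R^4.\<close>

type_synonym C2 = "complex \<times> complex"

definition omega :: "C2 \<Rightarrow> C2 \<Rightarrow> real" where
  "omega v w = (Re (fst v) * Im (fst w) - Im (fst v) * Re (fst w))
             + (Re (snd v) * Im (snd w) - Im (snd v) * Re (snd w))"

definition cpx_J :: "C2 \<Rightarrow> C2" where
  "cpx_J v = (\<i> * fst v, \<i> * snd v)"

definition dz1_dz2 :: "C2 \<Rightarrow> C2 \<Rightarrow> complex" where
  "dz1_dz2 v w = fst v * snd w - fst w * snd v"

text \<open>Complex linear isometries of the Hermitian plane.\<close>

definition U2 :: "(C2 \<Rightarrow> C2) set" where
  "U2 = {A. orthogonal_transformation A \<and> (\<forall>v. A (cpx_J v) = cpx_J (A v))}"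

text \<open>A plane is identified with the orthogonal projection onto it; this gives the
  Grassmannian its topology, as a compact subset of the bounded operators.\<close>

definition orth_proj :: "C2 set \<Rightarrow> C2 \<Rightarrow>\<^sub>L C2" where
  "orth_proj S = Blinfun (closest_point S)"

definition Gr2 :: "(C2 \<Rightarrow>\<^sub>L C2) set" where
  "Gr2 = orth_proj ` {S. subspace S \<and> dim S = 2}"


section \<open>Differentiable functions\<close>

text \<open>Meant for open \<open>S\<close>: all iterated directional derivatives up to order \<open>k\<close> exist
  (in the Frechet sense) and are continuous.\<close>

fun Ck_on :: "nat \<Rightarrow> ('a::real_normed_vector \<Rightarrow> 'b::real_normed_vector) \<Rightarrow> 'a set \<Rightarrow> bool" where
  "Ck_on 0 f S \<longleftrightarrow> continuous_on S f"
| "Ck_on (Suc k) f S \<longleftrightarrow> (\<forall>x\<in>S. f differentiable (at x))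
      \<and> (\<forall>v. Ck_on k (\<lambda>x. frechet_derivative f (at x) v) S)"

definition smooth_on :: "('a::real_normed_vector \<Rightarrow> 'b::real_normed_vector) \<Rightarrow> 'a set \<Rightarrow> bool" where
  "smooth_on f S \<longleftrightarrow> (\<forall>k. Ck_on k f S)"

definition compact_supp :: "('a::topological_space \<Rightarrow> 'b::zero) \<Rightarrow> bool" where
  "compact_supp f \<longleftrightarrow> compact (closure {x. f x \<noteq> 0})"


section \<open>Local geometry of a parametrized surface\<close>

type_synonym R2 = "real \<times> real"

definition pd1 :: "(R2 \<Rightarrow> 'b::real_normed_vector) \<Rightarrow> R2 \<Rightarrow> 'b" where
  "pd1 f u = frechet_derivative f (at u) (1, 0)"

definition pd2 :: "(R2 \<Rightarrow> 'b::real_normed_vector) \<Rightarrow> R2 \<Rightarrow> 'b" where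
  "pd2 f u = frechet_derivative f (at u) (0, 1)"

definition g11 :: "(R2 \<Rightarrow> C2) \<Rightarrow> R2 \<Rightarrow> real" where
  "g11 X u = pd1 X u \<bullet> pd1 X u"

definition g12 :: "(R2 \<Rightarrow> C2) \<Rightarrow> R2 \<Rightarrow> real" where
  "g12 X u = pd1 X u \<bullet> pd2 X u"

definition g22 :: "(R2 \<Rightarrow> C2) \<Rightarrow> R2 \<Rightarrow> real" where
  "g22 X u = pd2 X u \<bullet> pd2 X u"

definition gdet :: "(R2 \<Rightarrow> C2) \<Rightarrow> R2 \<Rightarrow> real" where
  "gdet X u = g11 X u * g22 X u - (g12 X u)\<^sup>2"

definition area_el :: "(R2 \<Rightarrow> C2) \<Rightarrow> R2 \<Rightarrow> real" where
  "area_el X u = sqrt (gdet X u)"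

text \<open>Components of the gradient with respect to the induced metric, i.e.
  \<open>g\<^sup>i\<^sup>j \<partial>\<^sub>j f\<close> with the inverse of the 2x2 matrix \<open>g\<close> written out.\<close>

definition grad1 :: "(R2 \<Rightarrow> C2) \<Rightarrow> (R2 \<Rightarrow> real) \<Rightarrow> R2 \<Rightarrow> real" where
  "grad1 X f u = (g22 X u * pd1 f u - g12 X u * pd2 f u) / gdet X u"

definition grad2 :: "(R2 \<Rightarrow> C2) \<Rightarrow> (R2 \<Rightarrow> real) \<Rightarrow> R2 \<Rightarrow> real" where
  "grad2 X f u = (g11 X u * pd2 f u - g12 X u * pd1 f u) / gdet X u"

definition surf_grad :: "(R2 \<Rightarrow> C2) \<Rightarrow> (R2 \<Rightarrow> real) \<Rightarrow> R2 \<Rightarrow> C2" where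
  "surf_grad X f u = grad1 X f u *\<^sub>R pd1 X u + grad2 X f u *\<^sub>R pd2 X u"

definition surf_laplacian :: "(R2 \<Rightarrow> C2) \<Rightarrow> (R2 \<Rightarrow> real) \<Rightarrow> R2 \<Rightarrow> real" where
  "surf_laplacian X f u = (pd1 (\<lambda>w. area_el X w * grad1 X f w) u
      + pd2 (\<lambda>w. area_el X w * grad2 X f w) u) / area_el X u"

definition tangent_space :: "(R2 \<Rightarrow> C2) \<Rightarrow> R2 \<Rightarrow> C2 set" where
  "tangent_space X u = range (frechet_derivative X (at u))"

definition normal_part :: "(R2 \<Rightarrow> C2) \<Rightarrow> R2 \<Rightarrow> C2 \<Rightarrow> C2" where
  "normal_part X u v = v - closest_point (tangent_space X u) v"

text \<open>The left-hand side is the Hodge star of \<open>dz\<^sup>1 \<and> dz\<^sup>2\<close> for the orientation given by the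
  parametrization. Reversing the orientation changes the angle by a constant.\<close>

definition lagrangian_angle :: "(R2 \<Rightarrow> C2) \<Rightarrow> R2 set \<Rightarrow> (R2 \<Rightarrow> real) \<Rightarrow> bool" where
  "lagrangian_angle X W \<beta> \<longleftrightarrow> smooth_on \<beta> W \<and>
     (\<forall>u\<in>W. dz1_dz2 (pd1 X u) (pd2 X u) / complex_of_real (area_el X u) = cis (\<beta> u))"


section \<open>Immersed surfaces\<close>

text \<open>A smooth surface is a Hausdorff second countable space with an atlas, whose members are
  pairs of an open subset of the plane and a parametrization of an open subset of the
  surface. It may be disconnected and non-orientable.\<close>

type_synonym 'm atlas = "(R2 set \<times> (R2 \<Rightarrow> 'm)) set"

definition smooth_surface :: "'m topology \<Rightarrow> 'm atlas \<Rightarrow> bool" where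
  "smooth_surface M A \<longleftrightarrow> Hausdorff_space M \<and> second_countable M
     \<and> topspace M = (\<Union>(U, \<phi>)\<in>A. \<phi> ` U)
     \<and> (\<forall>(U, \<phi>)\<in>A. open U \<and> openin M (\<phi> ` U)
          \<and> homeomorphic_map (top_of_set U) (subtopology M (\<phi> ` U)) \<phi>)
     \<and> (\<forall>(U, \<phi>)\<in>A. \<forall>(W, \<psi>)\<in>A.
          smooth_on (\<lambda>u. the_inv_into W \<psi> (\<phi> u)) {u \<in> U. \<phi> u \<in> \<psi> ` W})"

text \<open>Properness excludes surfaces with punctures or edges (for instance a cone with its vertex
  removed), whose varifold would be singular although the immersion is smooth.\<close>

definition proper_immersion :: "'m topology \<Rightarrow> 'm atlas \<Rightarrow> ('m \<Rightarrow> C2) \<Rightarrow> bool" where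
  "proper_immersion M A F \<longleftrightarrow> proper_map M euclidean F
     \<and> (\<forall>(U, \<phi>)\<in>A. smooth_on (F \<circ> \<phi>) U
          \<and> (\<forall>u\<in>U. inj (frechet_derivative (F \<circ> \<phi>) (at u))))"

definition lagrangian_immersion :: "'m atlas \<Rightarrow> ('m \<Rightarrow> C2) \<Rightarrow> bool" where
  "lagrangian_immersion A F \<longleftrightarrow> (\<forall>(U, \<phi>)\<in>A. \<forall>u\<in>U.
     \<forall>v\<in>tangent_space (F \<circ> \<phi>) u. \<forall>w\<in>tangent_space (F \<circ> \<phi>) u. omega v w = 0)"

definition hamiltonian_stationary :: "'m atlas \<Rightarrow> ('m \<Rightarrow> C2) \<Rightarrow> bool" where
  "hamiltonian_stationary A F \<longleftrightarrow> (\<forall>(U, \<phi>)\<in>A. \<forall>u\<in>U. \<exists>W \<beta>.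
     open W \<and> u \<in> W \<and> W \<subseteq> U \<and> lagrangian_angle (F \<circ> \<phi>) W \<beta>
     \<and> (\<forall>w\<in>W. surf_laplacian (F \<circ> \<phi>) \<beta> w = 0))"

text \<open>\<open>F\<^sup>\<bottom> = 2 c H\<close> with \<open>H = J \<nabla>\<beta>\<close>, for one and the same \<open>c\<close> on all of the surface.\<close>

definition self_similar :: "real \<Rightarrow> 'm atlas \<Rightarrow> ('m \<Rightarrow> C2) \<Rightarrow> bool" where
  "self_similar c A F \<longleftrightarrow> (\<forall>(U, \<phi>)\<in>A. \<forall>u\<in>U. \<exists>W \<beta>.
     open W \<and> u \<in> W \<and> W \<subseteq> U \<and> lagrangian_angle (F \<circ> \<phi>) W \<beta>
     \<and> (\<forall>w\<in>W. normal_part (F \<circ> \<phi>) w (F (\<phi> w))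
              = (2 * c) *\<^sub>R cpx_J (surf_grad (F \<circ> \<phi>) \<beta> w)))"


section \<open>Varifolds\<close>

type_synonym varifold = "(C2 \<times> (C2 \<Rightarrow>\<^sub>L C2)) measure"

definition is_varifold :: "varifold \<Rightarrow> bool" where
  "is_varifold V \<longleftrightarrow> sets V = sets borel \<and> (AE z in V. snd z \<in> Gr2)
     \<and> (\<forall>K. compact K \<longrightarrow> emeasure V K < \<infinity>)"

definition weight :: "varifold \<Rightarrow> C2 measure" where
  "weight V = distr V borel fst"

definition varifold_sum :: "varifold \<Rightarrow> varifold \<Rightarrow> varifold" where
  "varifold_sum V W = measure_of UNIV (sets borel) (\<lambda>B. emeasure V B + emeasure W B)"

text \<open>The chart formula determines the area measure on the Borel sets of the surface uniquely.\<close>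

definition area_measure :: "'m topology \<Rightarrow> 'm atlas \<Rightarrow> ('m \<Rightarrow> C2) \<Rightarrow> 'm measure \<Rightarrow> bool" where
  "area_measure M A F \<mu> \<longleftrightarrow> space \<mu> = topspace M
     \<and> sets \<mu> = sigma_sets (topspace M) {N. openin M N}
     \<and> (\<forall>(U, \<phi>)\<in>A. \<forall>B\<in>sets borel. B \<subseteq> U \<longrightarrow>
          emeasure \<mu> (\<phi> ` B) = (\<integral>\<^sup>+u\<in>B. ennreal (area_el (F \<circ> \<phi>) u) \<partial>lborel))"

text \<open>The union is over coinciding planes, one for each chart around \<open>m\<close>.\<close>

definition tangent_plane :: "'m atlas \<Rightarrow> ('m \<Rightarrow> C2) \<Rightarrow> 'm \<Rightarrow> C2 set" where
  "tangent_plane A F m = \<Union>{tangent_space (F \<circ> \<phi>) u |U \<phi> u. (U, \<phi>) \<in> A \<and> u \<in> U \<and> \<phi> u = m}"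

definition immersion_varifold ::
    "'m topology \<Rightarrow> 'm atlas \<Rightarrow> ('m \<Rightarrow> C2) \<Rightarrow> varifold \<Rightarrow> bool" where
  "immersion_varifold M A F V \<longleftrightarrow> (\<exists>\<mu>. area_measure M A F \<mu>
     \<and> V = distr \<mu> borel (\<lambda>m. (F m, orth_proj (tangent_plane A F m))))"

text \<open>The carrier type of the abstract surface has the cardinality of the continuum; as second
  countable surfaces have at most that many points, every one of them has a copy carried by
  this type.\<close>

definition smooth_ham_stat_self_similar :: "real \<Rightarrow> varifold \<Rightarrow> bool" where
  "smooth_ham_stat_self_similar c V \<longleftrightarrow>
     (\<exists>(M :: (complex \<times> C2) topology) A F. smooth_surface M A \<and> proper_immersion M A F
        \<and> lagrangian_immersion A F \<and> hamiltonian_stationary A F \<and> self_similar c A F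
        \<and> immersion_varifold M A F V)"

definition smooth_ham_stat_self_shrinker :: "varifold \<Rightarrow> bool" where
  "smooth_ham_stat_self_shrinker V \<longleftrightarrow> (\<exists>c<0. smooth_ham_stat_self_similar c V)"

definition smooth_ham_stat_self_expander :: "varifold \<Rightarrow> bool" where
  "smooth_ham_stat_self_expander V \<longleftrightarrow> (\<exists>c>0. smooth_ham_stat_self_similar c V)"


section \<open>Brakke motion\<close>

text \<open>The divergence of \<open>Y\<close> along the plane with projection \<open>P\<close>, as the trace of \<open>P \<circ> DY\<close>.\<close>

definition plane_div :: "(C2 \<Rightarrow>\<^sub>L C2) \<Rightarrow> (C2 \<Rightarrow> C2) \<Rightarrow> C2 \<Rightarrow> real" where
  "plane_div P Y x = (\<Sum>b\<in>Basis. b \<bullet> P (frechet_derivative Y (at x) b))"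

definition first_variation :: "varifold \<Rightarrow> (C2 \<Rightarrow> C2) \<Rightarrow> real" where
  "first_variation V Y = (\<integral>z. plane_div (snd z) Y (fst z) \<partial>V)"

text \<open>\<open>h\<close> is the generalized mean curvature vector of \<open>V\<close>; it is determined almost
  everywhere with respect to the weight.\<close>

definition gen_mean_curvature :: "varifold \<Rightarrow> (C2 \<Rightarrow> C2) \<Rightarrow> bool" where
  "gen_mean_curvature V h \<longleftrightarrow>
     (\<forall>K. compact K \<longrightarrow> set_integrable (weight V) K h)
     \<and> (\<forall>Y. Ck_on 1 Y UNIV \<and> compact_supp Y \<longrightarrow>
          first_variation V Y = - (\<integral>x. Y x \<bullet> h x \<partial>weight V))"

definition brakke_delta :: "varifold \<Rightarrow> (C2 \<Rightarrow> real) \<Rightarrow> (C2 \<Rightarrow> C2) \<Rightarrow> ereal" where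
  "brakke_delta V \<phi> h =
     (if (\<integral>\<^sup>+x. ennreal (\<phi> x * (norm (h x))\<^sup>2) \<partial>weight V) = \<infinity> then - \<infinity>
      else ereal (- (\<integral>x. \<phi> x * (norm (h x))\<^sup>2 \<partial>weight V)
                  + (\<integral>x. frechet_derivative \<phi> (at x) (h x) \<partial>weight V)))"

definition mass_upper_derivative :: "(real \<Rightarrow> varifold) \<Rightarrow> (C2 \<Rightarrow> real) \<Rightarrow> real \<Rightarrow> ereal" where
  "mass_upper_derivative V \<phi> t = Limsup (at t)
     (\<lambda>s. ereal (((\<integral>x. \<phi> x \<partial>weight (V s)) - (\<integral>x. \<phi> x \<partial>weight (V t))) / (s - t)))"

definition brakke_test :: "(C2 \<Rightarrow> real) \<Rightarrow> bool" where
  "brakke_test \<phi> \<longleftrightarrow> Ck_on 1 \<phi> UNIV \<and> compact_supp \<phi> \<and> (\<forall>x. 0 \<le> \<phi> x)"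

text \<open>As \<open>h\<close> is unique up to null sets, quantifying over it existentially
  leaves no choice.\<close>

definition brakke_motion :: "(real \<Rightarrow> varifold) \<Rightarrow> bool" where
  "brakke_motion V \<longleftrightarrow> (\<forall>t. is_varifold (V t) \<and> (\<exists>h. gen_mean_curvature (V t) h
     \<and> (\<forall>\<phi>. brakke_test \<phi> \<longrightarrow> mass_upper_derivative V \<phi> t \<le> brakke_delta (V t) \<phi> h)))"

definition without_mass_loss :: "(real \<Rightarrow> varifold) \<Rightarrow> bool" where
  "without_mass_loss V \<longleftrightarrow> (\<forall>t. \<exists>h. gen_mean_curvature (V t) h
     \<and> (\<forall>\<phi>. brakke_test \<phi> \<longrightarrow> mass_upper_derivative V \<phi> t = brakke_delta (V t) \<phi> h))"

text \<open>Convergence of the weights as Radon measures.\<close>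

definition weights_converge :: "(real \<Rightarrow> varifold) \<Rightarrow> varifold \<Rightarrow> real filter \<Rightarrow> bool" where
  "weights_converge V V0 G \<longleftrightarrow>
     (\<forall>f :: C2 \<Rightarrow> real. continuous_on UNIV f \<and> compact_supp f \<longrightarrow>
        ((\<lambda>t. \<integral>x. f x \<partial>weight (V t)) \<longlongrightarrow> (\<integral>x. f x \<partial>weight V0)) G)"


section \<open>Schoen--Wolfson cones\<close>

definition sw_curve :: "nat \<Rightarrow> nat \<Rightarrow> real \<Rightarrow> C2" where
  "sw_curve p q \<theta> =
     (complex_of_real (sqrt (real q / real (p + q))) * cis (real p * \<theta>),
      \<i> * complex_of_real (sqrt (real p / real (p + q))) * cis (- (real q * \<theta>)))"

definition sw_cone_map :: "nat \<Rightarrow> nat \<Rightarrow> R2 \<Rightarrow> C2" where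
  "sw_cone_map p q u = fst u *\<^sub>R sw_curve p q (snd u)"

text \<open>Pushforward of the area measure of \<open>X\<close> on \<open>S\<close>. If \<open>X\<close> is injective on \<open>S\<close>, this is
  the image surface with multiplicity one.\<close>

definition param_varifold :: "R2 set \<Rightarrow> (R2 \<Rightarrow> C2) \<Rightarrow> varifold" where
  "param_varifold S X =
     distr (density (restrict_space lborel S) (\<lambda>u. ennreal (area_el X u))) borel
       (\<lambda>u. (X u, orth_proj (tangent_space X u)))"

text \<open>The multiplicity one varifold of the image of the cone under \<open>T\<close>, to be used with \<open>T\<close> in
  \<open>U2\<close>. For co-prime \<open>p\<close> and \<open>q\<close> the curve is embedded, so the parametrization is injective
  on the half-strip below, which misses only the vertex of the cone.\<close>

definition sw_cone_varifold :: "(C2 \<Rightarrow> C2) \<Rightarrow> nat \<Rightarrow> nat \<Rightarrow> varifold" where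
  "sw_cone_varifold T p q = param_varifold ({0<..} \<times> {0..<2 * pi}) (T \<circ> sw_cone_map p q)"

end

theory Submission
  imports Defs
begin

text \<open>
The surfaces. Rotating a hyperbola by the circle action \<open>(z, w) \<mapsto> (e^(ips) z, e^(-iqs) w)\<close> gives
\<open>leaf d (x, s) = (sqrt q \<phi>(x) e^(ips), i sqrt p \<psi>(x) e^(-iqs))\<close>, where \<open>\<phi>, \<psi> = e^x \<plusminus> (d/4) e^(-x)\<close>, so that
\<open>\<phi>\<^sup>2 - \<psi>\<^sup>2 = d\<close>, \<open>\<phi>' = \<psi>\<close> and \<open>\<psi>' = \<phi>\<close>. The induced metric is \<open>E (dx\<^sup>2 + pq ds\<^sup>2)\<close> with a function \<open>E\<close> of \<open>x\<close>
alone. The surface is Lagrangian with angle \<open>(p - q) s\<close>, and this angle is harmonic because, up to the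
constant \<open>pq\<close>, the coordinates are isothermal. Two identities carry everything else. The mean curvature
vector is the value of one explicit vector field \<open>curvature\<close>, the same for all \<open>d\<close>
(\<open>curvature_leaf\<close>). The normal part of the position vector is a multiple of it, with the constant
factor \<open>- d pq / (p - q)\<close> (\<open>position_leaf\<close>, \<open>leaf_normal_component\<close>). Hence \<open>V\<^sub>t\<close>, the varifold of parameter
\<open>d = delta t = - 2 t (p - q) / (pq)\<close>, satisfies \<open>F\<^sup>\<bottom> = 2 t H\<close>: it shrinks for \<open>t < 0\<close> and expands for \<open>t > 0\<close>.

The limit. For \<open>d \<noteq> 0\<close> the reflection of \<open>x\<close> about \<open>ln (\<bar>d\<bar> / 4) / 2\<close> changes the sign of \<open>\<psi>\<close> if \<open>d > 0\<close> and of \<open>\<phi>\<close> if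
\<open>d < 0\<close>. So the two sheets with signs \<open>(1, 1)\<close> and \<open>(-1, -1)\<close>, cut at the fixed line of the reflection, are
four pieces, one for each pair of signs, and as \<open>d \<rightarrow> 0\<close> from either side they converge to the four
sheets \<open>(\<plusminus> sqrt q e^(x + ips), \<plusminus> i sqrt p e^(x - iqs))\<close> (\<open>weight_tendsto_cone\<close>). The half turn \<open>s \<mapsto> s + \<pi>\<close> multiplies
the signs by \<open>((-1)^p, (-1)^q)\<close>, which is not \<open>(1, 1)\<close> as \<open>p\<close> and \<open>q\<close> are coprime. It identifies the four
sheets in pairs, and they amount to the cone and one further diagonal image of it (\<open>cone_union_weight\<close>).

The Brakke equality. The divergence theorem in the coordinates \<open>(x, s)\<close> shows that \<open>curvature\<close> is the
generalized mean curvature for every \<open>d\<close>, including the cone, where the boundary term at the vertex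
tends to \<open>0\<close> like \<open>e^x\<close> (\<open>leaf_divergence_theorem\<close>). For \<open>t \<noteq> 0\<close> the mass \<open>\<parallel>V\<^sub>s\<parallel>(f)\<close> is, by scaling,
\<open>(s/t) \<integral> f(sqrt(s/t) x) d\<parallel>V\<^sub>t\<parallel>\<close>. Its derivative at \<open>s = t\<close> is turned into the right-hand side of the Brakke
inequality by the first variation along \<open>f(x) x\<close> (\<open>weight_balance\<close>, \<open>mass_derivative\<close>). At \<open>t = 0\<close>
l'Hopital's rule reduces the claim to the limit of that right-hand side as \<open>t \<rightarrow> 0\<close>. The term \<open>\<integral> Df h\<close>
converges. If \<open>f(0) = 0\<close>, then \<open>\<integral> f \<bar>h\<bar>\<^sup>2\<close> converges as well, since \<open>f = O(\<bar>x\<bar>)\<close>. If \<open>f(0) > 0\<close>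
and \<open>p \<noteq> q\<close>, it tends to infinity, because \<open>\<bar>h\<bar>\<^sup>2\<close> is comparable to \<open>\<bar>x\<bar>\<^sup>-\<^sup>2\<close>, and both sides are
\<open>-\<infinity>\<close> (\<open>mass_upper_derivative_eq\<close>).

Smoothness. Depending on the parities of \<open>p\<close> and \<open>q\<close> and the sign of \<open>d\<close>, the half turn
makes the surface an annulus or two Moebius bands,
and its core circles may be covered several times, so the leaf is only immersed. It becomes embedded in
\<open>S\<^sup>1 \<times> \<complex>\<^sup>2\<close> once the extra coordinate \<open>e^(2is)\<close> is recorded (\<open>lift\<close>), and the projection to \<open>\<complex>\<^sup>2\<close> is the
immersion. If \<open>p = q\<close>, hence \<open>p = q = 1\<close>, the field \<open>curvature\<close> vanishes and the motion is static; the
cones are then two Lagrangian planes in polar coordinates.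
\<close>


section \<open>Orthogonal projections onto planes\<close>

lemma closest_point_subspace_eqI:
  fixes S :: "'a::euclidean_space set"
  assumes "subspace S" "y \<in> S" "\<And>z. z \<in> S \<Longrightarrow> (v - y) \<bullet> z = 0"
  shows "closest_point S v = y"
proof -
  have "dist v y \<le> dist v z" if "z \<in> S" for z
  proof -
    have "y - z \<in> S" using assms that by (simp add: subspace_diff)
    then have "(v - y) \<bullet> (y - z) = 0" using assms by blast
    then have "(norm (v - z))\<^sup>2 = (norm (v - y))\<^sup>2 + (norm (y - z))\<^sup>2"
      using norm_add_Pythagorean[of "v - y" "y - z"] by (simp add: orthogonal_def)
    then show ?thesis
      by (metis dist_norm le_add_same_cancel1 norm_ge_zero power2_le_imp_le zero_le_power2)
  qed
  then show ?thesis
    using closest_point_unique[of S y v] assms closed_subspace subspace_imp_convex by metis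
qed

definition plane_proj :: "C2 \<Rightarrow> C2 \<Rightarrow> C2 \<Rightarrow> C2" where
  "plane_proj a b v = ((v \<bullet> a) / (a \<bullet> a)) *\<^sub>R a + ((v \<bullet> b) / (b \<bullet> b)) *\<^sub>R b"

lemma closest_point_orthogonal_span:
  fixes a b :: C2
  assumes "a \<bullet> b = 0" "a \<noteq> 0" "b \<noteq> 0"
  shows "closest_point (span {a, b}) = plane_proj a b"
proof
  fix v
  have ba: "b \<bullet> a = 0" using assms by (simp add: inner_commute)
  have 1: "(v - plane_proj a b v) \<bullet> a = 0" "(v - plane_proj a b v) \<bullet> b = 0"
    using assms ba by (simp_all add: plane_proj_def inner_diff_left inner_add_left)
  show "closest_point (span {a, b}) v = plane_proj a b v"
  proof (rule closest_point_subspace_eqI)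
    show "plane_proj a b v \<in> span {a, b}"
      unfolding plane_proj_def by (intro span_add span_scale span_base) auto
    fix z assume "z \<in> span {a, b}"
    then obtain k l where "z = k *\<^sub>R a + l *\<^sub>R b"
      by (auto simp: span_insert algebra_simps)
    then show "(v - plane_proj a b v) \<bullet> z = 0" using 1 by (simp add: inner_add_right)
  qed auto
qed

lemma bounded_linear_plane_proj: "bounded_linear (plane_proj a b)"
  unfolding plane_proj_def divide_inverse by (intro bounded_linear_intros)

lemma orth_proj_orthogonal_span:
  assumes "a \<bullet> b = 0" "a \<noteq> 0" "b \<noteq> 0"
  shows "blinfun_apply (orth_proj (span {a, b})) = plane_proj a b"
  unfolding orth_proj_def closest_point_orthogonal_span[OF assms]
  using bounded_linear_plane_proj by (simp add: bounded_linear_Blinfun_apply)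

lemma orth_proj_Gr2:
  assumes "a \<bullet> b = 0" "a \<noteq> 0" "b \<noteq> 0"
  shows "orth_proj (span {a, b}) \<in> Gr2"
proof -
  have "pairwise orthogonal {a, b}" using assms
    by (auto simp: pairwise_def orthogonal_def inner_commute)
  then have "independent {a, b}" by (rule pairwise_orthogonal_independent) (use assms in auto)
  moreover have "a \<noteq> b" using assms by auto
  ultimately have "dim (span {a, b}) = 2"
    by (simp add: dim_eq_card_independent)
  then show ?thesis unfolding Gr2_def by auto
qed

text \<open>The trace of \<open>P \<circ> DY\<close> may be computed in any orthogonal basis; this one is adapted to the plane.\<close>

lemma plane_div_orthogonal_span:
  assumes "a \<bullet> b = 0" "a \<noteq> 0" "b \<noteq> 0" and "Y differentiable (at x)"
  shows "plane_div (orth_proj (span {a, b})) Y x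
     = (frechet_derivative Y (at x) a \<bullet> a) / (a \<bullet> a) + (frechet_derivative Y (at x) b \<bullet> b) / (b \<bullet> b)"
proof -
  let ?D = "frechet_derivative Y (at x)"
  have lin: "linear ?D" using assms(4) linear_frechet_derivative by blast
  have exp: "?D c \<bullet> c = (\<Sum>e\<in>Basis. (e \<bullet> c) * (?D e \<bullet> c))" for c :: C2
  proof -
    have "?D c = ?D (\<Sum>e\<in>Basis. (c \<bullet> e) *\<^sub>R e)" by (simp add: euclidean_representation)
    also have "\<dots> = (\<Sum>e\<in>Basis. (c \<bullet> e) *\<^sub>R ?D e)"
      by (simp add: linear_sum[OF lin] linear_cmul[OF lin])
    finally show ?thesis by (simp add: inner_sum_left) (simp add: inner_commute)
  qed
  show ?thesis
    unfolding plane_div_def orth_proj_orthogonal_span[OF assms(1-3)] plane_proj_def exp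
    by (simp add: inner_add_right sum.distrib sum_divide_distrib mult.commute)
qed

section \<open>The family of surfaces\<close>

text \<open>The pair parametrizes the hyperbola \<open>\<phi>\<^sup>2 - \<psi>\<^sup>2 = d\<close> for both signs of \<open>d\<close>, and the ray \<open>\<phi> = \<psi>\<close> for \<open>d = 0\<close>; the
limit \<open>d \<rightarrow> 0\<close> is therefore a limit in one fixed coordinate.\<close>

definition phi :: "real \<Rightarrow> real \<Rightarrow> real" where "phi d x = exp x + d / 4 * exp (- x)"
definition psi :: "real \<Rightarrow> real \<Rightarrow> real" where "psi d x = exp x - d / 4 * exp (- x)"

lemma phi_psi_square: "(phi d x)\<^sup>2 - (psi d x)\<^sup>2 = d"
  by (simp add: phi_def psi_def power2_eq_square algebra_simps flip: exp_add)

lemma phi_square_add_psi_square: "(phi d x)\<^sup>2 + (psi d x)\<^sup>2 = 2 * exp (2 * x) + d\<^sup>2 / 8 * exp (- 2 * x)"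
  by (simp add: phi_def psi_def power2_eq_square algebra_simps flip: exp_add)

lemma has_real_derivative_phi: "(phi d has_real_derivative psi d x) (at x)"
  unfolding phi_def[abs_def] psi_def by (auto intro!: derivative_eq_intros simp: algebra_simps)

lemma has_real_derivative_psi: "(psi d has_real_derivative phi d x) (at x)"
  unfolding psi_def[abs_def] phi_def by (auto intro!: derivative_eq_intros simp: algebra_simps)

locale sw =
  fixes p q :: nat
  assumes p_pos: "0 < p" and q_pos: "0 < q"
begin

abbreviation (input) "rp \<equiv> sqrt (real p)"
abbreviation (input) "rq \<equiv> sqrt (real q)"

text \<open>The signs \<open>\<sigma>\<close> select one of the sheets over the same coordinate strip.\<close>

definition leaf :: "real \<Rightarrow> real \<times> real \<Rightarrow> R2 \<Rightarrow> C2" where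
  "leaf d \<sigma> u = (of_real (fst \<sigma> * rq * phi d (fst u)) * cis (real p * snd u),
                 \<i> * of_real (snd \<sigma> * rp * psi d (fst u)) * cis (- (real q * snd u)))"

text \<open>The partial derivatives of the leaf: \<open>leaf1\<close> is taken in \<open>x\<close> and \<open>leaf2\<close> in \<open>s\<close>.\<close>

definition leaf1 :: "real \<Rightarrow> real \<times> real \<Rightarrow> R2 \<Rightarrow> C2" where
  "leaf1 d \<sigma> u = (of_real (fst \<sigma> * rq * psi d (fst u)) * cis (real p * snd u),
                  \<i> * of_real (snd \<sigma> * rp * phi d (fst u)) * cis (- (real q * snd u)))"

definition leaf2 :: "real \<Rightarrow> real \<times> real \<Rightarrow> R2 \<Rightarrow> C2" where
  "leaf2 d \<sigma> u = (\<i> * of_real (real p * (fst \<sigma> * rq * phi d (fst u))) * cis (real p * snd u),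
                  of_real (real q * (snd \<sigma> * rp * psi d (fst u))) * cis (- (real q * snd u)))"

text \<open>The conformal factor \<open>E\<close> of the metric \<open>E (dx\<^sup>2 + pq ds\<^sup>2)\<close>.\<close>

definition energy :: "real \<Rightarrow> real \<Rightarrow> real" where
  "energy d x = real p * (phi d x)\<^sup>2 + real q * (psi d x)\<^sup>2"

definition signs :: "(real \<times> real) set" where "signs = {1, -1} \<times> {1, -1}"

lemma signs_square: "\<sigma> \<in> signs \<Longrightarrow> fst \<sigma> * fst \<sigma> = 1 \<and> snd \<sigma> * snd \<sigma> = 1"
  by (auto simp: signs_def)

lemma has_derivative_leaf:
  "(leaf d \<sigma> has_derivative (\<lambda>h. fst h *\<^sub>R leaf1 d \<sigma> u + snd h *\<^sub>R leaf2 d \<sigma> u)) (at u)"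
proof -
  have phi: "((\<lambda>u. phi d (fst u)) has_derivative (\<lambda>h. fst h * psi d (fst u))) (at u)" for u :: R2
    using has_derivative_compose[of "\<lambda>u. fst u" fst u UNIV "phi d" "(*) (psi d (fst u))"] has_real_derivative_phi[of d "fst u"]
      has_derivative_fst[OF has_derivative_ident, of "at u"]
    by (simp add: has_field_derivative_def mult.commute)
  have psi: "((\<lambda>u. psi d (fst u)) has_derivative (\<lambda>h. fst h * phi d (fst u))) (at u)" for u :: R2
    using has_derivative_compose[of "\<lambda>u. fst u" fst u UNIV "psi d" "(*) (phi d (fst u))"] has_real_derivative_psi[of d "fst u"]
      has_derivative_fst[OF has_derivative_ident, of "at u"]
    by (simp add: has_field_derivative_def mult.commute)
  have cis: "((\<lambda>u. cis (c * snd u)) has_derivative (\<lambda>h. (c * snd h) *\<^sub>R (\<i> * cis (c * snd u)))) (at u)"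
    for u :: R2 and c
  proof -
    have 1: "((\<lambda>u::R2. c * snd u) has_derivative (\<lambda>h. c * snd h)) (at u)"
      by (auto intro!: derivative_eq_intros)
    show ?thesis
      using has_derivative_compose[OF 1 has_derivative_cis[OF has_derivative_ident]]
      by (simp add: scaleR_conv_of_real mult_ac)
  qed
  have comp: "((\<lambda>u. of_real (c * f (fst u)) * cis (k * snd u)) has_derivative
      (\<lambda>h. fst h *\<^sub>R (of_real (c * f') * cis (k * snd u))
         + snd h *\<^sub>R (\<i> * of_real (k * (c * f (fst u))) * cis (k * snd u)))) (at u)"
    if "((\<lambda>u. f (fst u)) has_derivative (\<lambda>h. fst h * f')) (at u)" for f f' c k and u :: R2
    by (rule has_derivative_eq_rhs[OF has_derivative_mult[OF
          has_derivative_of_real[OF has_derivative_mult_right[OF that]] cis]])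
       (simp add: fun_eq_iff scaleR_conv_of_real algebra_simps)
  show ?thesis
    unfolding leaf_def leaf1_def leaf2_def
    using has_derivative_Pair[OF comp[OF phi, of "fst \<sigma> * rq" "real p" u]
        has_derivative_mult_right[OF comp[OF psi, of "snd \<sigma> * rp" "- real q" u], of \<i>]]
    by (simp add: algebra_simps)
qed

lemma frechet_leaf:
  "frechet_derivative (leaf d \<sigma>) (at u) = (\<lambda>h. fst h *\<^sub>R leaf1 d \<sigma> u + snd h *\<^sub>R leaf2 d \<sigma> u)"
  by (rule frechet_derivative_at[OF has_derivative_leaf, symmetric])

lemma pd_leaf: "pd1 (leaf d \<sigma>) u = leaf1 d \<sigma> u" "pd2 (leaf d \<sigma>) u = leaf2 d \<sigma> u"
  by (simp_all add: pd1_def pd2_def frechet_leaf)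

lemma inner_of_real_cis:
  "(complex_of_real a * cis t) \<bullet> (complex_of_real b * cis t) = a * b"
  "(\<i> * complex_of_real a * cis t) \<bullet> (\<i> * complex_of_real b * cis t) = a * b"
  "(\<i> * complex_of_real a * cis t) \<bullet> (complex_of_real b * cis t) = 0"
  "(complex_of_real a * cis t) \<bullet> (\<i> * complex_of_real b * cis t) = 0"
proof -
  have *: "x * (cos t)\<^sup>2 + x * (sin t)\<^sup>2 = x" for x
    by (metis distrib_left mult.right_neutral sin_cos_squared_add2)
  show "(complex_of_real a * cis t) \<bullet> (complex_of_real b * cis t) = a * b"
    "(\<i> * complex_of_real a * cis t) \<bullet> (\<i> * complex_of_real b * cis t) = a * b"
    using *[of "a * b"] by (simp_all add: inner_complex_def power2_eq_square algebra_simps)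
qed (simp_all add: inner_complex_def)

lemma energy_pos: "0 < energy d x"
proof -
  have "0 < (phi d x)\<^sup>2 + (psi d x)\<^sup>2"
    unfolding phi_square_add_psi_square by (simp add: add_pos_nonneg)
  then show ?thesis unfolding energy_def
    by (smt (verit) mult_pos_pos of_nat_0_less_iff p_pos q_pos zero_le_power2 mult_nonneg_nonneg)
qed

lemma sqrt_mult_sqrt_mult: "rp * (rp * x) = real p * x" "rq * (rq * x) = real q * x"
  by (simp_all flip: mult.assoc)

lemma leaf_inner:
  assumes "\<sigma> \<in> signs"
  shows "leaf1 d \<sigma> u \<bullet> leaf2 d \<sigma> u = 0"
    and "leaf1 d \<sigma> u \<bullet> leaf1 d \<sigma> u = energy d (fst u)"
    and "leaf2 d \<sigma> u \<bullet> leaf2 d \<sigma> u = real p * real q * energy d (fst u)"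
    and "leaf d \<sigma> u \<bullet> leaf d \<sigma> u = real q * (phi d (fst u))\<^sup>2 + real p * (psi d (fst u))\<^sup>2"
    and "leaf d \<sigma> u \<bullet> leaf1 d \<sigma> u = (real p + real q) * phi d (fst u) * psi d (fst u)"
    and "leaf d \<sigma> u \<bullet> leaf2 d \<sigma> u = 0"
  using assms
  unfolding leaf_def leaf1_def leaf2_def inner_Pair inner_of_real_cis energy_def
  by (auto simp: signs_def power2_eq_square algebra_simps sqrt_mult_sqrt_mult)

lemma leaf_nonzero:
  assumes "\<sigma> \<in> signs"
  shows "leaf1 d \<sigma> u \<noteq> 0" "leaf2 d \<sigma> u \<noteq> 0" "leaf d \<sigma> u \<noteq> 0"
proof -
  have "leaf2 d \<sigma> u \<bullet> leaf2 d \<sigma> u \<noteq> 0" "leaf1 d \<sigma> u \<bullet> leaf1 d \<sigma> u \<noteq> 0"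
    using energy_pos[of d "fst u"] p_pos q_pos by (simp_all add: leaf_inner[OF assms])
  then show "leaf1 d \<sigma> u \<noteq> 0" "leaf2 d \<sigma> u \<noteq> 0" by auto
  have "0 < energy d (fst u)" by (rule energy_pos)
  then have "phi d (fst u) \<noteq> 0 \<or> psi d (fst u) \<noteq> 0" by (auto simp: energy_def)
  then have "leaf d \<sigma> u \<bullet> leaf d \<sigma> u > 0"
    unfolding leaf_inner[OF assms] using p_pos q_pos
    by (auto intro: add_pos_nonneg add_nonneg_pos)
  then show "leaf d \<sigma> u \<noteq> 0" by auto
qed

lemma tangent_space_leaf: "tangent_space (leaf d \<sigma>) u = span {leaf1 d \<sigma> u, leaf2 d \<sigma> u}"
  unfolding tangent_space_def frechet_leaf
  by (auto simp: span_insert algebra_simps image_iff) (metis add.commute diff_add_cancel fst_conv snd_conv)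

lemma metric_leaf:
  assumes "\<sigma> \<in> signs"
  shows "g11 (leaf d \<sigma>) u = energy d (fst u)" "g12 (leaf d \<sigma>) u = 0"
    "g22 (leaf d \<sigma>) u = real p * real q * energy d (fst u)"
    "gdet (leaf d \<sigma>) u = p * q * (energy d (fst u))\<^sup>2"
    "area_el (leaf d \<sigma>) u = sqrt (real p * real q) * energy d (fst u)"
  using energy_pos[of d "fst u"]
  by (simp_all add: area_el_def gdet_def g11_def g12_def g22_def pd_leaf leaf_inner[OF assms]
      real_sqrt_mult power2_eq_square)

text \<open>On each leaf the scalar factor is \<open>(p - q) / (pq E)\<close> and the vector is \<open>J\<close> applied to the generator of the circle
action, so the value is \<open>J \<nabla>\<beta>\<close> for the angle \<open>\<beta> = (p - q) s\<close>. Written in terms of the point, it does not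
mention the leaf.\<close>

definition curvature :: "C2 \<Rightarrow> C2" where
  "curvature z = ((real p - real q) / ((real p)\<^sup>2 * (norm (fst z))\<^sup>2 + (real q)\<^sup>2 * (norm (snd z))\<^sup>2))
      *\<^sub>R (- (real p *\<^sub>R fst z), real q *\<^sub>R snd z)"

lemma norm_leaf_components:
  assumes "\<sigma> \<in> signs"
  shows "(norm (fst (leaf d \<sigma> u)))\<^sup>2 = real q * (phi d (fst u))\<^sup>2"
    "(norm (snd (leaf d \<sigma> u)))\<^sup>2 = real p * (psi d (fst u))\<^sup>2"
  using assms by (auto simp: leaf_def signs_def norm_mult power_mult_distrib)

lemma cpx_J_leaf2: "cpx_J (leaf2 d \<sigma> u)
  = (of_real (- real p * (fst \<sigma> * rq * phi d (fst u))) * cis (real p * snd u),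
     \<i> * of_real (real q * (snd \<sigma> * rp * psi d (fst u))) * cis (- (real q * snd u)))"
  by (simp add: cpx_J_def leaf2_def) (simp flip: mult.assoc)

lemma curvature_leaf:
  assumes "\<sigma> \<in> signs"
  shows "curvature (leaf d \<sigma> u)
    = ((real p - real q) / (real p * real q * energy d (fst u))) *\<^sub>R cpx_J (leaf2 d \<sigma> u)"
proof -
  have 1: "(real p)\<^sup>2 * (norm (fst (leaf d \<sigma> u)))\<^sup>2 + (real q)\<^sup>2 * (norm (snd (leaf d \<sigma> u)))\<^sup>2
     = real p * real q * energy d (fst u)"
    unfolding norm_leaf_components[OF assms] energy_def by (simp add: power2_eq_square algebra_simps)
  have 2: "(- (real p *\<^sub>R fst (leaf d \<sigma> u)), real q *\<^sub>R snd (leaf d \<sigma> u)) = cpx_J (leaf2 d \<sigma> u)"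
    by (simp add: cpx_J_leaf2 leaf_def scaleR_conv_of_real mult_ac)
  show ?thesis unfolding curvature_def 1 2 ..
qed

text \<open>Adding the right multiple of the normal vector \<open>J leaf2\<close> to the position gives a tangent vector. After the
common phases are removed this is an identity between \<open>\<phi>\<close> and \<open>\<psi>\<close> that uses only \<open>\<phi>\<^sup>2 - \<psi>\<^sup>2 = d\<close>.\<close>

lemma position_leaf:
  assumes "\<sigma> \<in> signs"
  shows "leaf d \<sigma> u + (d / energy d (fst u)) *\<^sub>R cpx_J (leaf2 d \<sigma> u)
      = ((real p + real q) * phi d (fst u) * psi d (fst u) / energy d (fst u)) *\<^sub>R leaf1 d \<sigma> u"
proof -
  let ?e = "energy d (fst u)" and ?a = "phi d (fst u)" and ?b = "psi d (fst u)"
  have "a - d / e * (real p * a) = (real p + real q) * a * b / e * b \<and>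
      b + d / e * (real q * b) = (real p + real q) * a * b / e * a"
    if "a\<^sup>2 - b\<^sup>2 = d" "e = real p * a\<^sup>2 + real q * b\<^sup>2" "e \<noteq> 0" for a b e :: real
  proof -
    have "a * e - d * (real p * a) = (real p + real q) * a * b * b"
      "b * e + d * (real q * b) = (real p + real q) * a * b * a"
      unfolding that(2) that(1)[symmetric] by (simp_all add: power2_eq_square algebra_simps)
    with that(3) show ?thesis by (auto simp: divide_simps algebra_simps)
  qed
  from this[OF phi_psi_square energy_def] energy_pos[of d "fst u"]
  have 1: "?a - d / ?e * (real p * ?a) = (real p + real q) * ?a * ?b / ?e * ?b"
    and 2: "?b + d / ?e * (real q * ?b) = (real p + real q) * ?a * ?b / ?e * ?a"
    by (metis less_irrefl)+
  define K L where "K = d / ?e" and "L = (real p + real q) * ?a * ?b / ?e"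
  have 1: "?a - K * (real p * ?a) = L * ?b" and 2: "?b + K * (real q * ?b) = L * ?a"
    unfolding K_def L_def by (fact 1, fact 2)
  have "fst (leaf d \<sigma> u + K *\<^sub>R cpx_J (leaf2 d \<sigma> u))
     = of_real (fst \<sigma> * rq * (?a - K * (real p * ?a))) * cis (real p * snd u)"
    by (simp add: leaf_def cpx_J_leaf2 scaleR_conv_of_real algebra_simps)
  moreover have "snd (leaf d \<sigma> u + K *\<^sub>R cpx_J (leaf2 d \<sigma> u))
     = \<i> * of_real (snd \<sigma> * rp * (?b + K * (real q * ?b))) * cis (- (real q * snd u))"
    by (simp add: leaf_def cpx_J_leaf2 scaleR_conv_of_real algebra_simps)
  ultimately have "leaf d \<sigma> u + K *\<^sub>R cpx_J (leaf2 d \<sigma> u) = L *\<^sub>R leaf1 d \<sigma> u"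
    unfolding 1 2 by (intro prod_eqI) (simp_all add: leaf1_def scaleR_conv_of_real mult_ac)
  then show ?thesis unfolding K_def L_def .
qed

lemma omega_eq_inner: "omega v w = cpx_J v \<bullet> w"
  by (simp add: omega_def cpx_J_def inner_complex_def inner_prod_def)

lemma inner_J_leaf2:
  assumes "\<sigma> \<in> signs"
  shows "leaf1 d \<sigma> u \<bullet> cpx_J (leaf2 d \<sigma> u) = 0" "leaf2 d \<sigma> u \<bullet> cpx_J (leaf2 d \<sigma> u) = 0"
    "leaf d \<sigma> u \<bullet> cpx_J (leaf2 d \<sigma> u) = - (real p * real q * d)"
proof -
  have d: "d = (phi d (fst u))\<^sup>2 - (psi d (fst u))\<^sup>2" by (simp add: phi_psi_square)
  show "leaf d \<sigma> u \<bullet> cpx_J (leaf2 d \<sigma> u) = - (real p * real q * d)"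
    apply (subst (3) d)
    unfolding cpx_J_leaf2 leaf_def inner_Pair inner_of_real_cis
    using assms by (auto simp: signs_def power2_eq_square algebra_simps sqrt_mult_sqrt_mult)
  show "leaf1 d \<sigma> u \<bullet> cpx_J (leaf2 d \<sigma> u) = 0" "leaf2 d \<sigma> u \<bullet> cpx_J (leaf2 d \<sigma> u) = 0"
    unfolding cpx_J_leaf2 unfolding leaf1_def leaf2_def inner_Pair inner_of_real_cis
    using assms by (auto simp: signs_def algebra_simps sqrt_mult_sqrt_mult)
qed

text \<open>The phase \<open>e^(i(p - q)s)\<close> is the Lagrangian angle. For opposite signs the right-hand side changes sign, which
would shift the angle by \<open>\<pi>\<close>.\<close>

lemma dz1_dz2_leaf:
  assumes "\<sigma> \<in> signs" "fst \<sigma> = snd \<sigma>"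
  shows "dz1_dz2 (leaf1 d \<sigma> u) (leaf2 d \<sigma> u)
   = of_real (sqrt (real p * real q) * energy d (fst u)) * cis ((real p - real q) * snd u)"
proof -
  have c: "cis ((real p - real q) * snd u) = cis (real p * snd u) * cis (- (real q * snd u))"
    by (simp add: cis_mult algebra_simps)
  have "(A * C) * (B * D) - (\<i> * A' * C) * (\<i> * B' * D) = (A * B + A' * B') * (C * D)"
    for A B A' B' C D :: complex by (simp add: algebra_simps)
  note 1 = this[of "of_real (fst \<sigma> * rq * psi d (fst u))" "cis (real p * snd u)"
      "of_real (real q * (snd \<sigma> * rp * psi d (fst u)))" "cis (- (real q * snd u))"
      "of_real (real p * (fst \<sigma> * rq * phi d (fst u)))" "of_real (snd \<sigma> * rp * phi d (fst u))"]
  have 2: "(fst \<sigma> * rq * psi d (fst u)) * (real q * (snd \<sigma> * rp * psi d (fst u)))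
      + (real p * (fst \<sigma> * rq * phi d (fst u))) * (snd \<sigma> * rp * phi d (fst u))
      = sqrt (real p * real q) * energy d (fst u)"
    using assms by (auto simp: signs_def energy_def real_sqrt_mult power2_eq_square algebra_simps)
  show ?thesis unfolding c dz1_dz2_def leaf1_def leaf2_def fst_conv snd_conv 2[symmetric]
    unfolding 1 by (simp only: of_real_add of_real_mult)
qed

end

section \<open>Finite sums of measures\<close>

text \<open>The measure \<open>c \<Sum>\<^sub>i f\<^sub>i\<close>, for measures \<open>f\<^sub>i\<close> on the sigma-algebra of \<open>N\<close>. The factor \<open>c = 1/2\<close> compensates for
parametrizations that cover a surface twice.\<close>

definition sum_measure :: "real \<Rightarrow> 'i set \<Rightarrow> 'a measure \<Rightarrow> ('i \<Rightarrow> 'a measure) \<Rightarrow> 'a measure" where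
  "sum_measure c I N f = measure_of (space N) (sets N) (\<lambda>B. ennreal c * (\<Sum>i\<in>I. emeasure (f i) B))"

lemma space_sum_measure [simp]: "space (sum_measure c I N f) = space N"
  by (simp add: sum_measure_def sets.space_closed space_measure_of)

lemma sets_sum_measure [simp, measurable_cong]: "sets (sum_measure c I N f) = sets N"
  by (simp add: sum_measure_def)

lemma emeasure_sum_measure:
  assumes "\<And>i. i \<in> I \<Longrightarrow> sets (f i) = sets N" "B \<in> sets N"
  shows "emeasure (sum_measure c I N f) B = ennreal c * (\<Sum>i\<in>I. emeasure (f i) B)"
proof (rule emeasure_measure_of[OF sum_measure_def])
  show "countably_additive (sets (sum_measure c I N f)) (\<lambda>B. ennreal c * (\<Sum>i\<in>I. emeasure (f i) B))"
  proof (rule countably_additiveI)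
    fix A :: "nat \<Rightarrow> 'b set"
    assume A: "range A \<subseteq> sets (sum_measure c I N f)" "disjoint_family A"
    have "(\<Sum>n. \<Sum>i\<in>I. emeasure (f i) (A n)) = (\<Sum>i\<in>I. \<Sum>n. emeasure (f i) (A n))"
      by (rule suminf_sum) auto
    also have "\<dots> = (\<Sum>i\<in>I. emeasure (f i) (\<Union>n. A n))"
      by (rule sum.cong[OF refl], rule suminf_emeasure) (use A assms(1) in auto)
    finally show "(\<Sum>n. ennreal c * (\<Sum>i\<in>I. emeasure (f i) (A n)))
        = ennreal c * (\<Sum>i\<in>I. emeasure (f i) (\<Union>n. A n))"
      by simp
  qed
qed (use assms in \<open>auto simp: positive_def sets.space_closed\<close>)

lemma nn_integral_sum_measure:
  assumes sets: "\<And>i. i \<in> I \<Longrightarrow> sets (f i) = sets N" and "g \<in> borel_measurable N"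
  shows "(\<integral>\<^sup>+x. g x \<partial>sum_measure c I N f) = ennreal c * (\<Sum>i\<in>I. \<integral>\<^sup>+x. g x \<partial>f i)"
  using assms(2)
proof induct
  case (cong h g)
  have "(\<integral>\<^sup>+x. h x \<partial>f i) = (\<integral>\<^sup>+x. g x \<partial>f i)" if "i \<in> I" for i
    by (rule nn_integral_cong) (use cong sets_eq_imp_space_eq[OF sets[OF that]] in auto)
  moreover have "(\<integral>\<^sup>+x. h x \<partial>sum_measure c I N f) = (\<integral>\<^sup>+x. g x \<partial>sum_measure c I N f)"
    by (rule nn_integral_cong) (use cong in auto)
  ultimately show ?case using cong by simp
next
  case (set A)
  then show ?case by (simp add: emeasure_sum_measure[OF sets] sets)
next
  case (mult h k)
  have "(\<integral>\<^sup>+x. k * h x \<partial>f i) = k * (\<integral>\<^sup>+x. h x \<partial>f i)" if "i \<in> I" for i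
    by (rule nn_integral_cmult) (auto simp: measurable_cong_sets[OF sets[OF that] refl] intro: mult.hyps)
  then show ?case using mult
    by (simp add: nn_integral_cmult sum_distrib_left mult.left_commute)
next
  case (add h k)
  have "(\<integral>\<^sup>+x. k x + h x \<partial>f i) = (\<integral>\<^sup>+x. k x \<partial>f i) + (\<integral>\<^sup>+x. h x \<partial>f i)" if "i \<in> I" for i
    by (rule nn_integral_add) (auto simp: measurable_cong_sets[OF sets[OF that] refl] intro: add.hyps)
  then show ?case using add
    by (simp add: nn_integral_add sum.distrib distrib_left)
next
  case (seq U)
  have "(\<integral>\<^sup>+x. (SUP n. U n x) \<partial>f i) = (SUP n. \<integral>\<^sup>+x. U n x \<partial>f i)" if "i \<in> I" for i
    by (rule nn_integral_monotone_convergence_SUP)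
       (auto simp: measurable_cong_sets[OF sets[OF that] refl] intro: seq.hyps)
  moreover have "(\<integral>\<^sup>+x. (SUP n. U n x) \<partial>sum_measure c I N f)
      = (SUP n. \<integral>\<^sup>+x. U n x \<partial>sum_measure c I N f)"
    by (rule nn_integral_monotone_convergence_SUP) (use seq in auto)
  moreover have "(SUP n. \<Sum>i\<in>I. \<integral>\<^sup>+x. U n x \<partial>f i) = (\<Sum>i\<in>I. SUP n. \<integral>\<^sup>+x. U n x \<partial>f i)"
    by (rule ennreal_SUP_sum) (use \<open>incseq U\<close> in \<open>auto simp: incseq_def le_fun_def intro!: nn_integral_mono\<close>)
  ultimately show ?case using seq
    by (simp add: image_comp SUP_mult_left_ennreal[symmetric])
qed

lemma integrable_sum_measure:
  fixes g :: "'a \<Rightarrow> 'b::{banach, second_countable_topology}"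
  assumes sets: "\<And>i. i \<in> I \<Longrightarrow> sets (f i) = sets N" and "g \<in> borel_measurable N" and "finite I"
    and int: "\<And>i. i \<in> I \<Longrightarrow> integrable (f i) g"
  shows "integrable (sum_measure c I N f) g"
  using assms by (auto simp: integrable_iff_bounded nn_integral_sum_measure ennreal_mult_less_top)

lemma integral_sum_measure:
  fixes g :: "'a \<Rightarrow> real"
  assumes sets: "\<And>i. i \<in> I \<Longrightarrow> sets (f i) = sets N" and g: "g \<in> borel_measurable N" and "finite I"
    and int: "\<And>i. i \<in> I \<Longrightarrow> integrable (f i) g" and "0 \<le> c"
  shows "(\<integral>x. g x \<partial>sum_measure c I N f) = c * (\<Sum>i\<in>I. \<integral>x. g x \<partial>f i)"
proof -
  have *: "enn2real (\<integral>\<^sup>+x. ennreal (h x) \<partial>sum_measure c I N f)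
      = c * (\<Sum>i\<in>I. enn2real (\<integral>\<^sup>+x. ennreal (h x) \<partial>f i))"
    if "h \<in> borel_measurable N" "\<And>i. i \<in> I \<Longrightarrow> integrable (f i) h" for h
  proof -
    have "(\<integral>\<^sup>+x. ennreal (h x) \<partial>f i) < \<infinity>" if "i \<in> I" for i
      using \<open>\<And>i. i \<in> I \<Longrightarrow> integrable (f i) h\<close>[OF that]
      by (auto simp: real_integrable_def less_top)
    then show ?thesis using that \<open>0 \<le> c\<close>
      by (subst nn_integral_sum_measure[OF sets]) (auto simp: enn2real_mult enn2real_sum o_def)
  qed
  have "(\<integral>x. g x \<partial>sum_measure c I N f) = c * (\<Sum>i\<in>I. enn2real (\<integral>\<^sup>+x. ennreal (g x) \<partial>f i))
      - c * (\<Sum>i\<in>I. enn2real (\<integral>\<^sup>+x. ennreal (- g x) \<partial>f i))"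
    using *[of g] *[of "\<lambda>x. - g x"] g int
    by (simp add: real_lebesgue_integral_def[OF integrable_sum_measure[OF sets g \<open>finite I\<close> int]])
  also have "\<dots> = c * (\<Sum>i\<in>I. \<integral>x. g x \<partial>f i)"
    using int by (simp add: real_lebesgue_integral_def sum_subtractf right_diff_distrib)
  finally show ?thesis .
qed

lemma distr_sum_measure:
  assumes sets: "\<And>i. i \<in> I \<Longrightarrow> sets (f i) = sets N" and g: "g \<in> measurable N L"
  shows "distr (sum_measure c I N f) L g = sum_measure c I L (\<lambda>i. distr (f i) L g)"
proof (rule measure_eqI)
  fix A assume A: "A \<in> sets (distr (sum_measure c I N f) L g)"
  have gi: "g \<in> measurable (f i) L" if "i \<in> I" for i
    using g by (simp add: measurable_cong_sets[OF sets[OF that] refl])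
  have "g -` A \<inter> space N \<in> sets N" using A g by (auto intro: measurable_sets)
  then show "emeasure (distr (sum_measure c I N f) L g) A = emeasure (sum_measure c I L (\<lambda>i. distr (f i) L g)) A"
    using A g gi sets_eq_imp_space_eq[OF sets]
    by (simp add: emeasure_distr emeasure_sum_measure[OF sets] emeasure_sum_measure[of I _ L])
qed simp

section \<open>The area measure of a leaf\<close>

definition strip :: "R2 set" where "strip = UNIV \<times> {0..<2 * pi}"

lemma strip_borel [measurable]: "strip \<in> sets borel"
  unfolding strip_def borel_prod[symmetric] by measurable

lemma borel_measurable_fst [measurable]:
  "fst \<in> borel_measurable (borel :: ('a::topological_space \<times> 'b::topological_space) measure)"
  by (intro borel_measurable_continuous_onI continuous_intros)

lemma continuous_on_phi [continuous_intros]: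
  "continuous_on S f \<Longrightarrow> continuous_on S (\<lambda>x. phi d (f x))"
  "continuous_on S f \<Longrightarrow> continuous_on S (\<lambda>x. psi d (f x))"
  unfolding phi_def psi_def by (auto intro!: continuous_intros)

context sw
begin

lemma continuous_on_leaf [continuous_intros]:
  "continuous_on S (leaf d \<sigma>)" "continuous_on S (leaf1 d \<sigma>)" "continuous_on S (leaf2 d \<sigma>)"
  unfolding leaf_def[abs_def] leaf1_def[abs_def] leaf2_def[abs_def]
  by (intro continuous_intros)+

lemma continuous_on_energy [continuous_intros]:
  "continuous_on S f \<Longrightarrow> continuous_on S (\<lambda>x. energy d (f x))"
  unfolding energy_def by (intro continuous_intros) auto

lemma measurable_leaf [measurable]: "leaf d \<sigma> \<in> borel_measurable borel"
  "leaf1 d \<sigma> \<in> borel_measurable borel" "leaf2 d \<sigma> \<in> borel_measurable borel"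
  by (intro borel_measurable_continuous_onI continuous_intros)+

lemma measurable_energy [measurable]: "energy d \<in> borel_measurable borel"
  using continuous_on_energy[OF continuous_on_id] by (intro borel_measurable_continuous_onI)

text \<open>The tangent plane, as a point of the Grassmannian.\<close>

definition leaf_proj :: "real \<Rightarrow> real \<times> real \<Rightarrow> R2 \<Rightarrow> (C2 \<Rightarrow>\<^sub>L C2)" where
  "leaf_proj d \<sigma> u = orth_proj (tangent_space (leaf d \<sigma>) u)"

lemma leaf_proj_apply:
  assumes "\<sigma> \<in> signs"
  shows "blinfun_apply (leaf_proj d \<sigma> u) = plane_proj (leaf1 d \<sigma> u) (leaf2 d \<sigma> u)"
  unfolding leaf_proj_def tangent_space_leaf
  by (rule orth_proj_orthogonal_span) (use leaf_inner[OF assms] leaf_nonzero[OF assms] in auto)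

lemma leaf_proj_Gr2: "\<sigma> \<in> signs \<Longrightarrow> leaf_proj d \<sigma> u \<in> Gr2"
  unfolding leaf_proj_def tangent_space_leaf
  by (rule orth_proj_Gr2) (use leaf_inner leaf_nonzero in auto)

lemma continuous_on_leaf_proj:
  assumes "\<sigma> \<in> signs"
  shows "continuous_on S (leaf_proj d \<sigma>)"
proof (rule continuous_on_blinfun_componentwise)
  fix i :: C2
  show "continuous_on S (\<lambda>u. blinfun_apply (leaf_proj d \<sigma> u) i)"
    unfolding leaf_proj_apply[OF assms] plane_proj_def
    by (intro continuous_intros) (use leaf_nonzero[OF assms] in auto)
qed

lemma measurable_leaf_pair:
  assumes "\<sigma> \<in> signs"
  shows "(\<lambda>u. (leaf d \<sigma> u, leaf_proj d \<sigma> u)) \<in> borel_measurable borel"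
  by (intro borel_measurable_continuous_onI continuous_intros continuous_on_leaf_proj assms)

text \<open>The indicator of one period of \<open>s\<close> is built in, so that integrals over a leaf are integrals over the whole plane.\<close>

definition area_density :: "real \<Rightarrow> R2 \<Rightarrow> real" where
  "area_density d u = indicator strip u * (sqrt (real p * real q) * energy d (fst u))"

lemma area_density_nonneg: "0 \<le> area_density d u"
  using energy_pos[of d "fst u"] by (simp add: area_density_def)

lemma measurable_area_density [measurable]: "area_density d \<in> borel_measurable borel"
  unfolding area_density_def[abs_def] by measurable

lemma param_varifold_leaf:
  assumes "\<sigma> \<in> signs"
  shows "param_varifold strip (leaf d \<sigma>)
    = distr (density lborel (area_density d)) borel (\<lambda>u. (leaf d \<sigma> u, leaf_proj d \<sigma> u))"
proof (rule measure_eqI)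
  fix A assume "A \<in> sets (param_varifold strip (leaf d \<sigma>))"
  then have A[measurable]: "A \<in> sets borel" by (simp add: param_varifold_def)
  note [measurable] = measurable_leaf_pair[OF assms, of d]
  let ?B = "(\<lambda>u. (leaf d \<sigma> u, leaf_proj d \<sigma> u)) -` A"
  have B[measurable]: "?B \<in> sets borel"
    using measurable_sets[OF measurable_leaf_pair[OF assms, of d] A] by simp
  have ael: "area_el (leaf d \<sigma>) = (\<lambda>u. sqrt (real p * real q) * energy d (fst u))"
    using metric_leaf(5)[OF assms] by auto
  have "emeasure (param_varifold strip (leaf d \<sigma>)) A
    = emeasure (density (restrict_space lborel strip) (area_el (leaf d \<sigma>))) (?B \<inter> strip)"
    unfolding param_varifold_def
    by (subst emeasure_distr)
       (auto simp: space_restrict_space leaf_proj_def[symmetric] intro!: measurable_restrict_space1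
             arg_cong2[where f=emeasure])
  also have "\<dots> = (\<integral>\<^sup>+u. ennreal (area_el (leaf d \<sigma>) u) * indicator (?B \<inter> strip) u \<partial>restrict_space lborel strip)"
    unfolding ael
    by (rule emeasure_density) (auto intro!: measurable_restrict_space1 image_eqI[OF _ B] simp: sets_restrict_space)
  also have "\<dots> = (\<integral>\<^sup>+u. ennreal (area_density d u) * indicator ?B u \<partial>lborel)"
    unfolding ael
    by (subst nn_integral_restrict_space)
       (auto simp: area_density_def indicator_def intro!: nn_integral_cong)
  also have "\<dots> = emeasure (distr (density lborel (area_density d)) borel (\<lambda>u. (leaf d \<sigma> u, leaf_proj d \<sigma> u))) A"
    by (simp add: emeasure_distr emeasure_density)
  finally show "emeasure (param_varifold strip (leaf d \<sigma>)) A
    = emeasure (distr (density lborel (area_density d)) borel (\<lambda>u. (leaf d \<sigma> u, leaf_proj d \<sigma> u))) A" .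
qed (simp add: param_varifold_def)

text \<open>Consider \<open>d \<noteq> 0\<close>. The half turn \<open>s \<mapsto> s + \<pi>\<close>, combined with the reflection of \<open>x\<close> if \<open>p\<close> and \<open>q\<close> have different
parities, either exchanges the sheets \<open>(1, 1)\<close> and \<open>(-1, -1)\<close> or maps each to itself. In both cases the two
sheets together cover the surface twice over \<open>0 \<le> s < 2\<pi>\<close>, which the factor \<open>1/2\<close> below corrects. For
\<open>d = 0\<close> there is no reflection, and all four sheets are needed to obtain both cones, again covered twice.\<close>

definition sheets :: "real \<Rightarrow> (real \<times> real) set" where
  "sheets d = (if d = 0 then signs else {(1, 1), (-1, -1)})"

lemma sheets_signs: "\<sigma> \<in> sheets d \<Longrightarrow> \<sigma> \<in> signs"
  by (auto simp: sheets_def signs_def split: if_splits)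

lemma finite_sheets [simp]: "finite (sheets d)"
  by (simp add: sheets_def signs_def)

definition varif :: "real \<Rightarrow> varifold" where
  "varif d = sum_measure (1/2) (sheets d) borel (\<lambda>\<sigma>. param_varifold strip (leaf d \<sigma>))"

lemma sets_varif [simp, measurable_cong]: "sets (varif d) = sets borel"
  and space_varif [simp]: "space (varif d) = UNIV"
  by (simp_all add: varif_def)

lemma sets_weight [simp, measurable_cong]: "sets (weight V) = sets borel"
  and space_weight [simp]: "space (weight V) = UNIV"
  by (simp_all add: weight_def)

lemma nn_integral_varif:
  assumes [measurable]: "F \<in> borel_measurable borel"
  shows "(\<integral>\<^sup>+z. F z \<partial>varif d)
    = ennreal (1/2) * (\<Sum>\<sigma>\<in>sheets d. \<integral>\<^sup>+u. ennreal (area_density d u) * F (leaf d \<sigma> u, leaf_proj d \<sigma> u) \<partial>lborel)"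
proof -
  have "(\<integral>\<^sup>+z. F z \<partial>param_varifold strip (leaf d \<sigma>))
     = (\<integral>\<^sup>+u. ennreal (area_density d u) * F (leaf d \<sigma> u, leaf_proj d \<sigma> u) \<partial>lborel)"
    if "\<sigma> \<in> sheets d" for \<sigma>
  proof -
    note [measurable] = measurable_leaf_pair[OF sheets_signs[OF that], of d]
    show ?thesis unfolding param_varifold_leaf[OF sheets_signs[OF that]]
      by (simp add: nn_integral_distr nn_integral_density)
  qed
  then show ?thesis
    by (simp add: varif_def nn_integral_sum_measure[of "sheets d"] param_varifold_def)
qed

lemma integrable_varif:
  fixes F :: "_ \<Rightarrow> 'b::{banach, second_countable_topology}"
  assumes [measurable]: "F \<in> borel_measurable borel"
    and int: "\<And>\<sigma>. \<sigma> \<in> sheets d \<Longrightarrow> integrable lborel (\<lambda>u. area_density d u *\<^sub>R F (leaf d \<sigma> u, leaf_proj d \<sigma> u))"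
  shows "integrable (varif d) F"
proof -
  have "integrable (param_varifold strip (leaf d \<sigma>)) F" if "\<sigma> \<in> sheets d" for \<sigma>
  proof -
    note [measurable] = measurable_leaf_pair[OF sheets_signs[OF that], of d]
    show ?thesis unfolding param_varifold_leaf[OF sheets_signs[OF that]]
      using int[OF that] by (simp add: integrable_distr_eq integrable_density area_density_nonneg)
  qed
  then show ?thesis unfolding varif_def
    by (intro integrable_sum_measure) (auto simp: param_varifold_def)
qed

lemma integral_varif:
  fixes F :: "_ \<Rightarrow> real"
  assumes [measurable]: "F \<in> borel_measurable borel"
    and int: "\<And>\<sigma>. \<sigma> \<in> sheets d \<Longrightarrow> integrable lborel (\<lambda>u. area_density d u * F (leaf d \<sigma> u, leaf_proj d \<sigma> u))"
  shows "(\<integral>z. F z \<partial>varif d)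
    = (\<Sum>\<sigma>\<in>sheets d. \<integral>u. area_density d u * F (leaf d \<sigma> u, leaf_proj d \<sigma> u) \<partial>lborel) / 2"
proof -
  have *: "integrable (param_varifold strip (leaf d \<sigma>)) F \<and> (\<integral>z. F z \<partial>param_varifold strip (leaf d \<sigma>))
     = (\<integral>u. area_density d u * F (leaf d \<sigma> u, leaf_proj d \<sigma> u) \<partial>lborel)"
    if "\<sigma> \<in> sheets d" for \<sigma>
  proof -
    note [measurable] = measurable_leaf_pair[OF sheets_signs[OF that], of d]
    show ?thesis unfolding param_varifold_leaf[OF sheets_signs[OF that]]
      using int[OF that]
      by (simp add: integrable_distr_eq integrable_density area_density_nonneg integral_distr integral_density)
  qed
  then show ?thesis unfolding varif_def
    by (subst integral_sum_measure) (auto simp: param_varifold_def)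
qed

lemma nn_integral_weight:
  assumes [measurable]: "F \<in> borel_measurable borel"
  shows "(\<integral>\<^sup>+x. F x \<partial>weight (varif d))
    = ennreal (1/2) * (\<Sum>\<sigma>\<in>sheets d. \<integral>\<^sup>+u. ennreal (area_density d u) * F (leaf d \<sigma> u) \<partial>lborel)"
proof -
  have "(\<integral>\<^sup>+x. F x \<partial>weight (varif d)) = (\<integral>\<^sup>+z. F (fst z) \<partial>varif d)"
    unfolding weight_def by (rule nn_integral_distr) auto
  also have "\<dots> = ennreal (1/2) * (\<Sum>\<sigma>\<in>sheets d. \<integral>\<^sup>+u. ennreal (area_density d u) * F (leaf d \<sigma> u) \<partial>lborel)"
    by (subst nn_integral_varif) auto
  finally show ?thesis .
qed

lemma integrable_weight:
  fixes F :: "_ \<Rightarrow> 'b::{banach, second_countable_topology}"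
  assumes [measurable]: "F \<in> borel_measurable borel"
    and int: "\<And>\<sigma>. \<sigma> \<in> sheets d \<Longrightarrow> integrable lborel (\<lambda>u. area_density d u *\<^sub>R F (leaf d \<sigma> u))"
  shows "integrable (weight (varif d)) F"
proof -
  show ?thesis unfolding weight_def
    by (subst integrable_distr_eq) (auto intro!: integrable_varif int)
qed

lemma integral_weight_fst:
  fixes F :: "_ \<Rightarrow> real"
  assumes [measurable]: "F \<in> borel_measurable borel"
  shows "(\<integral>x. F x \<partial>weight (varif d)) = (\<integral>z. F (fst z) \<partial>varif d)"
proof -
  show ?thesis unfolding weight_def by (rule integral_distr) auto
qed

lemma integral_weight:
  fixes F :: "_ \<Rightarrow> real"
  assumes [measurable]: "F \<in> borel_measurable borel"
    and int: "\<And>\<sigma>. \<sigma> \<in> sheets d \<Longrightarrow> integrable lborel (\<lambda>u. area_density d u * F (leaf d \<sigma> u))"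
  shows "(\<integral>x. F x \<partial>weight (varif d)) = (\<Sum>\<sigma>\<in>sheets d. \<integral>u. area_density d u * F (leaf d \<sigma> u) \<partial>lborel) / 2"
proof -
  show ?thesis unfolding integral_weight_fst[OF assms(1)]
    by (subst integral_varif) (auto intro: int)
qed

text \<open>Both bounds come from \<open>\<bar>leaf\<bar>\<^sup>2 \<ge> \<phi>\<^sup>2 + \<psi>\<^sup>2 = 2 e^(2x) + (d\<^sup>2/8) e^(-2x)\<close>. The second controls the end \<open>x \<rightarrow> -\<infinity>\<close>. It is
stated with a division by \<open>\<bar>d\<bar>\<close>, whose value is \<open>0\<close> for \<open>d = 0\<close>, in order to include the cone.\<close>

lemma leaf_bounds:
  assumes "\<sigma> \<in> signs"
  shows "exp (fst u) \<le> norm (leaf d \<sigma> u)"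
    and "norm (leaf d \<sigma> u) \<le> r \<Longrightarrow> \<bar>d\<bar> * exp (- fst u) \<le> 8 * r\<^sup>2 / \<bar>d\<bar> * exp (fst u)"
proof -
  let ?x = "fst u"
  have "1 * (phi d ?x)\<^sup>2 + 1 * (psi d ?x)\<^sup>2 \<le> real q * (phi d ?x)\<^sup>2 + real p * (psi d ?x)\<^sup>2"
    using p_pos q_pos by (intro add_mono mult_right_mono) auto
  then have *: "2 * exp (2 * ?x) + d\<^sup>2 / 8 * exp (- 2 * ?x) \<le> (norm (leaf d \<sigma> u))\<^sup>2"
    using leaf_inner(4)[OF assms, of d u] phi_square_add_psi_square[of d ?x]
    by (simp add: dot_square_norm)
  have "(exp ?x)\<^sup>2 \<le> (norm (leaf d \<sigma> u))\<^sup>2"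
  proof -
    have "(exp ?x)\<^sup>2 = exp (2 * ?x)" by (simp add: exp_double)
    moreover have "0 \<le> exp (2 * ?x)" "0 \<le> d\<^sup>2 / 8 * exp (- 2 * ?x)" by simp_all
    ultimately show ?thesis using * by linarith
  qed
  then show "exp ?x \<le> norm (leaf d \<sigma> u)" by (rule power2_le_imp_le) simp
  assume r: "norm (leaf d \<sigma> u) \<le> r"
  then have "(norm (leaf d \<sigma> u))\<^sup>2 \<le> r\<^sup>2" by (simp add: power_mono)
  then have "d\<^sup>2 / 8 * exp (- 2 * ?x) \<le> r\<^sup>2" using * exp_ge_zero[of "2 * ?x"] by linarith
  then have "d\<^sup>2 * exp (- 2 * ?x) * exp ?x \<le> 8 * r\<^sup>2 * exp ?x"
    by (intro mult_right_mono) auto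
  also have "d\<^sup>2 * exp (- 2 * ?x) * exp ?x = d\<^sup>2 * exp (- ?x)"
    by (simp add: mult.assoc flip: exp_add)
  finally have **: "d\<^sup>2 * exp (- ?x) \<le> 8 * r\<^sup>2 * exp ?x" .
  show "\<bar>d\<bar> * exp (- ?x) \<le> 8 * r\<^sup>2 / \<bar>d\<bar> * exp ?x"
  proof (cases "d = 0")
    case False
    then have "\<bar>d\<bar> * exp (- ?x) = d\<^sup>2 * exp (- ?x) / \<bar>d\<bar>"
      by (cases "0 < d") (simp_all add: power2_eq_square)
    with ** have "\<bar>d\<bar> * exp (- ?x) \<le> 8 * r\<^sup>2 * exp ?x / \<bar>d\<bar>"
      by (simp add: divide_right_mono)
    then show ?thesis by simp
  qed simp
qed

lemma leaf_bounded_coordinates: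
  obtains K where "0 < K" "\<And>u \<sigma>. \<sigma> \<in> signs \<Longrightarrow> norm (leaf d \<sigma> u) \<le> r \<Longrightarrow>
      fst u \<le> ln (max r 1) \<and> \<bar>phi d (fst u)\<bar> \<le> K * exp (fst u) \<and> \<bar>psi d (fst u)\<bar> \<le> K * exp (fst u)"
proof
  show "0 < 1 + 8 * r\<^sup>2 / \<bar>d\<bar>" by (simp add: add_pos_nonneg)
  fix u \<sigma> assume \<sigma>: "\<sigma> \<in> signs" "norm (leaf d \<sigma> u) \<le> r"
  have "exp (fst u) \<le> max r 1" using leaf_bounds(1)[OF \<sigma>(1), of u d] \<sigma> by linarith
  moreover have "\<bar>d / 4 * exp (- fst u)\<bar> \<le> 8 * r\<^sup>2 / \<bar>d\<bar> * exp (fst u)"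
  proof -
    have "0 \<le> \<bar>d\<bar> * exp (- fst u)" by simp
    moreover have "\<bar>d / 4 * exp (- fst u)\<bar> = \<bar>d\<bar> * exp (- fst u) / 4" by (simp add: abs_mult)
    ultimately show ?thesis using leaf_bounds(2)[OF \<sigma>] by linarith
  qed
  ultimately show "fst u \<le> ln (max r 1) \<and> \<bar>phi d (fst u)\<bar> \<le> (1 + 8 * r\<^sup>2 / \<bar>d\<bar>) * exp (fst u)
     \<and> \<bar>psi d (fst u)\<bar> \<le> (1 + 8 * r\<^sup>2 / \<bar>d\<bar>) * exp (fst u)"
    unfolding phi_def psi_def distrib_right using exp_ge_zero[of "fst u"]
    by (intro conjI) (simp add: ln_ge_iff, linarith+)
qed

end

section \<open>Compactly supported differentiable maps\<close>

text \<open>The definition of \<open>Ck_on\<close> gives continuity for each fixed direction; expanding the direction in a basis makes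
the derivative jointly continuous.\<close>

lemma continuous_on_frechet_derivative:
  fixes Y :: "'a::euclidean_space \<Rightarrow> 'b::real_normed_vector"
  assumes "Ck_on 1 Y UNIV" "continuous_on S f" "continuous_on S g"
  shows "continuous_on S (\<lambda>u. frechet_derivative Y (at (f u)) (g u))"
proof -
  have 1: "Y differentiable (at x)" "continuous_on UNIV (\<lambda>x. frechet_derivative Y (at x) v)" for x v
    using assms(1) by (simp_all add: One_nat_def)
  have *: "frechet_derivative Y (at x) v = (\<Sum>b\<in>Basis. (v \<bullet> b) *\<^sub>R frechet_derivative Y (at x) b)" for x v
  proof -
    have lin: "linear (frechet_derivative Y (at x))" using 1 linear_frechet_derivative by blast
    have "frechet_derivative Y (at x) v = frechet_derivative Y (at x) (\<Sum>b\<in>Basis. (v \<bullet> b) *\<^sub>R b)"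
      by (simp add: euclidean_representation)
    then show ?thesis by (simp add: linear_sum[OF lin] linear_cmul[OF lin])
  qed
  show ?thesis
    by (subst *) (intro continuous_intros assms continuous_on_compose2[OF 1(2) assms(2)], simp)
qed

lemma Ck_1_differentiable: "Ck_on 1 Y UNIV \<Longrightarrow> Y differentiable (at x)"
  by (simp add: One_nat_def)

lemma Ck_1_continuous:
  assumes "Ck_on 1 Y UNIV"
  shows "continuous_on UNIV Y"
proof -
  have "Y differentiable (at x)" for x using assms by (simp add: One_nat_def)
  then show ?thesis by (simp add: continuous_at_imp_continuous_on differentiable_imp_continuous_within)
qed

lemma continuous_compact_supp_bounds:
  fixes Y :: "'a::euclidean_space \<Rightarrow> 'b::real_normed_vector"
  assumes "continuous_on UNIV Y" "compact_supp Y"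
  obtains C r where "0 \<le> C" "0 < r" "\<And>x. norm (Y x) \<le> C" "\<And>x. r < norm x \<Longrightarrow> Y x = 0"
proof -
  let ?K = "closure {x. Y x \<noteq> 0}"
  have K: "compact ?K" using assms(2) by (simp add: compact_supp_def)
  from compact_imp_bounded[OF K, unfolded bounded_pos]
  obtain r where r: "0 < r" "\<forall>x\<in>?K. norm x \<le> r" by blast
  have out: "Y x = 0" if "x \<notin> ?K" for x using that closure_subset[of "{x. Y x \<noteq> 0}"] by auto
  have "compact (Y ` ?K)"
    by (rule compact_continuous_image[OF continuous_on_subset[OF assms(1)] K]) simp
  then have "bounded (Y ` ?K)" by (rule compact_imp_bounded)
  from this[unfolded bounded_pos] obtain C where C: "0 < C" "\<forall>y\<in>Y ` ?K. norm y \<le> C" by blast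
  show thesis
  proof
    show "norm (Y x) \<le> C" for x
    proof (cases "x \<in> ?K")
      case True then show ?thesis using C(2) by blast
    next
      case False then show ?thesis using C(1) out[OF False] by simp
    qed
    show "Y x = 0" if "r < norm x" for x using r(2) out[of x] that by (meson not_le)
  qed (use C(1) r(1) in simp_all)
qed

lemma C1_compact_supp_bounds:
  fixes Y :: "'a::euclidean_space \<Rightarrow> 'b::real_normed_vector"
  assumes "Ck_on 1 Y UNIV" "compact_supp Y"
  obtains C r where "0 \<le> C" "0 < r" "\<And>x. norm (Y x) \<le> C"
    "\<And>x v. norm (frechet_derivative Y (at x) v) \<le> C * norm v"
    "\<And>x. r < norm x \<Longrightarrow> Y x = 0" "\<And>x v. r < norm x \<Longrightarrow> frechet_derivative Y (at x) v = 0"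
proof -
  let ?D = "\<lambda>x. frechet_derivative Y (at x)"
  let ?K = "closure {x. Y x \<noteq> 0}"
  have 1: "Y differentiable (at x)" "continuous_on UNIV (\<lambda>x. ?D x v)" for x v
    using assms(1) by (simp_all add: One_nat_def)
  have lin: "linear (?D x)" for x using 1 linear_frechet_derivative by blast
  obtain C r where C: "0 \<le> C" "0 < r" "\<And>x. norm (Y x) \<le> C" "\<And>x. r < norm x \<Longrightarrow> Y x = 0"
    using continuous_compact_supp_bounds[OF Ck_1_continuous[OF assms(1)] assms(2)] by metis
  have D0: "?D x v = 0" if "r < norm x" for x v
  proof -
    have "open {x::'a. r < norm x}" by (intro open_Collect_less continuous_intros)
    then have "(Y has_derivative (\<lambda>_. 0)) (at x)"
      by (rule has_derivative_transform_within_open[OF has_derivative_const[of 0]]) (use that C in auto)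
    then show ?thesis by (metis frechet_derivative_at)
  qed
  have "\<exists>B\<ge>0. \<forall>x. norm (?D x b) \<le> B" for b
  proof -
    have "compact ((\<lambda>x. ?D x b) ` cball 0 r)"
      by (rule compact_continuous_image[OF continuous_on_subset[OF 1(2)]]) auto
    then have "bounded ((\<lambda>x. ?D x b) ` cball 0 r)" by (rule compact_imp_bounded)
    from this[unfolded bounded_pos]
    obtain B where B: "0 < B" "\<forall>y\<in>(\<lambda>x. ?D x b) ` cball 0 r. norm y \<le> B" by blast
    have "norm (?D x b) \<le> B" for x
    proof (cases "norm x \<le> r")
      case True then show ?thesis using B(2) by (simp add: dist_norm)
    next
      case False then show ?thesis using B(1) D0[of x b] by simp
    qed
    then show ?thesis using B by (intro exI[of _ B]) auto
  qed
  then obtain B where B: "\<And>b. 0 \<le> B b" "\<And>b x. norm (?D x b) \<le> B b" by metis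
  let ?B = "\<Sum>b\<in>Basis. B b"
  have D: "norm (?D x v) \<le> ?B * norm v" for x v
  proof -
    have "?D x v = (\<Sum>b\<in>Basis. (v \<bullet> b) *\<^sub>R ?D x b)"
    proof -
      have "?D x v = ?D x (\<Sum>b\<in>Basis. (v \<bullet> b) *\<^sub>R b)" by (simp add: euclidean_representation)
      then show ?thesis by (simp add: linear_sum[OF lin] linear_cmul[OF lin])
    qed
    also have "norm \<dots> \<le> (\<Sum>b\<in>Basis. norm v * B b)"
      by (rule sum_norm_le) (auto intro!: mult_mono B simp: Basis_le_norm)
    finally show ?thesis by (simp add: sum_distrib_left mult.commute)
  qed
  show thesis
  proof (rule that[of "max C ?B" r])
    show "norm (?D x v) \<le> max C ?B * norm v" for x v
      by (rule order.trans[OF D]) (intro mult_right_mono, auto)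
  qed (use C D0 le_max_iff_disj in \<open>auto simp: le_max_iff_disj\<close>)
qed

lemma integral_FTC_UNIV_zero:
  fixes f F :: "real \<Rightarrow> real"
  assumes "\<And>x. (F has_real_derivative f x) (at x)" "continuous_on UNIV f" "integrable lborel f"
    and "(F \<longlongrightarrow> 0) at_bot" "(F \<longlongrightarrow> 0) at_top"
  shows "(\<integral>x. f x \<partial>lborel) = 0"
proof -
  have "(LBINT x=-\<infinity>..\<infinity>. f x) = 0 - 0"
  proof (rule interval_integral_FTC_integrable)
    show "(F has_vector_derivative f x) (at x)" for x
      using assms(1) has_real_derivative_iff_has_vector_derivative by blast
    show "isCont f x" for x using assms(2) continuous_on_eq_continuous_at by blast
    show "set_integrable lborel (einterval (- \<infinity>) \<infinity>) f"
      using assms(3) by (simp add: set_integrable_def einterval_def)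
    show "((F \<circ> real_of_ereal) \<longlongrightarrow> 0) (at_right (- \<infinity>))" "((F \<circ> real_of_ereal) \<longlongrightarrow> 0) (at_left \<infinity>)"
      using assms(4,5) by (simp_all add: ereal_tendsto_simps1)
  qed auto
  then show ?thesis by (simp add: interval_lebesgue_integral_def set_lebesgue_integral_def einterval_def)
qed

lemma integral_FTC_periodic_zero:
  fixes f F :: "real \<Rightarrow> real"
  assumes "\<And>x. (F has_real_derivative f x) (at x)" "continuous_on UNIV f" "F T = F 0" "0 \<le> T"
  shows "(\<integral>x. indicator {0..<T} x * f x \<partial>lborel) = 0"
proof -
  have "(\<integral>x. indicator {0..T} x *\<^sub>R f x \<partial>lborel) = F T - F 0"
    by (rule integral_FTC_Icc) (use assms in \<open>auto simp: has_real_derivative_iff_has_vector_derivative[symmetric]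
        intro: has_field_derivative_at_within continuous_on_subset\<close>)
  moreover have "(\<integral>x. indicator {0..<T} x * f x \<partial>lborel) = (\<integral>x. indicator {0..T} x *\<^sub>R f x \<partial>lborel)"
  proof (rule integral_cong_AE)
    have [measurable]: "f \<in> borel_measurable borel" using assms(2) by (rule borel_measurable_continuous_onI)
    show "(\<lambda>x. indicator {0..<T} x * f x) \<in> borel_measurable lborel"
      "(\<lambda>x. indicator {0..T} x *\<^sub>R f x) \<in> borel_measurable lborel" by measurable
    show "AE x in lborel. indicator {0..<T} x * f x = indicator {0..T} x *\<^sub>R f x"
      using AE_lborel_singleton[of T] by eventually_elim (auto simp: indicator_def)
  qed
  ultimately show ?thesis using assms by simp
qed

section \<open>The divergence theorem on a leaf\<close>

lemma nn_integral_exp_atMost: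
  "(\<integral>\<^sup>+x. ennreal (indicator {..N} x * exp x) \<partial>lborel) = ennreal (exp N)"
proof -
    have "(\<integral>\<^sup>+x. ennreal (indicator {..N} x * exp x) \<partial>lborel)
        = (\<integral>\<^sup>+x. ennreal (indicator {..N} (- x) * exp (- x)) \<partial>lborel)"
      using nn_integral_real_affine[of "\<lambda>x. ennreal (indicator {..N} x * exp x)" "-1" 0] by simp
    also have "\<dots> = (\<integral>\<^sup>+x. ennreal (exp (- x)) * indicator {-N..} x \<partial>lborel)"
      by (intro nn_integral_cong) (auto simp: indicator_def)
    also have "\<dots> = ennreal (0 - - exp (- (- N)))"
    proof (rule nn_integral_FTC_atLeast)
      show "((\<lambda>x. - exp (- x)) has_real_derivative exp (- x)) (at x)" for x
        by (auto intro!: derivative_eq_intros)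
      show "((\<lambda>x::real. - exp (- x)) \<longlongrightarrow> 0) at_top"
        using tendsto_minus[OF filterlim_compose[OF exp_at_bot filterlim_uminus_at_bot_at_top]] by simp
    qed auto
    finally show ?thesis by simp
  qed

lemma integrable_exp_atMost: "integrable lborel (\<lambda>x. indicator {..N} x * exp x :: real)"
  by (rule integrableI_nonneg) (auto simp: nn_integral_exp_atMost)

lemma integrable_exp_strip:
  "integrable lborel (\<lambda>u::R2. indicator strip u * (indicator {..N} (fst u) * exp (fst u)))"
proof -
  note * = nn_integral_exp_atMost
  show ?thesis
  proof (rule integrableI_nonneg)
    have "(\<integral>\<^sup>+u. ennreal (indicator strip u * (indicator {..N} (fst u) * exp (fst u))) \<partial>lborel)
       = (\<integral>\<^sup>+y. \<integral>\<^sup>+x. ennreal (indicator {0..<2*pi} y) * ennreal (indicator {..N} x * exp x) \<partial>lborel \<partial>lborel)"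
      unfolding lborel_prod[symmetric]
      by (subst lborel_pair.nn_integral_snd[symmetric])
         (auto intro!: nn_integral_cong simp: strip_def indicator_def)
    also have "\<dots> < \<infinity>"
      by (simp add: nn_integral_cmult nn_integral_multc * ennreal_indicator emeasure_lborel_Ico ennreal_mult_less_top)
    finally show "(\<integral>\<^sup>+u. ennreal (indicator strip u * (indicator {..N} (fst u) * exp (fst u))) \<partial>lborel) < \<infinity>" .
  qed auto
qed

context sw
begin

text \<open>In the strip the vertex of the cone is the end \<open>x \<rightarrow> -\<infinity>\<close>, and a bound by \<open>e^x\<close> there is a bound by the distance
to the vertex.\<close>

lemma integrable_strip_bounded:
  fixes k :: "R2 \<Rightarrow> 'b::{banach, second_countable_topology}"
  assumes [measurable]: "k \<in> borel_measurable borel"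
    and "\<And>u. fst u \<le> N \<Longrightarrow> norm (k u) \<le> C * exp (fst u)" "\<And>u. N < fst u \<Longrightarrow> k u = 0"
  shows "integrable lborel (\<lambda>u. indicator strip u *\<^sub>R k u)"
proof (rule Bochner_Integration.integrable_bound)
  show "integrable lborel (\<lambda>u::R2. C * (indicator strip u * (indicator {..N} (fst u) * exp (fst u))))"
    by (intro integrable_mult_right integrable_exp_strip)
  show "AE u in lborel. norm (indicator strip u *\<^sub>R k u)
      \<le> norm (C * (indicator strip u * (indicator {..N} (fst u) * exp (fst u))))"
  proof (rule AE_I2)
    fix u :: R2
    show "norm (indicator strip u *\<^sub>R k u)
      \<le> norm (C * (indicator strip u * (indicator {..N} (fst u) * exp (fst u))))"
      using assms(2)[of u] assms(3)[of u]
      by (cases "fst u \<le> N") (auto simp: indicator_def intro: order.trans)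
  qed
qed auto

end

context sw
begin

lemma leaf1_eq_leaf: "leaf1 d \<sigma> u = leaf (- d) \<sigma> u"
  by (simp add: leaf_def leaf1_def phi_def psi_def)

text \<open>The generator of the circle action.\<close>

definition rot :: "C2 \<Rightarrow> C2" where
  "rot z = (\<i> * of_real (real p) * fst z, - (\<i> * of_real (real q) * snd z))"

lemma leaf2_eq_rot: "leaf2 d \<sigma> u = rot (leaf d \<sigma> u)"
proof -
  have "- (\<i> * a * (\<i> * b * c)) = a * b * c" for a b c :: complex by (simp add: algebra_simps)
  then show ?thesis by (simp add: leaf_def leaf2_def rot_def mult.assoc)
qed

lemma bounded_linear_rot: "bounded_linear rot"
  unfolding rot_def
  by (intro bounded_linear_Pair bounded_linear_minus bounded_linear_const_mult bounded_linear_fst bounded_linear_snd)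

lemma leaf_has_vector_derivative:
  shows "((\<lambda>t. leaf d \<sigma> (t, s)) has_vector_derivative leaf1 d \<sigma> (t, s)) (at t)"
    and "((\<lambda>s. leaf d \<sigma> (t, s)) has_vector_derivative leaf2 d \<sigma> (t, s)) (at s)"
    and "((\<lambda>t. leaf1 d \<sigma> (t, s)) has_vector_derivative leaf d \<sigma> (t, s)) (at t)"
    and "((\<lambda>s. leaf2 d \<sigma> (t, s)) has_vector_derivative rot (leaf2 d \<sigma> (t, s))) (at s)"
proof -
  have 1: "((\<lambda>t. leaf d \<sigma> (t, s)) has_vector_derivative leaf1 d \<sigma> (t, s)) (at t)" for t s d
  proof -
    have "((\<lambda>t::real. (t, s)) has_derivative (\<lambda>h. (h, 0))) (at t)" by (auto intro!: derivative_eq_intros)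
    from has_derivative_compose[OF this has_derivative_leaf[of d \<sigma> "(t, s)"]]
    show ?thesis by (simp add: has_vector_derivative_def)
  qed
  have 2: "((\<lambda>s. leaf d \<sigma> (t, s)) has_vector_derivative leaf2 d \<sigma> (t, s)) (at s)"
  proof -
    have "((\<lambda>s::real. (t, s)) has_derivative (\<lambda>h. (0, h))) (at s)" by (auto intro!: derivative_eq_intros)
    from has_derivative_compose[OF this has_derivative_leaf[of d \<sigma> "(t, s)"]]
    show ?thesis by (simp add: has_vector_derivative_def)
  qed
  show "((\<lambda>t. leaf d \<sigma> (t, s)) has_vector_derivative leaf1 d \<sigma> (t, s)) (at t)"
    "((\<lambda>s. leaf d \<sigma> (t, s)) has_vector_derivative leaf2 d \<sigma> (t, s)) (at s)" by (fact 1, fact 2)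
  show "((\<lambda>t. leaf1 d \<sigma> (t, s)) has_vector_derivative leaf d \<sigma> (t, s)) (at t)"
    using 1[where d = "- d"] by (simp add: leaf1_eq_leaf)
  show "((\<lambda>s. leaf2 d \<sigma> (t, s)) has_vector_derivative rot (leaf2 d \<sigma> (t, s))) (at s)"
    using bounded_linear.has_vector_derivative[OF bounded_linear_rot 2] by (simp add: leaf2_eq_rot)
qed

text \<open>With \<open>c = sqrt (pq)\<close> and \<open>X\<^sub>x\<^sub>x = X\<close>, this is the equation \<open>c X\<^sub>x\<^sub>x + c\<^sup>-\<^sup>1 X\<^sub>s\<^sub>s = \<surd>(det g) H\<close>: the mean curvature is
the Laplacian of the position. Comparing with \<open>curvature_leaf\<close>, it amounts to
\<open>pq z + rot (rot z) = (p - q) J (rot z)\<close>.\<close>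

lemma mean_curvature_equation:
  assumes "\<sigma> \<in> signs"
  shows "(sqrt (real p * real q) * energy d (fst u)) *\<^sub>R curvature (leaf d \<sigma> u)
    = sqrt (real p * real q) *\<^sub>R leaf d \<sigma> u + (1 / sqrt (real p * real q)) *\<^sub>R rot (leaf2 d \<sigma> u)"
proof -
  define c where "c = sqrt (real p * real q)"
  have c: "0 < c" "c * c = real p * real q" using p_pos q_pos by (simp_all add: c_def)
  have e: "energy d (fst u) \<noteq> 0" using energy_pos[of d "fst u"] by simp
  have "c *\<^sub>R leaf d \<sigma> u + (1 / c) *\<^sub>R rot (leaf2 d \<sigma> u)
      = (1 / c) *\<^sub>R ((c * c) *\<^sub>R leaf d \<sigma> u + rot (leaf2 d \<sigma> u))"
    using c(1) by (simp add: scaleR_add_right)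
  also have "(c * c) *\<^sub>R leaf d \<sigma> u + rot (leaf2 d \<sigma> u) = (real p - real q) *\<^sub>R cpx_J (leaf2 d \<sigma> u)"
    unfolding c(2) leaf2_eq_rot
    by (simp add: prod_eq_iff rot_def cpx_J_def scaleR_conv_of_real algebra_simps)
  also have "(1 / c) *\<^sub>R (real p - real q) *\<^sub>R cpx_J (leaf2 d \<sigma> u) = (c * energy d (fst u)) *\<^sub>R curvature (leaf d \<sigma> u)"
    unfolding curvature_leaf[OF assms] c(2)[symmetric] using c(1) e by simp
  finally show ?thesis by (simp add: c_def)
qed

lemma leaf_norm_bounds:
  obtains K N where "0 < K" "\<And>u \<sigma>. \<sigma> \<in> signs \<Longrightarrow> norm (leaf d \<sigma> u) \<le> r \<Longrightarrow> fst u \<le> N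
      \<and> norm (leaf d \<sigma> u) \<le> K * exp (fst u) \<and> norm (leaf1 d \<sigma> u) \<le> K * exp (fst u)
      \<and> norm (leaf2 d \<sigma> u) \<le> K * exp (fst u) \<and> energy d (fst u) \<le> K * exp (fst u) * exp (fst u)"
proof -
  obtain K where K: "0 < K" and b: "\<And>u \<sigma>. \<sigma> \<in> signs \<Longrightarrow> norm (leaf d \<sigma> u) \<le> r \<Longrightarrow>
      fst u \<le> ln (max r 1) \<and> \<bar>phi d (fst u)\<bar> \<le> K * exp (fst u) \<and> \<bar>psi d (fst u)\<bar> \<le> K * exp (fst u)"
    using leaf_bounded_coordinates by metis
  define P where "P = real p + real q"
  have P: "1 \<le> real p" "1 \<le> real q" "1 \<le> P" using p_pos q_pos by (auto simp: P_def)
  \<comment> \<open>A generous common constant: P bounds p, q and, through its square, the product pq.\<close>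
  define K' where "K' = P * P * (K + 1) * (K + 1)"
  have KK: "K * K \<le> (K + 1) * (K + 1)" "K + 1 \<le> (K + 1) * (K + 1)" using K by (auto intro: mult_mono)
  show thesis
  proof (rule that[of K' "ln (max r 1)"])
    show "0 < K'" using K P by (simp add: K'_def)
    fix u \<sigma> assume \<sigma>: "\<sigma> \<in> signs" and r: "norm (leaf d \<sigma> u) \<le> r"
    let ?e = "exp (fst u)"
    have sq: "(phi d (fst u))\<^sup>2 \<le> (K * ?e)\<^sup>2" "(psi d (fst u))\<^sup>2 \<le> (K * ?e)\<^sup>2"
      using b[OF \<sigma> r] K by (auto simp: abs_le_square_iff[symmetric] abs_mult)
    have en: "energy d (fst u) \<le> P * (K * ?e)\<^sup>2" "real q * (phi d (fst u))\<^sup>2 + real p * (psi d (fst u))\<^sup>2 \<le> P * (K * ?e)\<^sup>2"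
      unfolding energy_def P_def distrib_right using sq P
      by (auto intro: add_mono mult_left_mono) (metis add.commute add_mono mult_left_mono of_nat_0_le_iff)
    have bound: "norm v \<le> K' * ?e" if "v \<bullet> v \<le> P * P * (P * (K * ?e)\<^sup>2)" for v :: C2
    proof (rule power2_le_imp_le)
      have "(norm v)\<^sup>2 \<le> P * P * (P * (K * ?e)\<^sup>2)" using that by (simp add: dot_square_norm)
      also have "\<dots> = (P * P * P) * (K * K) * ?e\<^sup>2" by (simp add: power2_eq_square)
      also have "\<dots> \<le> (P * P * P * P) * ((K + 1) * (K + 1) * ((K + 1) * (K + 1))) * ?e\<^sup>2"
      proof (rule mult_right_mono, rule mult_mono)
        show "P * P * P \<le> P * P * P * P" using P by simp
        have "1 \<le> (K + 1) * (K + 1)" using KK K by linarith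
        then show "K * K \<le> (K + 1) * (K + 1) * ((K + 1) * (K + 1))"
          using KK(1) mult_mono[of "K * K" "(K+1)*(K+1)" 1 "(K+1)*(K+1)"] K by simp
      qed (use P K in auto)
      also have "\<dots> = (K' * ?e)\<^sup>2" by (simp add: K'_def power2_eq_square)
      finally show "(norm v)\<^sup>2 \<le> (K' * ?e)\<^sup>2" .
      show "0 \<le> K' * ?e" using P K by (simp add: K'_def)
    qed
    have PP: "1 \<le> P * P" "real p * real q \<le> P * P" 
      using P mult_mono[of 1 P 1 P] mult_mono[of "real p" P "real q" P] by (auto simp: P_def)
    have X: "0 \<le> P * (K * ?e)\<^sup>2" using P by simp
    have "P * (K * ?e)\<^sup>2 \<le> P * P * (P * (K * ?e)\<^sup>2)"
      using mult_right_mono[OF PP(1) X] by simp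
    moreover have "real p * real q * energy d (fst u) \<le> P * P * (P * (K * ?e)\<^sup>2)"
      by (intro mult_mono PP en) (use P energy_pos[of d "fst u"] in auto)
    moreover have "energy d (fst u) \<le> K' * ?e * ?e"
    proof -
      have "P * (K * ?e)\<^sup>2 = P * (K * K) * (?e * ?e)" by (simp add: power2_eq_square)
      also have "\<dots> \<le> P * P * ((K + 1) * (K + 1)) * (?e * ?e)"
        by (intro mult_right_mono mult_mono KK) (use P K in auto)
      finally show ?thesis using en(1) by (simp add: K'_def mult.assoc)
    qed
    ultimately show "fst u \<le> ln (max r 1) \<and> norm (leaf d \<sigma> u) \<le> K' * ?e \<and> norm (leaf1 d \<sigma> u) \<le> K' * ?e
      \<and> norm (leaf2 d \<sigma> u) \<le> K' * ?e \<and> energy d (fst u) \<le> K' * ?e * ?e"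
      using b[OF \<sigma> r] en by (auto intro!: bound simp: leaf_inner[OF \<sigma>])
  qed
qed

text \<open>Functions of bounded support that are \<open>O(1/\<bar>x\<bar>)\<close> near the origin. They are integrable on every leaf, with bounds
that survive the limit \<open>d \<rightarrow> 0\<close>. The class contains the curvature cut off at infinity, and it is the reason why
the vertex does no harm.\<close>

definition tame :: "(C2 \<Rightarrow> 'b::real_normed_vector) \<Rightarrow> bool" where
  "tame F \<longleftrightarrow> (\<exists>C r. \<forall>x. norm x * norm (F x) \<le> C \<and> (r < norm x \<longrightarrow> F x = 0))"

text \<open>The area element is of size \<open>e^(2x)\<close> and \<open>\<bar>leaf\<bar> \<ge> e^x\<close>, so the integrand is \<open>O(e^x)\<close>.\<close>

lemma tame_integrable:
  fixes F :: "C2 \<Rightarrow> 'b::{banach, second_countable_topology}"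
  assumes "tame F" and [measurable]: "F \<in> borel_measurable borel" and \<sigma>: "\<sigma> \<in> signs"
  shows "integrable lborel (\<lambda>u. area_density d u *\<^sub>R F (leaf d \<sigma> u))"
proof -
  obtain C r where C: "\<And>x. norm x * norm (F x) \<le> C" "\<And>x. r < norm x \<Longrightarrow> F x = 0"
    using assms(1) unfolding tame_def by blast
  obtain K N where K: "0 < K" and b: "\<And>u \<sigma>. \<sigma> \<in> signs \<Longrightarrow> norm (leaf d \<sigma> u) \<le> r \<Longrightarrow> fst u \<le> N
      \<and> norm (leaf d \<sigma> u) \<le> K * exp (fst u) \<and> norm (leaf1 d \<sigma> u) \<le> K * exp (fst u)
      \<and> norm (leaf2 d \<sigma> u) \<le> K * exp (fst u) \<and> energy d (fst u) \<le> K * exp (fst u) * exp (fst u)"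
    using leaf_norm_bounds by metis
  let ?c = "sqrt (real p * real q)"
  have "integrable lborel (\<lambda>u. indicator strip u *\<^sub>R ((?c * energy d (fst u)) *\<^sub>R F (leaf d \<sigma> u)))"
  proof (rule integrable_strip_bounded)
    fix u :: R2
    have C0: "0 \<le> C" using C(1)[of 0] by simp
    show "norm ((?c * energy d (fst u)) *\<^sub>R F (leaf d \<sigma> u)) \<le> (?c * K * C) * exp (fst u)" 
    proof (cases "norm (leaf d \<sigma> u) \<le> r")
      case True
      have "energy d (fst u) * norm (F (leaf d \<sigma> u)) \<le> K * exp (fst u) * (exp (fst u) * norm (F (leaf d \<sigma> u)))"
        using mult_right_mono[of "energy d (fst u)" "K * exp (fst u) * exp (fst u)" "norm (F (leaf d \<sigma> u))"]
          b[OF \<sigma> True] by (simp add: mult.assoc)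
      also have "\<dots> \<le> K * exp (fst u) * (norm (leaf d \<sigma> u) * norm (F (leaf d \<sigma> u)))"
        using K leaf_bounds(1)[OF \<sigma>, of u d] by (intro mult_left_mono mult_right_mono) auto
      also have "\<dots> \<le> K * exp (fst u) * C" using K C(1) by (intro mult_left_mono) auto
      finally have "?c * (energy d (fst u) * norm (F (leaf d \<sigma> u))) \<le> ?c * (K * exp (fst u) * C)"
        by (intro mult_left_mono) auto
      then show ?thesis using energy_pos[of d "fst u"] by (simp add: mult_ac abs_mult)
    qed (use C(2) K C0 in simp)
    show "(?c * energy d (fst u)) *\<^sub>R F (leaf d \<sigma> u) = 0" if "N < fst u"
      using b[OF \<sigma>, of u] that C(2)[of "leaf d \<sigma> u"] by force
  qed measurable
  then show ?thesis by (simp add: area_density_def)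
qed

text \<open>The denominator of \<open>curvature\<close> is the square of the norm of the vector in the numerator, and that vector is at
least as long as \<open>z\<close> because \<open>p, q \<ge> 1\<close>.\<close>

lemma norm_curvature: "norm z * norm (curvature z) \<le> \<bar>real p - real q\<bar>"
proof -
  define D where "D = (real p)\<^sup>2 * (norm (fst z))\<^sup>2 + (real q)\<^sup>2 * (norm (snd z))\<^sup>2"
  have D: "norm (- (real p *\<^sub>R fst z), real q *\<^sub>R snd z) = sqrt D"
    by (simp add: norm_Pair D_def power_mult_distrib)
  have "(norm z)\<^sup>2 \<le> D"
  proof -
    have "1 * (norm (fst z))\<^sup>2 + 1 * (norm (snd z))\<^sup>2 \<le> D"
      unfolding D_def using p_pos q_pos by (intro add_mono mult_right_mono) (auto simp: one_le_power)
    then show ?thesis by (simp add: norm_prod_def)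
  qed
  then have n: "norm z \<le> sqrt D" by (simp add: real_le_rsqrt)
  have D0: "0 \<le> D" by (simp add: D_def)
  have "norm (curvature z) = \<bar>real p - real q\<bar> / D * sqrt D"
    unfolding curvature_def D_def[symmetric] norm_scaleR D using D0 by simp
  then have "norm z * norm (curvature z) = \<bar>real p - real q\<bar> / D * sqrt D * norm z" by simp
  also have "\<dots> \<le> \<bar>real p - real q\<bar> / D * sqrt D * sqrt D"
    using n D0 by (intro mult_left_mono) auto
  also have "\<dots> = \<bar>real p - real q\<bar> / D * D" using D0 by (simp only: mult.assoc real_sqrt_mult_self abs_of_nonneg)
  also have "\<dots> \<le> \<bar>real p - real q\<bar>" by (cases "D = 0") auto
  finally show ?thesis .
qed

lemma borel_measurable_curvature [measurable]: "curvature \<in> borel_measurable borel"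
proof -
  have [measurable]: "snd \<in> borel_measurable (borel :: C2 measure)"
    by (intro borel_measurable_continuous_onI continuous_intros)
  have [measurable]: "(\<lambda>z::C2. (- (real p *\<^sub>R fst z), real q *\<^sub>R snd z)) \<in> borel_measurable borel"
    by (intro borel_measurable_continuous_onI continuous_intros)
  show ?thesis unfolding curvature_def[abs_def] by measurable
qed

text \<open>The weighted sum of the divergence of \<open>Y\<close> and \<open>Y \<bullet> H\<close> equals \<open>\<partial>\<^sub>x (c Y \<bullet> X\<^sub>x) + \<partial>\<^sub>s (c\<^sup>-\<^sup>1 Y \<bullet> X\<^sub>s)\<close> with \<open>c = sqrt (pq)\<close>. The
first term integrates to \<open>0\<close> in \<open>x\<close>: the boundary value vanishes for large \<open>x\<close> by compact support and is
\<open>O(e^x)\<close> at \<open>-\<infinity>\<close>. For \<open>d \<noteq> 0\<close> that end leaves the support; for \<open>d = 0\<close> it is the vertex. The second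
term integrates to \<open>0\<close> in \<open>s\<close> by periodicity.\<close>

lemma leaf_divergence_theorem:
  assumes \<sigma>: "\<sigma> \<in> signs" and Y: "Ck_on 1 Y UNIV" "compact_supp Y"
  shows "integrable lborel (\<lambda>u. area_density d u * plane_div (leaf_proj d \<sigma> u) Y (leaf d \<sigma> u))"
    and "integrable lborel (\<lambda>u. area_density d u * (Y (leaf d \<sigma> u) \<bullet> curvature (leaf d \<sigma> u)))"
    and "(\<integral>u. area_density d u * plane_div (leaf_proj d \<sigma> u) Y (leaf d \<sigma> u) \<partial>lborel)
      = - (\<integral>u. area_density d u * (Y (leaf d \<sigma> u) \<bullet> curvature (leaf d \<sigma> u)) \<partial>lborel)"
proof -
  define c where "c = sqrt (real p * real q)"
  have c: "0 < c" "c * c = real p * real q" using p_pos q_pos by (simp_all add: c_def)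
  let ?X = "leaf d \<sigma>" and ?X1 = "leaf1 d \<sigma>" and ?X2 = "leaf2 d \<sigma>"
  let ?D = "\<lambda>x. frechet_derivative Y (at x)"
  define A where "A u = c * (?D (?X u) (?X1 u) \<bullet> ?X1 u + Y (?X u) \<bullet> ?X u)" for u
  define B where "B u = (?D (?X u) (?X2 u) \<bullet> ?X2 u + Y (?X u) \<bullet> rot (?X2 u)) / c" for u
  obtain C r where C: "0 \<le> C" "0 < r" "\<And>x. norm (Y x) \<le> C"
    "\<And>x v. norm (?D x v) \<le> C * norm v"
    "\<And>x. r < norm x \<Longrightarrow> Y x = 0" "\<And>x v. r < norm x \<Longrightarrow> ?D x v = 0"
    using C1_compact_supp_bounds[OF Y] by metis
  obtain K N where K: "0 < K" and b0: "\<And>u \<sigma>. \<sigma> \<in> signs \<Longrightarrow> norm (leaf d \<sigma> u) \<le> r \<Longrightarrow> fst u \<le> N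
      \<and> norm (leaf d \<sigma> u) \<le> K * exp (fst u) \<and> norm (leaf1 d \<sigma> u) \<le> K * exp (fst u)
      \<and> norm (leaf2 d \<sigma> u) \<le> K * exp (fst u) \<and> energy d (fst u) \<le> K * exp (fst u) * exp (fst u)"
    using leaf_norm_bounds by metis
  note b = b0[OF \<sigma>]
  have zero: "Y (?X u) = 0" "?D (?X u) v = 0" if "N < fst u" for u v
    using b[of u] that C(5,6)[of "?X u"] by (meson not_le)+
  obtain R where R: "0 < R" "\<And>v. norm (rot v) \<le> norm v * R"
    using bounded_linear.pos_bounded[OF bounded_linear_rot] by blast
  have contY: "continuous_on UNIV Y" by (rule Ck_1_continuous[OF Y(1)])
  have cY: "continuous_on S (\<lambda>u. Y (?X u))" for S
    by (rule continuous_on_compose2[OF contY continuous_on_leaf(1)]) auto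
  have contA: "continuous_on UNIV A" and contB: "continuous_on UNIV B"
    unfolding A_def[abs_def] B_def[abs_def]
    by (intro continuous_intros continuous_on_frechet_derivative[OF Y(1)] cY
        bounded_linear.continuous_on[OF bounded_linear_rot]; use c in simp)+
  \<comment> \<open>The integrand splits into two exact derivatives: A in x and B in s.\<close>
  have key: "A u + B u = c * energy d (fst u) * (plane_div (leaf_proj d \<sigma> u) Y (?X u) + Y (?X u) \<bullet> curvature (?X u))" for u
  proof -
    have e: "energy d (fst u) \<noteq> 0" using energy_pos[of d "fst u"] by simp
    have diff: "Y differentiable (at x)" for x by (rule Ck_1_differentiable[OF Y(1)])
    have "plane_div (leaf_proj d \<sigma> u) Y (?X u) = ?D (?X u) (?X1 u) \<bullet> ?X1 u / energy d (fst u)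
      + ?D (?X u) (?X2 u) \<bullet> ?X2 u / (c * c * energy d (fst u))"
      unfolding leaf_proj_def tangent_space_leaf
      using plane_div_orthogonal_span[OF leaf_inner(1)[OF \<sigma>] leaf_nonzero(1,2)[OF \<sigma>] diff, of d u]
      by (simp add: leaf_inner[OF \<sigma>] c(2))
    then have 1: "c * energy d (fst u) * plane_div (leaf_proj d \<sigma> u) Y (?X u)
       = c * (?D (?X u) (?X1 u) \<bullet> ?X1 u) + ?D (?X u) (?X2 u) \<bullet> ?X2 u / c"
    proof -
      have "c * x * (a / x + b / (c * c * x)) = c * a + b / c" if "x \<noteq> 0" for a b x :: real
        using c(1) that by (simp add: field_simps)
      from this[OF e] show ?thesis by (simp add: \<open>plane_div _ _ _ = _\<close>)
    qed
    have "c * energy d (fst u) * (Y (?X u) \<bullet> curvature (?X u))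
       = Y (?X u) \<bullet> ((c * energy d (fst u)) *\<^sub>R curvature (?X u))" by simp
    also have "\<dots> = c * (Y (?X u) \<bullet> ?X u) + (Y (?X u) \<bullet> rot (?X2 u)) / c"
      unfolding c_def mean_curvature_equation[OF \<sigma>] by (simp add: inner_add_right)
    finally show ?thesis unfolding distrib_left 1 A_def B_def by (simp add: add_divide_distrib distrib_left)
  qed
  have inner_bound: "\<bar>v \<bullet> w\<bar> \<le> m * n" if "norm v \<le> m" "norm w \<le> n" "0 \<le> m" for v w :: C2 and m n
    using Cauchy_Schwarz_ineq2[of v w] mult_mono[OF that(1,2)] that(3) by simp
  have bA: "\<bar>A u\<bar> \<le> (c * (C * K * (K * exp N) + C * K)) * exp (fst u)"
    and bB: "\<bar>B u\<bar> \<le> ((C * K * (K * exp N) + C * (K * R)) / c) * exp (fst u)"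
    and bC: "\<bar>Y (?X u) \<bullet> ?X1 u\<bar> \<le> C * K * exp (fst u)" for u
  proof -
    let ?e = "exp (fst u)"
    have "\<bar>?D (?X u) (?X1 u) \<bullet> ?X1 u\<bar> \<le> C * K * (K * exp N) * ?e \<and> \<bar>?D (?X u) (?X2 u) \<bullet> ?X2 u\<bar> \<le> C * K * (K * exp N) * ?e
       \<and> \<bar>Y (?X u) \<bullet> ?X u\<bar> \<le> C * K * ?e \<and> \<bar>Y (?X u) \<bullet> rot (?X2 u)\<bar> \<le> C * (K * R) * ?e
       \<and> \<bar>Y (?X u) \<bullet> ?X1 u\<bar> \<le> C * K * ?e"
    proof (cases "norm (?X u) \<le> r")
      case True
      note bb = b[OF True]
      have eN: "K * ?e \<le> K * exp N" using bb K by simp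
      have D: "norm (?D (?X u) v) \<le> C * (K * ?e)" if "norm v \<le> K * ?e" for v
        using C(4)[of "?X u" v] mult_left_mono[OF that C(1)] by simp
      have q: "\<bar>?D (?X u) v \<bullet> v\<bar> \<le> C * K * (K * exp N) * ?e" if "norm v \<le> K * ?e" for v
      proof -
        have "\<bar>?D (?X u) v \<bullet> v\<bar> \<le> (C * (K * ?e)) * (K * exp N)"
          by (rule inner_bound[OF D[OF that] order.trans[OF that eN]]) (use C(1) K in simp)
        then show ?thesis by (simp add: mult_ac)
      qed
      have "norm (rot (?X2 u)) \<le> K * ?e * R"
      proof -
        have "norm (?X2 u) * R \<le> K * ?e * R" using bb R(1) by (intro mult_right_mono) auto
        then show ?thesis using R(2) order.trans by blast
      qed
      from inner_bound[OF C(3) this C(1), of "?X u"]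
      have r: "\<bar>Y (?X u) \<bullet> rot (?X2 u)\<bar> \<le> C * (K * R) * ?e" by (simp add: mult_ac)
      show ?thesis using q bb r inner_bound[OF C(3) _ C(1), of _ "K * ?e" "?X u"] by (simp add: mult.assoc)
    qed (use C K R in \<open>simp_all\<close>)
    then have 1: "\<bar>?D (?X u) (?X1 u) \<bullet> ?X1 u\<bar> \<le> C * K * (K * exp N) * ?e" "\<bar>?D (?X u) (?X2 u) \<bullet> ?X2 u\<bar> \<le> C * K * (K * exp N) * ?e"
       "\<bar>Y (?X u) \<bullet> ?X u\<bar> \<le> C * K * ?e" "\<bar>Y (?X u) \<bullet> rot (?X2 u)\<bar> \<le> C * (K * R) * ?e"
       "\<bar>Y (?X u) \<bullet> ?X1 u\<bar> \<le> C * K * ?e" by auto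
    show "\<bar>Y (?X u) \<bullet> ?X1 u\<bar> \<le> C * K * ?e" by (fact 1)
    have "\<bar>?D (?X u) (?X1 u) \<bullet> ?X1 u + Y (?X u) \<bullet> ?X u\<bar> \<le> (C * K * (K * exp N) + C * K) * ?e"
      using 1 by (simp add: distrib_right)
    from mult_left_mono[OF this, of c] show "\<bar>A u\<bar> \<le> (c * (C * K * (K * exp N) + C * K)) * ?e"
      using c by (simp add: A_def abs_mult mult.assoc)
    have "\<bar>?D (?X u) (?X2 u) \<bullet> ?X2 u + Y (?X u) \<bullet> rot (?X2 u)\<bar> \<le> (C * K * (K * exp N) + C * (K * R)) * ?e"
      using 1 by (simp add: distrib_right)
    from divide_right_mono[OF this, of c] show "\<bar>B u\<bar> \<le> ((C * K * (K * exp N) + C * (K * R)) / c) * ?e"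
      using c by (simp add: B_def)
  qed
  have [measurable]: "A \<in> borel_measurable borel" "B \<in> borel_measurable borel"
    using contA contB by (auto intro: borel_measurable_continuous_onI)
  have intA: "integrable lborel (\<lambda>u. indicator strip u *\<^sub>R A u)"
  proof (rule integrable_strip_bounded)
    show "norm (A u) \<le> (c * (C * K * (K * exp N) + C * K)) * exp (fst u)" for u using bA[of u] by simp
    show "A u = 0" if "N < fst u" for u using zero[OF that] by (simp add: A_def)
  qed measurable
  have intB: "integrable lborel (\<lambda>u. indicator strip u *\<^sub>R B u)"
  proof (rule integrable_strip_bounded)
    show "norm (B u) \<le> ((C * K * (K * exp N) + C * (K * R)) / c) * exp (fst u)" for u using bB[of u] by simp
    show "B u = 0" if "N < fst u" for u using zero[OF that] by (simp add: B_def)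
  qed measurable
  have Y': "((\<lambda>t. Y (f t)) has_vector_derivative ?D (f t) f') (at t)"
    if "(f has_vector_derivative f') (at t)" for f f' and t :: real
  proof -
    have dY: "(Y has_derivative ?D x) (at x)" for x
      using Ck_1_differentiable[OF Y(1)] by (simp add: frechet_derivative_works)
    have "linear (?D x)" for x using dY has_derivative_linear by blast
    then show ?thesis
      using has_derivative_compose[OF that[unfolded has_vector_derivative_def] dY]
      by (simp add: has_vector_derivative_def linear_cmul)
  qed
  note inner' = bounded_bilinear.has_vector_derivative[OF bounded_bilinear_inner]
  have zA: "(\<integral>t. A (t, s) \<partial>lborel) = 0" for s
  proof (rule integral_FTC_UNIV_zero)
    let ?F = "\<lambda>t. c * (Y (?X (t, s)) \<bullet> ?X1 (t, s))"
    show "(?F has_real_derivative A (t, s)) (at t)" for t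
      unfolding A_def has_real_derivative_iff_has_vector_derivative
      using has_vector_derivative_mult_right[OF inner'[OF Y'[OF leaf_has_vector_derivative(1)] leaf_has_vector_derivative(3)], of c]
      by (simp add: add.commute)
    show "continuous_on UNIV (\<lambda>t. A (t, s))"
      by (rule continuous_on_compose2[OF contA]) (auto intro!: continuous_intros)
    then have [measurable]: "(\<lambda>t. A (t, s)) \<in> borel_measurable borel"
      by (rule borel_measurable_continuous_onI)
    show "integrable lborel (\<lambda>t. A (t, s))"
    proof (rule Bochner_Integration.integrable_bound)
      let ?k = "c * (C * K * (K * exp N) + C * K)"
      show "integrable lborel (\<lambda>t. ?k * (indicator {..N} t * exp t))"
        by (intro integrable_mult_right integrable_exp_atMost)
      have "A (t, s) = 0" if "N < t" for t using zero[of "(t, s)"] that by (simp add: A_def)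
      then have "norm (A (t, s)) \<le> norm (?k * (indicator {..N} t * exp t))" for t
        using order.trans[OF bA[of "(t, s)"] abs_ge_self] by (cases "t \<le> N") auto
      then show "AE t in lborel. norm (A (t, s)) \<le> norm (?k * (indicator {..N} t * exp t))" by simp
    qed measurable
    have Fb: "norm (?F t) \<le> (c * (C * K)) * exp t" for t
      using mult_left_mono[OF bC[of "(t, s)"], of c] c(1) by (simp add: abs_mult mult.assoc)
    have "((\<lambda>t::real. (c * (C * K)) * exp t) \<longlongrightarrow> 0) at_bot"
      using tendsto_mult_right_zero[OF exp_at_bot] by blast
    then show "(?F \<longlongrightarrow> 0) at_bot"
      by (rule Lim_null_comparison[rotated]) (intro always_eventually allI Fb)
    show "(?F \<longlongrightarrow> 0) at_top"
      by (rule tendsto_eventually, rule eventually_mono[OF eventually_gt_at_top[of N]])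
         (simp add: zero(1))
  qed
  have zB: "(\<integral>s. indicator {0..<2*pi} s * B (t, s) \<partial>lborel) = 0" for t
  proof (rule integral_FTC_periodic_zero)
    let ?F = "\<lambda>s. (Y (?X (t, s)) \<bullet> ?X2 (t, s)) / c"
    show "(?F has_real_derivative B (t, s)) (at s)" for s
      unfolding B_def has_real_derivative_iff_has_vector_derivative divide_inverse
      using has_vector_derivative_mult_left[OF inner'[OF Y'[OF leaf_has_vector_derivative(2)[of d \<sigma> t s]] leaf_has_vector_derivative(4)[of d \<sigma> t s]],
          where a = "inverse c"]
      by (simp add: add.commute)
    show "continuous_on UNIV (\<lambda>s. B (t, s))"
      by (rule continuous_on_compose2[OF contB]) (auto intro!: continuous_intros)
    have per: "cis (real n * (2 * pi)) = 1" "cis (- (real n * (2 * pi))) = 1" for n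
      using cis_multiple_2pi[of "real n"] cis_multiple_2pi[of "- real n"] by (simp_all add: mult_ac)
    have "?X (t, 2 * pi) = ?X (t, 0)" unfolding leaf_def snd_conv fst_conv per by simp
    then show "?F (2 * pi) = ?F 0" by (simp add: leaf2_eq_rot)
  qed simp
  have IA: "(\<integral>u. indicator strip u *\<^sub>R A u \<partial>lborel) = 0"
  proof -
    have "(\<integral>u. indicator strip u *\<^sub>R A u \<partial>lborel) = (\<integral>s. \<integral>t. indicator strip (t, s) *\<^sub>R A (t, s) \<partial>lborel \<partial>lborel)"
      using intA unfolding lborel_prod[symmetric]
      by (subst lborel_pair.integral_snd) (auto simp: case_prod_beta')
    then show ?thesis by (simp add: strip_def indicator_times zA)
  qed
  have IB: "(\<integral>u. indicator strip u *\<^sub>R B u \<partial>lborel) = 0"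
  proof -
    have "(\<integral>u. indicator strip u *\<^sub>R B u \<partial>lborel) = (\<integral>t. \<integral>s. indicator strip (t, s) *\<^sub>R B (t, s) \<partial>lborel \<partial>lborel)"
      using intB unfolding lborel_prod[symmetric]
      by (subst lborel_pair.integral_fst) (auto simp: case_prod_beta')
    then show ?thesis by (simp add: strip_def indicator_times zB)
  qed
  show I2: "integrable lborel (\<lambda>u. area_density d u * (Y (?X u) \<bullet> curvature (?X u)))"
  proof -
    have [measurable]: "Y \<in> borel_measurable borel" by (rule borel_measurable_continuous_onI[OF contY])
    have "tame (\<lambda>x. Y x \<bullet> curvature x)"
      unfolding tame_def
    proof (intro exI allI conjI impI)
      fix x
      have "norm x * norm (Y x \<bullet> curvature x) \<le> norm x * (C * norm (curvature x))"
        using inner_bound[OF C(3) order.refl C(1), of x "curvature x"] by (intro mult_left_mono) auto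
      also have "\<dots> \<le> C * \<bar>real p - real q\<bar>"
        using mult_left_mono[OF norm_curvature[of x] C(1)] by (simp add: mult_ac)
      finally show "norm x * norm (Y x \<bullet> curvature x) \<le> C * \<bar>real p - real q\<bar>" .
      assume "r < norm x"
      then show "Y x \<bullet> curvature x = 0" using C(5) by simp
    qed
    from tame_integrable[OF this _ \<sigma>, of d] show ?thesis by simp
  qed
  have sum: "area_density d u * plane_div (leaf_proj d \<sigma> u) Y (?X u)
     = indicator strip u *\<^sub>R A u + indicator strip u *\<^sub>R B u - area_density d u * (Y (?X u) \<bullet> curvature (?X u))" for u
    using key[of u] by (simp add: area_density_def c_def[symmetric] algebra_simps indicator_def)
  show "integrable lborel (\<lambda>u. area_density d u * plane_div (leaf_proj d \<sigma> u) Y (?X u))"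
    unfolding sum by (intro Bochner_Integration.integrable_diff Bochner_Integration.integrable_add intA intB I2)
  show "(\<integral>u. area_density d u * plane_div (leaf_proj d \<sigma> u) Y (?X u) \<partial>lborel)
      = - (\<integral>u. area_density d u * (Y (?X u) \<bullet> curvature (?X u)) \<partial>lborel)"
    unfolding sum
    using intA intB I2 IA IB by (subst Bochner_Integration.integral_diff) auto
qed

end

section \<open>The generalized mean curvature\<close>

text \<open>Convergence along a filter \<open>at a\<close> reduces to sequences because the domain is first countable.\<close>

lemma dominated_convergence_at:
  fixes F :: "'b::first_countable_topology \<Rightarrow> 'a \<Rightarrow> real"
  assumes "\<And>h. F h \<in> borel_measurable M" "G \<in> borel_measurable M" "integrable M w"
    and "eventually (\<lambda>h. \<forall>x. \<bar>F h x\<bar> \<le> w x) (at a)"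
    and "\<And>x. ((\<lambda>h. F h x) \<longlongrightarrow> G x) (at a)"
  shows "((\<lambda>h. \<integral>x. F h x \<partial>M) \<longlongrightarrow> (\<integral>x. G x \<partial>M)) (at a)"
  unfolding tendsto_at_iff_sequentially comp_def
proof (intro allI impI)
  fix X assume X: "\<forall>i. X i \<in> UNIV - {a}" "X \<longlonglongrightarrow> a"
  then have lim: "filterlim X (at a) sequentially"
    by (simp add: filterlim_at eventually_sequentially)
  \<comment> \<open>The bound holds only from some index on, so finitely many terms are dropped.\<close>
  from eventually_compose_filterlim[OF assms(4) lim]
  obtain N where N: "\<And>n x. N \<le> n \<Longrightarrow> \<bar>F (X n) x\<bar> \<le> w x" by (auto simp: eventually_sequentially)
  show "(\<lambda>n. \<integral>x. F (X n) x \<partial>M) \<longlonglongrightarrow> (\<integral>x. G x \<partial>M)"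
  proof (rule LIMSEQ_offset[where k = N], rule integral_dominated_convergence)
    show "AE x in M. (\<lambda>n. F (X (n + N)) x) \<longlonglongrightarrow> G x"
    proof (rule AE_I2)
      fix x
      have "(\<lambda>n. F (X n) x) \<longlonglongrightarrow> G x" using filterlim_compose[OF assms(5) lim] .
      then show "(\<lambda>n. F (X (n + N)) x) \<longlonglongrightarrow> G x" by (rule LIMSEQ_ignore_initial_segment)
    qed
    show "AE x in M. norm (F (X (n + N)) x) \<le> w x" for n using N[of "n + N"] by auto
  qed (use assms in auto)
qed

lemma distr_lborel_R2_affine:
  assumes "\<bar>e\<bar> = 1"
  shows "distr lborel borel (\<lambda>u::R2. (a + e * fst u, b + snd u)) = lborel"
proof -
  define c :: "R2 \<Rightarrow> real" where "c j = (if j = (1, 0) then e else 1)" for j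
  have cn: "c j \<noteq> 0" for j using assms by (auto simp: c_def)
  have B: "(Basis :: R2 set) = {(1, 0), (0, 1)}" by (auto simp: Basis_prod_def)
  have T: "(a, b) + (\<Sum>j\<in>Basis. (c j * (x \<bullet> j)) *\<^sub>R j) = (a + e * fst x, b + snd x)" for x :: R2
    by (simp add: B c_def inner_prod_def)
  have "lborel = density (distr lborel borel (\<lambda>u::R2. (a + e * fst u, b + snd u))) (\<lambda>_. ennreal (\<Prod>j\<in>Basis. \<bar>c j\<bar>))"
    using lborel_affine_euclidean[of c "(a, b)"] cn unfolding T by blast
  also have "(\<Prod>j\<in>Basis. \<bar>c j\<bar>) = 1" using assms by (simp add: B c_def)
  finally show ?thesis by (simp add: density_1)
qed

lemma borel_measurable_snd [measurable]:
  "snd \<in> borel_measurable (borel :: ('a::topological_space \<times> 'b::topological_space) measure)"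
  by (intro borel_measurable_continuous_onI continuous_intros)

lemma measurable_R2_affine [measurable]:
  "(\<lambda>u::R2. (a + e * fst u, b + snd u)) \<in> borel_measurable borel"
  by (intro borel_measurable_continuous_onI continuous_intros)

lemma integral_R2_affine:
  fixes f :: "R2 \<Rightarrow> real"
  assumes "\<bar>e\<bar> = 1" and [measurable]: "f \<in> borel_measurable borel"
  shows "(\<integral>u. f (a + e * fst u, b + snd u) \<partial>lborel) = (\<integral>u. f u \<partial>lborel)"
proof -
  have "(\<integral>u. f u \<partial>lborel) = (\<integral>u. f u \<partial>distr lborel borel (\<lambda>u::R2. (a + e * fst u, b + snd u)))"
    by (simp add: distr_lborel_R2_affine[OF assms(1)])
  also have "\<dots> = (\<integral>u. f (a + e * fst u, b + snd u) \<partial>lborel)" by (rule integral_distr) auto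
  finally show ?thesis by simp
qed

lemma nn_integral_R2_affine:
  fixes f :: "R2 \<Rightarrow> ennreal"
  assumes "\<bar>e\<bar> = 1" and [measurable]: "f \<in> borel_measurable borel"
  shows "(\<integral>\<^sup>+u. f (a + e * fst u, b + snd u) \<partial>lborel) = (\<integral>\<^sup>+u. f u \<partial>lborel)"
proof -
  have "(\<integral>\<^sup>+u. f u \<partial>lborel) = (\<integral>\<^sup>+u. f u \<partial>distr lborel borel (\<lambda>u::R2. (a + e * fst u, b + snd u)))"
    by (simp add: distr_lborel_R2_affine[OF assms(1)])
  also have "\<dots> = (\<integral>\<^sup>+u. f (a + e * fst u, b + snd u) \<partial>lborel)" by (rule nn_integral_distr) auto
  finally show ?thesis by simp
qed

context sw
begin

lemma tame_integrable_weight: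
  fixes F :: "C2 \<Rightarrow> 'b::{banach, second_countable_topology}"
  assumes "tame F" "F \<in> borel_measurable borel"
  shows "integrable (weight (varif d)) F"
  using assms by (intro integrable_weight tame_integrable) (auto dest: sheets_signs)

lemma tame_integral_weight:
  fixes F :: "C2 \<Rightarrow> real"
  assumes "tame F" "F \<in> borel_measurable borel"
  shows "(\<integral>x. F x \<partial>weight (varif d)) = (\<Sum>\<sigma>\<in>sheets d. \<integral>u. area_density d u * F (leaf d \<sigma> u) \<partial>lborel) / 2"
  using tame_integrable[OF assms] by (intro integral_weight assms) (auto dest: sheets_signs)

lemma tame_bounded:
  assumes "\<And>x. norm (F x) \<le> C" "\<And>x. r < norm x \<Longrightarrow> F x = 0"
  shows "tame F"
  unfolding tame_def
proof (intro exI allI conjI impI)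
  fix x
  have "0 \<le> C" using assms(1)[of 0] norm_ge_zero order.trans by blast
  then show "norm x * norm (F x) \<le> \<bar>r\<bar> * C"
    using assms mult_mono[of "norm x" "\<bar>r\<bar>" "norm (F x)" C] by (cases "norm x \<le> r") auto
qed (use assms in auto)

lemma tame_curvature:
  assumes "\<And>x. norm (F x) \<le> C * norm (curvature x)" "\<And>x. r < norm x \<Longrightarrow> F x = 0" "0 \<le> C"
  shows "tame F"
  unfolding tame_def
proof (intro exI allI conjI impI)
  fix x
  have "norm x * norm (F x) \<le> C * (norm x * norm (curvature x))"
    using mult_left_mono[OF assms(1)[of x], of "norm x"] by (simp add: mult_ac)
  also have "\<dots> \<le> C * \<bar>real p - real q\<bar>" by (intro mult_left_mono norm_curvature assms)
  finally show "norm x * norm (F x) \<le> C * \<bar>real p - real q\<bar>" .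
qed (use assms in auto)

lemma continuous_on_plane_div:
  assumes "Ck_on 1 Y UNIV"
  shows "continuous_on UNIV (\<lambda>z :: C2 \<times> (C2 \<Rightarrow>\<^sub>L C2). plane_div (snd z) Y (fst z))"
  unfolding plane_div_def
  by (intro continuous_intros blinfun.continuous_on continuous_on_frechet_derivative[OF assms])

theorem gen_mean_curvature_varif: "gen_mean_curvature (varif d) curvature"
  unfolding gen_mean_curvature_def
proof (intro conjI allI impI)
  fix K :: "C2 set" assume "compact K"
  then obtain r where r: "\<forall>x\<in>K. norm x \<le> r" using compact_imp_bounded bounded_iff by metis
  have [measurable]: "K \<in> sets borel" using \<open>compact K\<close> by (simp add: borel_compact)
  show "set_integrable (weight (varif d)) K curvature"
    unfolding set_integrable_def
    by (rule tame_integrable_weight, rule tame_curvature[of _ 1 r])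
       (use r in \<open>auto simp: indicator_def not_le[symmetric]\<close>)
next
  fix Y :: "C2 \<Rightarrow> C2" assume Y: "Ck_on 1 Y UNIV \<and> compact_supp Y"
  obtain C r where C: "0 \<le> C" "\<And>x. norm (Y x) \<le> C" "\<And>x. r < norm x \<Longrightarrow> Y x = 0"
    using continuous_compact_supp_bounds[OF Ck_1_continuous] Y by metis
  have [measurable]: "(\<lambda>z :: C2 \<times> (C2 \<Rightarrow>\<^sub>L C2). plane_div (snd z) Y (fst z)) \<in> borel_measurable borel"
    by (rule borel_measurable_continuous_onI[OF continuous_on_plane_div[OF conjunct1[OF Y]]])
  have [measurable]: "Y \<in> borel_measurable borel"
    by (rule borel_measurable_continuous_onI[OF Ck_1_continuous[OF conjunct1[OF Y]]])
  note D = leaf_divergence_theorem[OF sheets_signs conjunct1[OF Y] conjunct2[OF Y], of _ d d]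
  have "first_variation (varif d) Y
     = (\<Sum>\<sigma>\<in>sheets d. \<integral>u. area_density d u * plane_div (leaf_proj d \<sigma> u) Y (leaf d \<sigma> u) \<partial>lborel) / 2"
    unfolding first_variation_def by (subst integral_varif) (use D(1) in auto)
  also have "\<dots> = - ((\<Sum>\<sigma>\<in>sheets d. \<integral>u. area_density d u * (Y (leaf d \<sigma> u) \<bullet> curvature (leaf d \<sigma> u)) \<partial>lborel) / 2)"
    by (simp add: D(3) sum_negf)
  also have "\<dots> = - (\<integral>x. Y x \<bullet> curvature x \<partial>weight (varif d))"
    by (subst integral_weight) (use D(2) in auto)
  finally show "first_variation (varif d) Y = - (\<integral>x. Y x \<bullet> curvature x \<partial>weight (varif d))" .
qed

text \<open>The planes that occur lie in a countable union \<open>S\<close> of compact sets. This is a Borel subset of \<open>Gr2\<close>, so its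
complement can be measured.\<close>

lemma is_varifold_varif: "is_varifold (varif d)"
  unfolding is_varifold_def
proof (intro conjI allI impI)
  define S where "S = (\<Union>\<sigma>\<in>sheets d. \<Union>n. leaf_proj d \<sigma> ` cball 0 (real n))"
  have S: "leaf_proj d \<sigma> u \<in> S" if "\<sigma> \<in> sheets d" for \<sigma> u
  proof -
    obtain n where "norm u \<le> real n" using real_arch_simple by blast
    then have "leaf_proj d \<sigma> u \<in> leaf_proj d \<sigma> ` cball 0 (real n)" by (intro imageI) simp
    then show ?thesis using that unfolding S_def by blast
  qed
  have SG: "S \<subseteq> Gr2" using leaf_proj_Gr2 sheets_signs by (auto simp: S_def)
  have "leaf_proj d \<sigma> ` cball 0 (real n) \<in> sets borel" if "\<sigma> \<in> sheets d" for \<sigma> n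
    by (intro borel_compact compact_continuous_image continuous_on_leaf_proj sheets_signs[OF that]) auto
  then have [measurable]: "S \<in> sets borel" unfolding S_def by (intro sets.finite_UN sets.countable_UN) auto
  let ?A = "{z :: C2 \<times> (C2 \<Rightarrow>\<^sub>L C2). snd z \<notin> S}"
  have A[measurable]: "?A \<in> sets borel" by measurable
  have "emeasure (varif d) ?A = (\<integral>\<^sup>+z. indicator ?A z \<partial>varif d)" by simp
  also have "\<dots> = 0" by (subst nn_integral_varif) (auto simp: S)
  finally have "emeasure (varif d) ?A = 0" .
  then show "AE z in varif d. snd z \<in> Gr2"
    by (rule AE_I[rotated]) (use SG in auto)
next
  fix K :: "(C2 \<times> (C2 \<Rightarrow>\<^sub>L C2)) set" assume K: "compact K"
  then have "bounded (fst ` K)" by (intro compact_imp_bounded compact_continuous_image continuous_intros)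
  then obtain r where r: "\<And>z. z \<in> K \<Longrightarrow> norm (fst z) \<le> r" unfolding bounded_iff by auto
  have [measurable]: "K \<in> sets borel" using K by (simp add: borel_compact)
  have [measurable]: "cball (0::C2) r \<in> sets borel" by (simp add: borel_closed)
  have int: "integrable (weight (varif d)) (\<lambda>x. indicator (cball 0 r) x :: real)"
    by (rule tame_integrable_weight, rule tame_bounded[of _ 1 r]) auto
  have pre: "fst -` cball 0 r \<in> sets (borel :: varifold)"
    using measurable_sets[OF borel_measurable_fst, of "cball (0::C2) r"] by simp
  have "emeasure (varif d) K \<le> emeasure (varif d) (fst -` cball 0 r \<inter> space (varif d))"
  proof (rule emeasure_mono)
    show "K \<subseteq> fst -` cball 0 r \<inter> space (varif d)" using r by (auto simp del: split_paired_All)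
    show "fst -` cball 0 r \<inter> space (varif d) \<in> sets (varif d)" using pre by simp
  qed
  also have "\<dots> = emeasure (weight (varif d)) (cball 0 r)"
    unfolding weight_def by (rule emeasure_distr[symmetric]) auto
  also have "\<dots> < \<infinity>"
    using int by (auto simp: integrable_indicator_iff)
  finally show "emeasure (varif d) K < \<infinity>" .
qed simp

section \<open>Scaling and the limit cone\<close>

text \<open>Multiplication by \<open>l\<close> maps the leaf of parameter \<open>d\<close> to that of parameter \<open>l\<^sup>2 d\<close>; in coordinates it is the
translation of \<open>x\<close> by \<open>ln l\<close>.\<close>

lemma leaf_scale:
  assumes "0 < l"
  shows "leaf (l\<^sup>2 * d) \<sigma> (ln l + fst u, snd u) = l *\<^sub>R leaf d \<sigma> u"
    and "area_density (l\<^sup>2 * d) (ln l + fst u, snd u) = l\<^sup>2 * area_density d u"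
proof -
  have *: "phi (l\<^sup>2 * d) (ln l + fst u) = l * phi d (fst u)" "psi (l\<^sup>2 * d) (ln l + fst u) = l * psi d (fst u)"
    using assms by (simp_all add: phi_def psi_def exp_add exp_diff exp_minus field_simps power2_eq_square)
  show "leaf (l\<^sup>2 * d) \<sigma> (ln l + fst u, snd u) = l *\<^sub>R leaf d \<sigma> u"
    unfolding leaf_def fst_conv snd_conv * by (simp add: scaleR_conv_of_real mult_ac)
  show "area_density (l\<^sup>2 * d) (ln l + fst u, snd u) = l\<^sup>2 * area_density d u"
    unfolding area_density_def energy_def fst_conv *
    by (simp add: strip_def indicator_def power_mult_distrib distrib_left mult_ac mem_Times_iff)
qed

lemma integral_weight_scale:
  assumes "0 < l" "d \<noteq> 0" "tame F" and [measurable]: "F \<in> borel_measurable borel"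
  shows "(\<integral>x. F x \<partial>weight (varif (l\<^sup>2 * d))) = l\<^sup>2 * (\<integral>x. F (l *\<^sub>R x) \<partial>weight (varif d))"
proof -
  obtain C r where C: "\<And>x. norm x * norm (F x) \<le> C" "\<And>x. r < norm x \<Longrightarrow> F x = 0"
    using assms(3) unfolding tame_def by blast
  have tame: "tame (\<lambda>x. F (l *\<^sub>R x))"
    unfolding tame_def
  proof (intro exI allI conjI impI)
    fix x
    show "norm x * norm (F (l *\<^sub>R x)) \<le> C / l" using C(1)[of "l *\<^sub>R x"] assms(1) by (simp add: field_simps)
    show "F (l *\<^sub>R x) = 0" if "r / l < norm x" using that C(2)[of "l *\<^sub>R x"] assms(1) by (simp add: field_simps)
  qed
  have "(\<integral>u. area_density (l\<^sup>2 * d) u * F (leaf (l\<^sup>2 * d) \<sigma> u) \<partial>lborel)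
      = l\<^sup>2 * (\<integral>u. area_density d u * F (l *\<^sub>R leaf d \<sigma> u) \<partial>lborel)" for \<sigma>
  proof -
    have "(\<integral>u. area_density (l\<^sup>2 * d) u * F (leaf (l\<^sup>2 * d) \<sigma> u) \<partial>lborel)
       = (\<integral>u. area_density (l\<^sup>2 * d) (ln l + 1 * fst u, 0 + snd u) * F (leaf (l\<^sup>2 * d) \<sigma> (ln l + 1 * fst u, 0 + snd u)) \<partial>lborel)"
      by (rule integral_R2_affine[symmetric]) auto
    also have "\<dots> = (\<integral>u. l\<^sup>2 * (area_density d u * F (l *\<^sub>R leaf d \<sigma> u)) \<partial>lborel)"
      by (simp add: leaf_scale[OF assms(1)] mult.assoc)
    finally show ?thesis by simp
  qed
  moreover have "sheets (l\<^sup>2 * d) = sheets d" using assms by (simp add: sheets_def)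
  ultimately show ?thesis
    by (simp add: tame_integral_weight[OF assms(3,4)] tame_integral_weight[OF tame] sum_distrib_left)
qed

text \<open>The reflection exchanges the two summands of \<open>\<phi>\<close> and of \<open>\<psi>\<close> up to the sign of \<open>d\<close>, so it fixes one of these
functions and negates the other.\<close>

lemma leaf_reflect:
  assumes "d \<noteq> 0"
  defines "R u \<equiv> (ln (\<bar>d\<bar> / 4) + (-1) * fst u, 0 + snd u) :: R2"
  shows "leaf d \<sigma> (R u) = leaf d (if 0 < d then (fst \<sigma>, - snd \<sigma>) else (- fst \<sigma>, snd \<sigma>)) u"
    and "area_density d (R u) = area_density d u"
    and "exp (2 * fst (R u)) = (\<bar>d\<bar> / 4)\<^sup>2 / exp (2 * fst u)"
proof -
  have 1: "exp (fst (R u)) = \<bar>d\<bar> / 4 * exp (- fst u)" "exp (- fst (R u)) = 4 / \<bar>d\<bar> * exp (fst u)"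
    using assms by (simp_all add: exp_add exp_diff exp_minus field_simps)
  have *: "phi d (fst (R u)) = sgn d * phi d (fst u)" "psi d (fst (R u)) = - sgn d * psi d (fst u)"
    unfolding phi_def psi_def 1 using assms by (auto simp: sgn_if field_simps)
  show "leaf d \<sigma> (R u) = leaf d (if 0 < d then (fst \<sigma>, - snd \<sigma>) else (- fst \<sigma>, snd \<sigma>)) u"
    using assms(1) unfolding leaf_def * by (auto simp: R_def)
  show "area_density d (R u) = area_density d u"
  proof -
    have "(sgn d)\<^sup>2 = 1" using assms(1) by (auto simp: sgn_if)
    then show ?thesis unfolding area_density_def energy_def * power_mult_distrib
      by (simp add: R_def strip_def indicator_def mem_Times_iff)
  qed
  show "exp (2 * fst (R u)) = (\<bar>d\<bar> / 4)\<^sup>2 / exp (2 * fst u)"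
  proof -
    have "exp (- fst u) * exp (- fst u) * exp (2 * fst u) = 1" by (simp flip: exp_add)
    then have "(exp (- fst u))\<^sup>2 = 1 / exp (2 * fst u)" by (simp add: field_simps power2_eq_square)
    then show ?thesis by (simp only: exp_double[of "fst (R u)"] 1 power_mult_distrib) simp
  qed
qed

text \<open>The indicator of the half \<open>2x > ln (\<bar>d\<bar>/4)\<close> of the strip, with value \<open>1/2\<close> on the boundary line. With this value
the reflection turns it into its complement at every point.\<close>

definition upper :: "real \<Rightarrow> R2 \<Rightarrow> real" where
  "upper d u = (1 + sgn (exp (2 * fst u) - \<bar>d\<bar> / 4)) / 2"

lemma upper_range: "0 \<le> upper d u" "upper d u \<le> 1"
  by (auto simp: upper_def sgn_if)

lemma measurable_upper [measurable]: "upper d \<in> borel_measurable borel"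
  unfolding upper_def[abs_def] by measurable

lemma upper_reflect:
  assumes "d \<noteq> 0"
  shows "upper d (ln (\<bar>d\<bar> / 4) + (-1) * fst u, 0 + snd u) = 1 - upper d u"
proof -
  let ?E = "exp (2 * fst u)" and ?D = "\<bar>d\<bar> / 4"
  have D: "0 < ?D" "0 < ?E" using assms by auto
  have "sgn (?D\<^sup>2 / ?E - ?D) = - sgn (?E - ?D)"
  proof -
    have "?D\<^sup>2 / ?E - ?D = (?D / ?E) * (?D - ?E)" using D by (simp add: field_simps power2_eq_square)
    then have "sgn (?D\<^sup>2 / ?E - ?D) = sgn (?D / ?E) * sgn (?D - ?E)" by (simp only: sgn_mult)
    also have "sgn (?D / ?E) = 1" using D by simp
    also have "sgn (?D - ?E) = - sgn (?E - ?D)" by (metis minus_diff_eq sgn_minus)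
    finally show ?thesis by simp
  qed
  from this[folded leaf_reflect(3)[OF assms, of u]] show ?thesis
    unfolding upper_def by (simp only:) (simp add: field_simps)
qed

text \<open>Each of the two sheets is folded over by the reflection. The other half of it becomes the upper half of a sheet
with mixed signs, and the four upper halves are what converges to the cone.\<close>

lemma tame_integral_weight_upper:
  fixes F :: "C2 \<Rightarrow> real"
  assumes "tame F" and [measurable]: "F \<in> borel_measurable borel" and "d \<noteq> 0"
  shows "(\<integral>x. F x \<partial>weight (varif d))
    = (\<Sum>\<sigma>\<in>signs. \<integral>u. upper d u * (area_density d u * F (leaf d \<sigma> u)) \<partial>lborel) / 2"
proof -
  let ?I = "\<lambda>\<sigma>. \<integral>u. upper d u * (area_density d u * F (leaf d \<sigma> u)) \<partial>lborel"
  let ?R = "\<lambda>u::R2. (ln (\<bar>d\<bar> / 4) + (-1) * fst u, 0 + snd u)"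
  let ?s = "\<lambda>\<sigma>::real\<times>real. if 0 < d then (fst \<sigma>, - snd \<sigma>) else (- fst \<sigma>, snd \<sigma>)"
  have "(\<integral>u. area_density d u * F (leaf d \<sigma> u) \<partial>lborel) = ?I \<sigma> + ?I (?s \<sigma>)" if "\<sigma> \<in> signs" for \<sigma>
  proof -
    have int: "integrable lborel (\<lambda>u. area_density d u * F (leaf d \<sigma> u))"
      using tame_integrable[OF assms(1,2) that, of d] by simp
    have int1: "integrable lborel (\<lambda>u. upper d u * (area_density d u * F (leaf d \<sigma> u)))"
      by (rule Bochner_Integration.integrable_bound[OF int])
         (use upper_range in \<open>auto simp: abs_mult intro!: mult_left_le_one_le\<close>)
    have int2: "integrable lborel (\<lambda>u. (1 - upper d u) * (area_density d u * F (leaf d \<sigma> u)))"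
      using Bochner_Integration.integrable_diff[OF int int1] by (simp add: left_diff_distrib)
    have "(\<integral>u. area_density d u * F (leaf d \<sigma> u) \<partial>lborel)
       = ?I \<sigma> + (\<integral>u. (1 - upper d u) * (area_density d u * F (leaf d \<sigma> u)) \<partial>lborel)"
      using Bochner_Integration.integral_add[OF int1 int2] by (simp add: algebra_simps)
    also have "(\<integral>u. (1 - upper d u) * (area_density d u * F (leaf d \<sigma> u)) \<partial>lborel)
       = (\<integral>u. (1 - upper d (?R u)) * (area_density d (?R u) * F (leaf d \<sigma> (?R u))) \<partial>lborel)"
      by (rule integral_R2_affine[symmetric]) auto
    also have "\<dots> = ?I (?s \<sigma>)"
      unfolding upper_reflect[OF assms(3)] leaf_reflect[OF assms(3)] by simp
    finally show ?thesis .
  qed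
  then have *: "(\<integral>x. F x \<partial>weight (varif d)) = (\<Sum>\<sigma>\<in>{(1,1), (-1,-1)}. ?I \<sigma> + ?I (?s \<sigma>)) / 2"
    unfolding tame_integral_weight[OF assms(1,2)] using assms(3) by (simp add: sheets_def signs_def)
  show ?thesis unfolding * by (simp add: signs_def)
qed

text \<open>On the upper half \<open>\<bar>d\<bar> e^(-x) / 4 \<le> e^x\<close>, so the area element is at most a constant times \<open>e^(2x)\<close> there, uniformly
in \<open>d\<close>. For a tame function this gives the integrable bound \<open>O(e^x)\<close> of the dominated convergence theorem. The
limit is the same for \<open>d > 0\<close> and \<open>d < 0\<close>.\<close>

lemma weight_tendsto_cone:
  fixes F :: "C2 \<Rightarrow> real"
  assumes "tame F" and [measurable]: "F \<in> borel_measurable borel" and cont: "continuous_on (- {0}) F"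
  shows "((\<lambda>d. \<integral>x. F x \<partial>weight (varif d)) \<longlongrightarrow> (\<integral>x. F x \<partial>weight (varif 0))) (at 0)"
proof -
  obtain C r where C: "\<And>x. norm x * norm (F x) \<le> C" "\<And>x. r < norm x \<Longrightarrow> F x = 0"
    using assms(1) unfolding tame_def by blast
  have C0: "0 \<le> C" using C(1)[of 0] by simp
  define c where "c = sqrt (real p * real q)"
  define N where "N = ln (max r 1)"
  have c: "0 \<le> c" by (simp add: c_def)
  have "((\<lambda>d. \<integral>u. upper d u * (area_density d u * F (leaf d \<sigma> u)) \<partial>lborel)
      \<longlongrightarrow> (\<integral>u. area_density 0 u * F (leaf 0 \<sigma> u) \<partial>lborel)) (at 0)" if \<sigma>: "\<sigma> \<in> signs" for \<sigma>
  proof (rule dominated_convergence_at)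
    let ?w = "\<lambda>u::R2. (c * (4 * (real p + real q)) * C) * (indicator strip u * (indicator {..N} (fst u) * exp (fst u)))"
    show "integrable lborel ?w" by (intro integrable_mult_right integrable_exp_strip)
    have "\<bar>upper d u * (area_density d u * F (leaf d \<sigma> u))\<bar> \<le> ?w u" for d u
    proof (cases "upper d u \<noteq> 0 \<and> u \<in> strip \<and> norm (leaf d \<sigma> u) \<le> r")
      case True
      let ?e = "exp (fst u)"
      have "\<bar>d\<bar> / 4 \<le> exp (2 * fst u)" using True by (auto simp: upper_def sgn_if split: if_splits)
      then have "\<bar>d\<bar> / 4 * exp (- fst u) \<le> exp (2 * fst u) * exp (- fst u)" by (intro mult_right_mono) auto
      also have "\<dots> = ?e" by (simp flip: exp_add)
      finally have "\<bar>d / 4 * exp (- fst u)\<bar> \<le> ?e" by (simp add: abs_mult)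
      then have "\<bar>phi d (fst u)\<bar> \<le> 2 * ?e" "\<bar>psi d (fst u)\<bar> \<le> 2 * ?e"
        unfolding phi_def psi_def by linarith+
      then have "(phi d (fst u))\<^sup>2 \<le> (2 * ?e)\<^sup>2" "(psi d (fst u))\<^sup>2 \<le> (2 * ?e)\<^sup>2"
        using power_mono[of "\<bar>phi d (fst u)\<bar>" "2 * ?e" 2] power_mono[of "\<bar>psi d (fst u)\<bar>" "2 * ?e" 2]
        by simp_all
      then have "energy d (fst u) \<le> real p * (2 * ?e)\<^sup>2 + real q * (2 * ?e)\<^sup>2"
        unfolding energy_def by (intro add_mono mult_left_mono) auto
      also have "\<dots> = 4 * (real p + real q) * ?e * ?e" by (simp add: power2_eq_square algebra_simps)
      finally have en: "energy d (fst u) \<le> 4 * (real p + real q) * ?e * ?e" .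
      have "?e \<le> max r 1" using leaf_bounds(1)[OF \<sigma>, of u d] True by linarith
      then have N: "fst u \<le> N" by (simp add: N_def ln_ge_iff)
      have "\<bar>upper d u * (area_density d u * F (leaf d \<sigma> u))\<bar>
          \<le> 1 * (c * (energy d (fst u) * \<bar>F (leaf d \<sigma> u)\<bar>))"
      proof -
        have "\<bar>area_density d u * F (leaf d \<sigma> u)\<bar> = c * (energy d (fst u) * \<bar>F (leaf d \<sigma> u)\<bar>)"
          using True energy_pos[of d "fst u"] by (simp add: area_density_def abs_mult c_def)
        then show ?thesis using upper_range[of d u]
          by (simp add: abs_mult[of "upper d u"] mult_left_le_one_le)
      qed
      also have "\<dots> \<le> c * (4 * (real p + real q) * ?e * (?e * \<bar>F (leaf d \<sigma> u)\<bar>))"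
        using mult_right_mono[OF en, of "\<bar>F (leaf d \<sigma> u)\<bar>"] c by (simp add: mult.assoc mult_left_mono)
      also have "\<dots> \<le> c * (4 * (real p + real q) * ?e * (norm (leaf d \<sigma> u) * \<bar>F (leaf d \<sigma> u)\<bar>))"
        using leaf_bounds(1)[OF \<sigma>, of u d] c by (intro mult_left_mono mult_right_mono) auto
      also have "\<dots> \<le> c * (4 * (real p + real q) * ?e * C)"
        using C(1)[of "leaf d \<sigma> u"] c by (intro mult_left_mono) auto
      finally show ?thesis using N True by (simp add: mult_ac)
    next
      case False
      then have "upper d u * (area_density d u * F (leaf d \<sigma> u)) = 0"
        using C(2)[of "leaf d \<sigma> u"] by (auto simp: area_density_def)
      then have "\<bar>upper d u * (area_density d u * F (leaf d \<sigma> u))\<bar> = 0" by (simp only: abs_zero)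
      also have "0 \<le> ?w u" using c C0 by simp
      finally show ?thesis .
    qed
    then show "eventually (\<lambda>d. \<forall>u. \<bar>upper d u * (area_density d u * F (leaf d \<sigma> u))\<bar> \<le> ?w u) (at 0)"
      by (intro always_eventually) blast
    show "((\<lambda>d. upper d u * (area_density d u * F (leaf d \<sigma> u))) \<longlongrightarrow> area_density 0 u * F (leaf 0 \<sigma> u)) (at 0)" for u
    proof -
      have "((\<lambda>d::real. \<bar>d\<bar> / 4) \<longlongrightarrow> \<bar>0\<bar> / 4) (at 0)" by (intro tendsto_intros) auto
      then have "eventually (\<lambda>d. \<bar>d\<bar> / 4 < exp (2 * fst u)) (at 0)" by (intro order_tendstoD(2)[of _ 0]) auto
      then have u: "((\<lambda>d. upper d u) \<longlongrightarrow> 1) (at 0)"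
        by (intro tendsto_eventually) (auto simp: upper_def elim!: eventually_mono)
      have ph: "((\<lambda>d. phi d (fst u)) \<longlongrightarrow> phi 0 (fst u)) (at 0)" "((\<lambda>d. psi d (fst u)) \<longlongrightarrow> psi 0 (fst u)) (at 0)"
        unfolding phi_def psi_def by (intro tendsto_intros; simp)+
      have l: "((\<lambda>d. leaf d \<sigma> u) \<longlongrightarrow> leaf 0 \<sigma> u) (at 0)"
        unfolding leaf_def by (intro tendsto_intros ph)
      have "isCont F (leaf 0 \<sigma> u)"
        using cont leaf_nonzero(3)[OF \<sigma>, of 0 u] continuous_on_eq_continuous_at[of "- {0}" F]
        by (simp add: open_Compl)
      then have f: "((\<lambda>d. F (leaf d \<sigma> u)) \<longlongrightarrow> F (leaf 0 \<sigma> u)) (at 0)" using l by (rule isCont_tendsto_compose)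
      have "((\<lambda>d. upper d u * (area_density d u * F (leaf d \<sigma> u))) \<longlongrightarrow> 1 * (area_density 0 u * F (leaf 0 \<sigma> u))) (at 0)"
        unfolding area_density_def energy_def by (intro tendsto_intros u f ph)
      then show ?thesis by simp
    qed
  qed measurable
  then have "((\<lambda>d. (\<Sum>\<sigma>\<in>signs. \<integral>u. upper d u * (area_density d u * F (leaf d \<sigma> u)) \<partial>lborel) / 2)
      \<longlongrightarrow> (\<Sum>\<sigma>\<in>signs. \<integral>u. area_density 0 u * F (leaf 0 \<sigma> u) \<partial>lborel) / 2) (at 0)"
    by (intro tendsto_intros) auto
  moreover have "eventually (\<lambda>d. (\<Sum>\<sigma>\<in>signs. \<integral>u. upper d u * (area_density d u * F (leaf d \<sigma> u)) \<partial>lborel) / 2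
      = (\<integral>x. F x \<partial>weight (varif d))) (at 0)"
    by (auto simp: eventually_at_filter tame_integral_weight_upper[OF assms(1,2)])
  ultimately have "((\<lambda>d. \<integral>x. F x \<partial>weight (varif d))
      \<longlongrightarrow> (\<Sum>\<sigma>\<in>signs. \<integral>u. area_density 0 u * F (leaf 0 \<sigma> u) \<partial>lborel) / 2) (at 0)"
    by (rule Lim_transform_eventually)
  then show ?thesis
    by (simp add: tame_integral_weight[OF assms(1,2)] sheets_def)
qed

end

section \<open>The mass balance\<close>

lemma C1_lipschitz:
  fixes f :: "'a::euclidean_space \<Rightarrow> 'b::real_normed_vector"
  assumes "Ck_on 1 f UNIV" "0 \<le> C" "\<And>x v. norm (frechet_derivative f (at x) v) \<le> C * norm v"
  shows "norm (f x - f y) \<le> C * norm (x - y)"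
proof (rule differentiable_bound[of UNIV f "\<lambda>x. frechet_derivative f (at x)"])
  show "(f has_derivative frechet_derivative f (at x)) (at x within UNIV)" for x
    using Ck_1_differentiable[OF assms(1)] by (simp add: frechet_derivative_works)
  show "onorm (frechet_derivative f (at x)) \<le> C" for x
    by (rule onorm_bound) (use assms in auto)
qed auto

text \<open>Differentiation under the integral; the difference quotients vanish outside a fixed ball and are bounded there by the Lipschitz constant.\<close>

lemma has_real_derivative_integral_scale:
  fixes f :: "'a::euclidean_space \<Rightarrow> real"
  assumes f: "Ck_on 1 f UNIV" "compact_supp f" and sets: "sets M = sets borel"
    and fin: "\<And>r. integrable M (\<lambda>x. indicator (cball 0 r) x :: real)"
  shows "((\<lambda>l. \<integral>x. f (l *\<^sub>R x) \<partial>M) has_real_derivative (\<integral>x. frechet_derivative f (at x) x \<partial>M)) (at 1)"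
proof -
  let ?D = "\<lambda>x. frechet_derivative f (at x)"
  obtain C r where C: "0 \<le> C" "0 < r" "\<And>x. norm (f x) \<le> C" "\<And>x v. norm (?D x v) \<le> C * norm v"
    "\<And>x. r < norm x \<Longrightarrow> f x = 0" "\<And>x v. r < norm x \<Longrightarrow> ?D x v = 0"
    using C1_compact_supp_bounds[OF f] by metis
  have df: "(f has_derivative ?D x) (at x)" for x
    using Ck_1_differentiable[OF f(1)] by (simp add: frechet_derivative_works)
  have lin: "linear (?D x)" for x using df has_derivative_linear by blast
  have cf: "continuous_on UNIV f" by (rule Ck_1_continuous[OF f(1)])
  have [measurable]: "f \<in> borel_measurable borel" by (rule borel_measurable_continuous_onI[OF cf])
  have [measurable]: "(\<lambda>x. ?D x x) \<in> borel_measurable borel"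
    by (intro borel_measurable_continuous_onI continuous_on_frechet_derivative[OF f(1)] continuous_intros)
  have meas: "borel_measurable M = (borel_measurable borel :: ('a \<Rightarrow> real) set)"
    by (rule measurable_cong_sets[OF sets refl])
  have lip: "\<bar>f x - f y\<bar> \<le> C * norm (x - y)" for x y
    using C1_lipschitz[OF f(1) C(1,4), of x y] by simp
  have bound: "\<bar>(f (l *\<^sub>R x) - f x) / (l - 1)\<bar> \<le> C * (2 * r) * indicator (cball 0 (2 * r)) x"
    if l: "\<bar>l - 1\<bar> < 1/2" "l \<noteq> 1" for l x
  proof (cases "norm x \<le> 2 * r")
    case True
    have "\<bar>f (l *\<^sub>R x) - f x\<bar> \<le> C * (\<bar>l - 1\<bar> * norm x)"
      using lip[of "l *\<^sub>R x" x] by (metis norm_scaleR scaleR_left_diff_distrib scaleR_one)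
    also have "\<dots> \<le> C * (\<bar>l - 1\<bar> * (2 * r))" using True C(1) by (intro mult_left_mono) auto
    finally have "\<bar>f (l *\<^sub>R x) - f x\<bar> / \<bar>l - 1\<bar> \<le> C * (2 * r)"
      using l by (simp add: pos_divide_le_eq mult_ac)
    then show ?thesis using True by (simp add: dist_norm)
  next
    case False
    have "r < norm (l *\<^sub>R x)"
    proof -
      have "1/2 \<le> \<bar>l\<bar>" using l by linarith
      then have "1/2 * norm x \<le> \<bar>l\<bar> * norm x" by (intro mult_right_mono) auto
      then show ?thesis using False by simp
    qed
    then show ?thesis using False C(2) C(5)[of x] C(5)[of "l *\<^sub>R x"] by simp
  qed
  have intf: "integrable M (\<lambda>x. f (l *\<^sub>R x))" if l: "\<bar>l - 1\<bar> < 1/2" for l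
  proof (rule Bochner_Integration.integrable_bound)
    show "integrable M (\<lambda>x. C * indicator (cball 0 (2 * r)) x)" by (intro integrable_mult_right fin)
    show "(\<lambda>x. f (l *\<^sub>R x)) \<in> borel_measurable M" unfolding meas by measurable
    have "norm (f (l *\<^sub>R x)) \<le> norm (C * indicator (cball 0 (2 * r)) x)" for x
    proof (cases "norm x \<le> 2 * r")
      case False
      have "1/2 \<le> \<bar>l\<bar>" using l by linarith
      then have "1/2 * norm x \<le> \<bar>l\<bar> * norm x" by (intro mult_right_mono) auto
      then show ?thesis using False C(5)[of "l *\<^sub>R x"] by simp
    qed (use C(1) C(3)[of "l *\<^sub>R x"] in \<open>simp add: dist_norm\<close>)
    then show "AE x in M. norm (f (l *\<^sub>R x)) \<le> norm (C * indicator (cball 0 (2 * r)) x)" by simp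
  qed
  have "((\<lambda>l. \<integral>x. (f (l *\<^sub>R x) - f x) / (l - 1) \<partial>M) \<longlongrightarrow> (\<integral>x. ?D x x \<partial>M)) (at 1)"
  proof (rule dominated_convergence_at)
    show "integrable M (\<lambda>x. C * (2 * r) * indicator (cball 0 (2 * r)) x)" by (intro integrable_mult_right fin)
    have "eventually (\<lambda>l::real. \<bar>l - 1\<bar> < 1/2 \<and> l \<noteq> 1) (at 1)"
      unfolding eventually_at by (intro exI[of _ "1/2"]) (auto simp: dist_real_def)
    then show "eventually (\<lambda>l. \<forall>x. \<bar>(f (l *\<^sub>R x) - f x) / (l - 1)\<bar> \<le> C * (2 * r) * indicator (cball 0 (2 * r)) x) (at 1)"
      by (rule eventually_mono) (use bound in blast)
    show "((\<lambda>l. (f (l *\<^sub>R x) - f x) / (l - 1)) \<longlongrightarrow> ?D x x) (at 1)" for x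
    proof -
      have "((\<lambda>l::real. l *\<^sub>R x) has_derivative (\<lambda>h. h *\<^sub>R x)) (at 1)" by (auto intro!: derivative_eq_intros)
      from has_derivative_compose[OF this, of f "?D x"] df[of x]
      have "((\<lambda>l. f (l *\<^sub>R x)) has_real_derivative ?D x x) (at 1)"
        by (simp add: has_field_derivative_def linear_cmul[OF lin] mult.commute[of _ "?D x x"])
      then show ?thesis by (simp add: has_field_derivative_iff)
    qed
  qed (simp_all add: meas)
  moreover have "eventually (\<lambda>l. (\<integral>x. (f (l *\<^sub>R x) - f x) / (l - 1) \<partial>M)
     = ((\<integral>x. f (l *\<^sub>R x) \<partial>M) - (\<integral>x. f (1 *\<^sub>R x) \<partial>M)) / (l - 1)) (at 1)"
  proof -
    have "eventually (\<lambda>l::real. \<bar>l - 1\<bar> < 1/2) (at 1)"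
      unfolding eventually_at by (intro exI[of _ "1/2"]) (auto simp: dist_real_def)
    then show ?thesis
      by (rule eventually_mono) (use intf intf[of 1] in \<open>simp add: Bochner_Integration.integral_diff\<close>)
  qed
  ultimately show ?thesis
    unfolding has_field_derivative_iff by (rule Lim_transform_eventually)
qed

context sw
begin

text \<open>The value of \<open>d\<close> for which the normal part of the position is \<open>2 t\<close> times the mean curvature.\<close>

definition delta :: "real \<Rightarrow> real" where
  "delta t = - 2 * t * (real p - real q) / (real p * real q)"

lemma delta_mult: "real p * real q * delta t = - 2 * t * (real p - real q)"
  using p_pos q_pos by (simp add: delta_def)

lemma norm_curvature_leaf:
  assumes "\<sigma> \<in> signs"
  shows "(norm (curvature (leaf d \<sigma> u)))\<^sup>2 = (real p - real q)\<^sup>2 / (real p * real q * energy d (fst u))"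
proof -
  have J: "cpx_J v \<bullet> cpx_J v = v \<bullet> v" for v :: C2
    by (simp add: cpx_J_def inner_prod_def inner_complex_def)
  have "(norm (curvature (leaf d \<sigma> u)))\<^sup>2 = curvature (leaf d \<sigma> u) \<bullet> curvature (leaf d \<sigma> u)"
    by (simp add: dot_square_norm)
  also have "\<dots> = (real p - real q)\<^sup>2 / (real p * real q * energy d (fst u))"
    unfolding curvature_leaf[OF assms] using energy_pos[of d "fst u"] p_pos q_pos
    by (simp add: J leaf_inner[OF assms] power2_eq_square)
  finally show ?thesis .
qed

lemma leaf_normal_component:
  assumes "\<sigma> \<in> signs"
  shows "leaf (delta t) \<sigma> u - leaf_proj (delta t) \<sigma> u (leaf (delta t) \<sigma> u)
      = (2 * t) *\<^sub>R curvature (leaf (delta t) \<sigma> u)"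
    and "leaf (delta t) \<sigma> u \<bullet> curvature (leaf (delta t) \<sigma> u) = 2 * t * (norm (curvature (leaf (delta t) \<sigma> u)))\<^sup>2"
proof -
  let ?d = "delta t"
  let ?e = "energy ?d (fst u)"
  have pq: "real p * real q \<noteq> 0" using p_pos q_pos by simp
  have e: "?e \<noteq> 0" using energy_pos[of ?d "fst u"] by simp
  have "leaf_proj ?d \<sigma> u (leaf ?d \<sigma> u) = leaf ?d \<sigma> u + (?d / ?e) *\<^sub>R cpx_J (leaf2 ?d \<sigma> u)"
    unfolding leaf_proj_apply[OF assms] plane_proj_def position_leaf[OF assms]
    by (simp add: leaf_inner[OF assms])
  then have "leaf ?d \<sigma> u - leaf_proj ?d \<sigma> u (leaf ?d \<sigma> u) = (- ?d / ?e) *\<^sub>R cpx_J (leaf2 ?d \<sigma> u)" by simp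
  also have "- ?d / ?e = 2 * t * ((real p - real q) / (real p * real q * ?e))"
    using e pq by (simp add: delta_def)
  finally show "leaf ?d \<sigma> u - leaf_proj ?d \<sigma> u (leaf ?d \<sigma> u) = (2 * t) *\<^sub>R curvature (leaf ?d \<sigma> u)"
    unfolding curvature_leaf[OF assms] by simp
  show "leaf ?d \<sigma> u \<bullet> curvature (leaf ?d \<sigma> u) = 2 * t * (norm (curvature (leaf ?d \<sigma> u)))\<^sup>2"
    unfolding norm_curvature_leaf[OF assms] unfolding curvature_leaf[OF assms] inner_scaleR_right inner_J_leaf2[OF assms] delta_mult
    by (simp add: power2_eq_square mult_ac)
qed

lemma continuous_on_curvature: "continuous_on (- {0}) curvature"
proof -
  have "(real p)\<^sup>2 * (norm (fst z))\<^sup>2 + (real q)\<^sup>2 * (norm (snd z))\<^sup>2 \<noteq> 0" if "z \<in> - {0}" for z :: C2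
  proof -
    have "fst z \<noteq> 0 \<or> snd z \<noteq> 0" using that by (auto simp: prod_eq_iff)
    then have "0 < (real p)\<^sup>2 * (norm (fst z))\<^sup>2 + (real q)\<^sup>2 * (norm (snd z))\<^sup>2"
      using p_pos q_pos by (auto intro: add_pos_nonneg add_nonneg_pos)
    then show ?thesis by simp
  qed
  then show ?thesis unfolding curvature_def[abs_def] by (intro continuous_intros) auto
qed

lemma brakke_test_measurable:
  assumes "brakke_test f"
  shows "f \<in> borel_measurable borel" "(\<lambda>x. frechet_derivative f (at x) (curvature x)) \<in> borel_measurable borel"
    "(\<lambda>x. frechet_derivative f (at x) x) \<in> borel_measurable borel"
    "(\<lambda>x. f x * (x \<bullet> curvature x)) \<in> borel_measurable borel"
proof -
  have f: "Ck_on 1 f UNIV" using assms by (simp add: brakke_test_def)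
  show [measurable]: "f \<in> borel_measurable borel"
    by (rule borel_measurable_continuous_onI[OF Ck_1_continuous[OF f]])
  have 1: "(\<lambda>z. frechet_derivative f (at (fst z)) (snd z)) \<in> borel_measurable borel"
    by (intro borel_measurable_continuous_onI continuous_on_frechet_derivative[OF f] continuous_intros)
  have 2: "(\<lambda>x. (x, curvature x)) \<in> borel_measurable borel" by measurable
  show "(\<lambda>x. frechet_derivative f (at x) (curvature x)) \<in> borel_measurable borel"
    using measurable_compose[OF 2 1] by simp
  show "(\<lambda>x. frechet_derivative f (at x) x) \<in> borel_measurable borel"
    by (intro borel_measurable_continuous_onI continuous_on_frechet_derivative[OF f] continuous_intros)
  show "(\<lambda>x. f x * (x \<bullet> curvature x)) \<in> borel_measurable borel" by measurable
qed

lemma brakke_test_tame: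
  assumes "brakke_test f"
  shows "tame f" "tame (\<lambda>x. frechet_derivative f (at x) (curvature x))"
    "tame (\<lambda>x. frechet_derivative f (at x) x)" "tame (\<lambda>x. f x * (x \<bullet> curvature x))"
    "tame (\<lambda>x. f x * min ((norm (curvature x))\<^sup>2) (real n))"
proof -
  have f: "Ck_on 1 f UNIV" "compact_supp f" using assms by (simp_all add: brakke_test_def)
  let ?D = "\<lambda>x. frechet_derivative f (at x)"
  obtain C r where C: "0 \<le> C" "0 < r" "\<And>x. norm (f x) \<le> C" "\<And>x v. norm (?D x v) \<le> C * norm v"
    "\<And>x. r < norm x \<Longrightarrow> f x = 0" "\<And>x v. r < norm x \<Longrightarrow> ?D x v = 0"
    using C1_compact_supp_bounds[OF f] by metis
  show "tame f" by (rule tame_bounded[OF C(3,5)])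
  show "tame (\<lambda>x. ?D x (curvature x))" by (rule tame_curvature[OF C(4,6,1)])
  show "tame (\<lambda>x. ?D x x)"
  proof (rule tame_bounded[where r = r])
    show "norm (?D x x) \<le> C * r" for x
    proof (cases "norm x \<le> r")
      case True then show ?thesis using C(4)[of x x] mult_left_mono[OF True C(1)] by linarith
    qed (use C(1,2) C(6)[of x] in simp)
  qed (rule C(6))
  show "tame (\<lambda>x. f x * (x \<bullet> curvature x))"
  proof (rule tame_bounded[where r = r])
    show "norm (f x * (x \<bullet> curvature x)) \<le> C * \<bar>real p - real q\<bar>" for x
      using mult_mono[OF C(3)[of x] order.trans[OF Cauchy_Schwarz_ineq2 norm_curvature[of x]]] C(1)
      by (simp add: abs_mult)
  qed (use C(5) in simp)
  show "tame (\<lambda>x. f x * min ((norm (curvature x))\<^sup>2) (real n))"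
  proof (rule tame_bounded[where r = r])
    show "norm (f x * min ((norm (curvature x))\<^sup>2) (real n)) \<le> C * real n" for x
      using mult_mono[OF C(3)[of x], of "min ((norm (curvature x))\<^sup>2) (real n)" "real n"] C(1)
      by (simp add: abs_mult)
  qed (use C(5) in simp)
qed

text \<open>This is the first variation along \<open>Y(x) = f(x) x\<close>, whose divergence along a plane is \<open>2 f + Df(P x)\<close>, together with
\<open>P x = x - 2 t H\<close>.\<close>

lemma leaf_balance:
  assumes f: "brakke_test f" and \<sigma>: "\<sigma> \<in> signs"
  shows "(\<integral>u. area_density (delta t) u * (2 * f (leaf (delta t) \<sigma> u)
        + frechet_derivative f (at (leaf (delta t) \<sigma> u)) (leaf (delta t) \<sigma> u)) \<partial>lborel)
    = (\<integral>u. area_density (delta t) u * (2 * t * frechet_derivative f (at (leaf (delta t) \<sigma> u)) (curvature (leaf (delta t) \<sigma> u))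
        - f (leaf (delta t) \<sigma> u) * (leaf (delta t) \<sigma> u \<bullet> curvature (leaf (delta t) \<sigma> u))) \<partial>lborel)"
proof -
  let ?d = "delta t"
  let ?X = "leaf ?d \<sigma>" and ?D = "\<lambda>x. frechet_derivative f (at x)"
  define Y :: "C2 \<Rightarrow> C2" where "Y x = f x *\<^sub>R x" for x
  have C1: "Ck_on 1 f UNIV" "compact_supp f" using f by (simp_all add: brakke_test_def)
  have df: "(f has_derivative ?D x) (at x)" for x
    using Ck_1_differentiable[OF C1(1)] by (simp add: frechet_derivative_works)
  have lin: "linear (?D x)" for x using df has_derivative_linear by blast
  have dY: "(Y has_derivative (\<lambda>v. f x *\<^sub>R v + ?D x v *\<^sub>R x)) (at x)" for x
    unfolding Y_def[abs_def] by (rule has_derivative_scaleR[OF df has_derivative_ident])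
  have fY: "frechet_derivative Y (at x) v = f x *\<^sub>R v + ?D x v *\<^sub>R x" for x v
    using frechet_derivative_at[OF dY] by metis
  have Y1: "Ck_on 1 Y UNIV"
    unfolding One_nat_def Ck_on.simps fY
  proof (intro conjI ballI allI)
    show "Y differentiable (at x)" for x using dY[of x] unfolding differentiable_def by blast
    show "continuous_on UNIV (\<lambda>x. f x *\<^sub>R v + ?D x v *\<^sub>R x)" for v
      by (intro continuous_intros Ck_1_continuous[OF C1(1)] continuous_on_frechet_derivative[OF C1(1)])
  qed
  have "closure {x. Y x \<noteq> 0} \<subseteq> closure {x. f x \<noteq> 0}"
    by (intro closure_mono) (auto simp: Y_def)
  then have Y2: "compact_supp Y"
    using C1(2) unfolding compact_supp_def using closed_Int_compact[OF closed_closure] by (metis inf.absorb_iff1)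
  have div: "plane_div (leaf_proj ?d \<sigma> u) Y (?X u) = 2 * f (?X u) + ?D (?X u) (?X u) - 2 * t * ?D (?X u) (curvature (?X u))" for u
  proof -
    have e: "energy ?d (fst u) \<noteq> 0" "real p * real q \<noteq> 0" using energy_pos[of ?d "fst u"] p_pos q_pos by simp_all
    have P: "leaf_proj ?d \<sigma> u (?X u) = ((?X u \<bullet> leaf1 ?d \<sigma> u) / energy ?d (fst u)) *\<^sub>R leaf1 ?d \<sigma> u"
      by (simp add: leaf_proj_apply[OF \<sigma>] plane_proj_def leaf_inner[OF \<sigma>])
    have "plane_div (leaf_proj ?d \<sigma> u) Y (?X u) = 2 * f (?X u) + ?D (?X u) (leaf_proj ?d \<sigma> u (?X u))"
      unfolding leaf_proj_def tangent_space_leaf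
      unfolding plane_div_orthogonal_span[OF leaf_inner(1)[OF \<sigma>] leaf_nonzero(1,2)[OF \<sigma>] Ck_1_differentiable[OF Y1]]
      unfolding tangent_space_leaf[symmetric] leaf_proj_def[symmetric] P fY linear_cmul[OF lin]
      using e by (simp add: inner_add_left leaf_inner[OF \<sigma>] add_divide_distrib)
    also have "leaf_proj ?d \<sigma> u (?X u) = ?X u - (2 * t) *\<^sub>R curvature (?X u)"
      using leaf_normal_component(1)[OF \<sigma>, of t u] by (simp add: algebra_simps)
    finally show ?thesis by (simp add: linear_diff[OF lin] linear_cmul[OF lin])
  qed
  note m = brakke_test_measurable[OF f] and T = brakke_test_tame[OF f]
  have I: "integrable lborel (\<lambda>u. area_density ?d u * f (?X u))"
    "integrable lborel (\<lambda>u. area_density ?d u * ?D (?X u) (curvature (?X u)))"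
    "integrable lborel (\<lambda>u. area_density ?d u * ?D (?X u) (?X u))"
    "integrable lborel (\<lambda>u. area_density ?d u * (f (?X u) * (?X u \<bullet> curvature (?X u))))"
    using tame_integrable[OF T(1) m(1) \<sigma>, of ?d] tame_integrable[OF T(2) m(2) \<sigma>, of ?d]
      tame_integrable[OF T(3) m(3) \<sigma>, of ?d] tame_integrable[OF T(4) m(4) \<sigma>, of ?d] by simp_all
  have "(\<integral>u. area_density ?d u * (2 * f (?X u) + ?D (?X u) (?X u) - 2 * t * ?D (?X u) (curvature (?X u))) \<partial>lborel)
     = - (\<integral>u. area_density ?d u * (f (?X u) * (?X u \<bullet> curvature (?X u))) \<partial>lborel)"
    using leaf_divergence_theorem(3)[OF \<sigma> Y1 Y2, of ?d] unfolding div by (simp add: Y_def)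
  then show ?thesis using I by (simp add: algebra_simps)
qed

lemma weight_balance:
  assumes f: "brakke_test f"
  shows "2 * (\<integral>x. f x \<partial>weight (varif (delta t))) + (\<integral>x. frechet_derivative f (at x) x \<partial>weight (varif (delta t)))
    = 2 * t * (\<integral>x. frechet_derivative f (at x) (curvature x) \<partial>weight (varif (delta t)))
      - (\<integral>x. f x * (x \<bullet> curvature x) \<partial>weight (varif (delta t)))"
proof -
  note m = brakke_test_measurable[OF f] and T = brakke_test_tame[OF f]
  let ?A = "\<lambda>\<sigma> F. \<integral>u. area_density (delta t) u * F (leaf (delta t) \<sigma> u) \<partial>lborel"
  have "2 * ?A \<sigma> f + ?A \<sigma> (\<lambda>x. frechet_derivative f (at x) x)
     = 2 * t * ?A \<sigma> (\<lambda>x. frechet_derivative f (at x) (curvature x)) - ?A \<sigma> (\<lambda>x. f x * (x \<bullet> curvature x))"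
    if "\<sigma> \<in> sheets (delta t)" for \<sigma>
  proof -
    note \<sigma> = sheets_signs[OF that]
    have I: "integrable lborel (\<lambda>u. area_density (delta t) u * f (leaf (delta t) \<sigma> u))"
      "integrable lborel (\<lambda>u. area_density (delta t) u * frechet_derivative f (at (leaf (delta t) \<sigma> u)) (curvature (leaf (delta t) \<sigma> u)))"
      "integrable lborel (\<lambda>u. area_density (delta t) u * frechet_derivative f (at (leaf (delta t) \<sigma> u)) (leaf (delta t) \<sigma> u))"
      "integrable lborel (\<lambda>u. area_density (delta t) u * (f (leaf (delta t) \<sigma> u) * (leaf (delta t) \<sigma> u \<bullet> curvature (leaf (delta t) \<sigma> u))))"
      using tame_integrable[OF T(1) m(1) \<sigma>, of "delta t"] tame_integrable[OF T(2) m(2) \<sigma>, of "delta t"]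
        tame_integrable[OF T(3) m(3) \<sigma>, of "delta t"] tame_integrable[OF T(4) m(4) \<sigma>, of "delta t"] by simp_all
    show ?thesis using leaf_balance[OF f \<sigma>, of t] I
      by (simp add: distrib_left right_diff_distrib mult.left_commute)
  qed
  then have "(\<Sum>\<sigma>\<in>sheets (delta t). 2 * ?A \<sigma> f + ?A \<sigma> (\<lambda>x. frechet_derivative f (at x) x))
     = (\<Sum>\<sigma>\<in>sheets (delta t). 2 * t * ?A \<sigma> (\<lambda>x. frechet_derivative f (at x) (curvature x)) - ?A \<sigma> (\<lambda>x. f x * (x \<bullet> curvature x)))"
    by (intro sum.cong) auto
  then show ?thesis
    unfolding tame_integral_weight[OF T(1) m(1)] tame_integral_weight[OF T(2) m(2)]
      tame_integral_weight[OF T(3) m(3)] tame_integral_weight[OF T(4) m(4)]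
    by (simp add: sum.distrib sum_subtractf flip: sum_distrib_left) 
qed

text \<open>On the leaf \<open>x \<bullet> H = 2 t \<bar>H\<bar>\<^sup>2\<close>, since \<open>H\<close> is normal. So for \<open>t \<noteq> 0\<close> the square of the curvature is as
integrable as the tame function \<open>f(x) (x \<bullet> H)\<close>.\<close>

lemma curvature_square_integral:
  assumes f: "brakke_test f" and "t \<noteq> 0"
  shows "integrable (weight (varif (delta t))) (\<lambda>x. f x * (norm (curvature x))\<^sup>2)"
    and "2 * t * (\<integral>x. f x * (norm (curvature x))\<^sup>2 \<partial>weight (varif (delta t)))
      = (\<integral>x. f x * (x \<bullet> curvature x) \<partial>weight (varif (delta t)))"
proof -
  note m = brakke_test_measurable[OF f] and T = brakke_test_tame[OF f]
  note [measurable] = m(1)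
  have *: "area_density (delta t) u * (f (leaf (delta t) \<sigma> u) * (norm (curvature (leaf (delta t) \<sigma> u)))\<^sup>2)
     = (area_density (delta t) u * (f (leaf (delta t) \<sigma> u) * (leaf (delta t) \<sigma> u \<bullet> curvature (leaf (delta t) \<sigma> u)))) / (2 * t)"
    if "\<sigma> \<in> sheets (delta t)" for \<sigma> u
    using leaf_normal_component(2)[OF sheets_signs[OF that], of t u] assms(2) by simp
  have I: "integrable lborel (\<lambda>u. area_density (delta t) u * (f (leaf (delta t) \<sigma> u) * (norm (curvature (leaf (delta t) \<sigma> u)))\<^sup>2))"
    if "\<sigma> \<in> sheets (delta t)" for \<sigma>
    unfolding *[OF that] using tame_integrable[OF T(4) m(4) sheets_signs[OF that], of "delta t"]
    by (intro integrable_divide) simp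
  show "integrable (weight (varif (delta t))) (\<lambda>x. f x * (norm (curvature x))\<^sup>2)"
    by (rule integrable_weight) (use I in auto)
  have "(\<integral>x. f x * (norm (curvature x))\<^sup>2 \<partial>weight (varif (delta t)))
     = (\<Sum>\<sigma>\<in>sheets (delta t). (\<integral>u. area_density (delta t) u * (f (leaf (delta t) \<sigma> u) * (leaf (delta t) \<sigma> u \<bullet> curvature (leaf (delta t) \<sigma> u))) \<partial>lborel) / (2 * t)) / 2"
    by (subst integral_weight) (use I * in auto)
  also have "2 * t * \<dots> = (\<integral>x. f x * (x \<bullet> curvature x) \<partial>weight (varif (delta t)))"
    unfolding tame_integral_weight[OF T(4) m(4)] using assms(2) by (simp flip: sum_divide_distrib)
  finally show "2 * t * (\<integral>x. f x * (norm (curvature x))\<^sup>2 \<partial>weight (varif (delta t)))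
      = (\<integral>x. f x * (x \<bullet> curvature x) \<partial>weight (varif (delta t)))" .
qed

text \<open>The right-hand side of the Brakke inequality where it is finite.\<close>

definition dissipation :: "(C2 \<Rightarrow> real) \<Rightarrow> real \<Rightarrow> real" where
  "dissipation f d = (\<integral>x. frechet_derivative f (at x) (curvature x) \<partial>weight (varif d))
     - (\<integral>x. f x * (norm (curvature x))\<^sup>2 \<partial>weight (varif d))"

text \<open>Scaling gives \<open>M(s) = (s/t) g(sqrt (s/t))\<close> with \<open>g(l) = \<integral> f(l x) d\<parallel>V\<^sub>t\<parallel>\<close>. Hence \<open>M'(t) = (2 g(1) + g'(1)) / (2t)\<close>,
and \<open>weight_balance\<close> evaluates the numerator.\<close>

lemma mass_derivative:
  assumes f: "brakke_test f" and "t \<noteq> 0" "p \<noteq> q"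
  shows "((\<lambda>s. \<integral>x. f x \<partial>weight (varif (delta s))) has_real_derivative dissipation f (delta t)) (at t)"
proof -
  let ?W = "weight (varif (delta t))"
  note m = brakke_test_measurable[OF f] and T = brakke_test_tame[OF f]
  have C1: "Ck_on 1 f UNIV" "compact_supp f" using f by (simp_all add: brakke_test_def)
  have d: "delta t \<noteq> 0" using assms(2,3) p_pos q_pos by (simp add: delta_def)
  define g where "g l = (\<integral>x. f (l *\<^sub>R x) \<partial>?W)" for l
  define g' where "g' = (\<integral>x. frechet_derivative f (at x) x \<partial>?W)"
  have g: "(g has_real_derivative g') (at 1)"
    unfolding g_def[abs_def] g'_def
  proof (rule has_real_derivative_integral_scale[OF C1])
    fix r
    have [measurable]: "cball (0::C2) r \<in> sets borel" by (simp add: borel_closed)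
    show "integrable ?W (\<lambda>x. indicator (cball 0 r) x :: real)"
      by (rule tame_integrable_weight, rule tame_bounded[of _ 1 r]) auto
  qed simp
  have sq: "((\<lambda>s. sqrt (s / t)) has_real_derivative 1 / (2 * t)) (at t)"
    using assms(2) by (auto intro!: derivative_eq_intros simp: divide_simps)
  have "((\<lambda>s. s / t * g (sqrt (s / t))) has_real_derivative (1 / t * g 1 + g' * (1 / (2 * t)))) (at t)"
  proof -
    have "((\<lambda>s. g (sqrt (s / t))) has_real_derivative g' * (1 / (2 * t))) (at t)"
      by (rule DERIV_chain2[OF _ sq]) (use g assms(2) in simp)
    moreover have "((\<lambda>s. s / t) has_real_derivative 1 / t) (at t)"
      using DERIV_cdivide[OF DERIV_ident] .
    ultimately show ?thesis using DERIV_mult[of "\<lambda>s. s / t" "1 / t" t UNIV "\<lambda>s. g (sqrt (s / t))"] assms(2) by simp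
  qed
  also have "1 / t * g 1 + g' * (1 / (2 * t)) = dissipation f (delta t)"
  proof -
    have "2 * g 1 + g' = 2 * t * dissipation f (delta t)"
      using weight_balance[OF f, of t] curvature_square_integral(2)[OF f assms(2)]
      by (simp add: g_def g'_def dissipation_def right_diff_distrib)
    then show ?thesis using assms(2) by (simp add: field_simps)
  qed
  finally have *: "((\<lambda>s. s / t * g (sqrt (s / t))) has_real_derivative dissipation f (delta t)) (at t)" .
  have op: "open {s. 0 < s / t}" by (intro open_Collect_less continuous_intros) (use assms in auto)
  have tin: "t \<in> {s. 0 < s / t}" using assms by simp
  have "s / t * g (sqrt (s / t)) = (\<integral>x. f x \<partial>weight (varif (delta s)))" if "s \<in> {s. 0 < s / t}" for s
  proof -
    have "delta s = (sqrt (s / t))\<^sup>2 * delta t" using that assms(2) by (simp add: delta_def)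
    then show ?thesis
      using integral_weight_scale[of "sqrt (s / t)" "delta t" f] that d T(1) m(1) by (simp add: g_def)
  qed
  then show ?thesis by (rule has_field_derivative_transform_within_open[OF * op tin])
qed

text \<open>A Lipschitz function that vanishes at the origin is \<open>O(\<bar>x\<bar>)\<close>, while \<open>\<bar>H\<bar>\<^sup>2 = O(\<bar>x\<bar>\<^sup>-\<^sup>2)\<close>.\<close>

lemma curvature_square_tame:
  assumes f: "brakke_test f" and "f 0 = 0"
  shows "tame (\<lambda>x. f x * (norm (curvature x))\<^sup>2)"
proof -
  have C1: "Ck_on 1 f UNIV" "compact_supp f" using f by (simp_all add: brakke_test_def)
  obtain C r where C: "0 \<le> C" "\<And>x v. norm (frechet_derivative f (at x) v) \<le> C * norm v"
    "\<And>x. r < norm x \<Longrightarrow> f x = 0"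
    using C1_compact_supp_bounds[OF C1] by metis
  show ?thesis
    unfolding tame_def
  proof (intro exI allI conjI impI)
    fix x
    have "norm x * norm (f x * (norm (curvature x))\<^sup>2) = \<bar>f x\<bar> * (norm x * (norm (curvature x))\<^sup>2)"
      by (simp add: abs_mult)
    also have "\<dots> \<le> (C * norm x) * (norm x * (norm (curvature x))\<^sup>2)"
      using C1_lipschitz[OF C1(1) C(1,2), of x 0] assms(2) by (intro mult_right_mono) auto
    also have "\<dots> = C * (norm x * norm (curvature x))\<^sup>2" by (simp add: power2_eq_square)
    also have "\<dots> \<le> C * (\<bar>real p - real q\<bar>)\<^sup>2"
      by (intro mult_left_mono power_mono norm_curvature C(1)) auto
    finally show "norm x * norm (f x * (norm (curvature x))\<^sup>2) \<le> C * (\<bar>real p - real q\<bar>)\<^sup>2" .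
    show "f x * (norm (curvature x))\<^sup>2 = 0" if "r < norm x" using C(3)[OF that] by simp
  qed
qed

text \<open>On the cone \<open>\<bar>H\<bar>\<^sup>2\<close> times the area element is constant in the coordinates \<open>(x, s)\<close>, and the part of the strip near
the vertex, where \<open>f > f(0)/2\<close>, has infinite Lebesgue measure.\<close>

lemma curvature_square_cone_infinite:
  assumes f: "brakke_test f" and "f 0 \<noteq> 0" "p \<noteq> q"
  shows "(\<integral>\<^sup>+x. ennreal (f x * (norm (curvature x))\<^sup>2) \<partial>weight (varif 0)) = \<infinity>"
proof -
  note [measurable] = brakke_test_measurable(1)[OF f]
  have nn: "0 \<le> f x" for x using f unfolding brakke_test_def by blast
  then have f0: "0 < f 0" "\<And>x. 0 \<le> f x" using assms(2) by (auto simp: less_le)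
  have "continuous_on UNIV f" using Ck_1_continuous f unfolding brakke_test_def by blast
  then have "isCont f 0" using continuous_on_eq_continuous_at[of UNIV f] by blast
  then have "eventually (\<lambda>x. f 0 / 2 < f x) (nhds 0)"
    using order_tendstoD(1)[of f "f 0" "nhds 0" "f 0 / 2"] f0(1)
    by (simp add: isCont_def tendsto_at_iff_tendsto_nhds)
  then obtain r where r: "0 < r" "\<And>x. norm x < r \<Longrightarrow> f 0 / 2 < f x"
    by (auto simp: eventually_nhds_metric dist_norm)
  define k where "k = sqrt (real p * real q) * ((real p - real q)\<^sup>2 / (real p * real q)) * (f 0 / 2)"
  have k: "0 < k" using p_pos q_pos f0 assms(3) by (simp add: k_def)
  define N where "N = ln (r / (2 * sqrt (real p + real q)))"
  have spq: "0 < sqrt (real p + real q)" using p_pos by simp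
  let ?\<sigma> = "(1, 1) :: real \<times> real"
  have \<sigma>: "?\<sigma> \<in> signs" by (simp add: signs_def)
  have bound: "ennreal k * indicator ({..N} \<times> {0..<2 * pi}) u
      \<le> ennreal (area_density 0 u) * ennreal (f (leaf 0 ?\<sigma> u) * (norm (curvature (leaf 0 ?\<sigma> u)))\<^sup>2)" for u
  proof (cases "fst u \<le> N \<and> u \<in> strip")
    case True
    have "(norm (leaf 0 ?\<sigma> u))\<^sup>2 = (real p + real q) * (exp (fst u))\<^sup>2"
      using leaf_inner(4)[OF \<sigma>, of 0 u] by (simp add: dot_square_norm phi_def psi_def algebra_simps)
    then have "norm (leaf 0 ?\<sigma> u) = sqrt ((real p + real q) * (exp (fst u))\<^sup>2)" by (metis norm_ge_zero real_sqrt_unique)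
    then have "norm (leaf 0 ?\<sigma> u) = sqrt (real p + real q) * exp (fst u)" by (simp add: real_sqrt_mult)
    also have "\<dots> \<le> sqrt (real p + real q) * exp N" using True by (intro mult_left_mono) auto
    also have "\<dots> = r / 2" using r(1) spq by (simp add: N_def)
    finally have "f 0 / 2 \<le> f (leaf 0 ?\<sigma> u)" using r by (intro less_imp_le r(2)) linarith
    then have "sqrt (real p * real q) * ((real p - real q)\<^sup>2 / (real p * real q)) * (f 0 / 2)
       \<le> sqrt (real p * real q) * ((real p - real q)\<^sup>2 / (real p * real q)) * f (leaf 0 ?\<sigma> u)"
      by (intro mult_left_mono) auto
    also have "\<dots> = area_density 0 u * (f (leaf 0 ?\<sigma> u) * (norm (curvature (leaf 0 ?\<sigma> u)))\<^sup>2)"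
      unfolding norm_curvature_leaf[OF \<sigma>] using True energy_pos[of 0 "fst u"] by (simp add: area_density_def)
    finally have "k \<le> area_density 0 u * (f (leaf 0 ?\<sigma> u) * (norm (curvature (leaf 0 ?\<sigma> u)))\<^sup>2)"
      by (simp add: k_def)
    then show ?thesis using area_density_nonneg[of 0 u]
      by (auto simp: indicator_def ennreal_leI f0(2) simp flip: ennreal_mult)
  next
    case False
    then have "u \<notin> {..N} \<times> {0..<2 * pi}" by (auto simp: strip_def mem_Times_iff)
    then show ?thesis by simp
  qed
  have "of_nat n \<le> emeasure lborel {..N}" for n
  proof -
    have "of_nat n = emeasure lborel {N - real n..N}" by (simp add: ennreal_of_nat_eq_real_of_nat)
    also have "\<dots> \<le> emeasure lborel {..N}" by (intro emeasure_mono) auto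
    finally show ?thesis .
  qed
  then have inf: "emeasure lborel {..N} = \<infinity>"
    using ennreal_Ex_less_of_nat by (metis infinity_ennreal_def less_top not_le)
  have "emeasure lborel ({..N} \<times> {0..<2 * pi}) = emeasure lborel {..N} * emeasure lborel {0..<2 * pi}"
    unfolding lborel_prod[symmetric] by (rule lborel.emeasure_pair_measure_Times) auto
  also have "\<dots> = \<infinity>" unfolding inf by (simp add: ennreal_top_mult)
  finally have box_inf: "(\<integral>\<^sup>+u. ennreal k * indicator ({..N} \<times> {0..<2 * pi}) u \<partial>(lborel :: R2 measure)) = \<infinity>"
    using k by (subst nn_integral_cmult_indicator) (auto simp: ennreal_mult_top borel_Times)
  have "\<infinity> \<le> (\<integral>\<^sup>+u. ennreal (area_density 0 u) * ennreal (f (leaf 0 ?\<sigma> u) * (norm (curvature (leaf 0 ?\<sigma> u)))\<^sup>2) \<partial>lborel)"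
  proof -
    have "(\<integral>\<^sup>+u. ennreal k * indicator ({..N} \<times> {0..<2 * pi}) u \<partial>(lborel :: R2 measure))
      \<le> (\<integral>\<^sup>+u. ennreal (area_density 0 u) * ennreal (f (leaf 0 ?\<sigma> u) * (norm (curvature (leaf 0 ?\<sigma> u)))\<^sup>2) \<partial>lborel)"
      by (rule nn_integral_mono) (rule bound)
    then show ?thesis unfolding box_inf .
  qed
  also have "\<dots> \<le> (\<Sum>\<sigma>\<in>sheets 0. \<integral>\<^sup>+u. ennreal (area_density 0 u) * ennreal (f (leaf 0 \<sigma> u) * (norm (curvature (leaf 0 \<sigma> u)))\<^sup>2) \<partial>lborel)"
    by (rule member_le_sum) (use \<sigma> finite_sheets[of 0] in \<open>auto simp: sheets_def\<close>)
  finally have "(\<Sum>\<sigma>\<in>sheets 0. \<integral>\<^sup>+u. ennreal (area_density 0 u) * ennreal (f (leaf 0 \<sigma> u) * (norm (curvature (leaf 0 \<sigma> u)))\<^sup>2) \<partial>lborel) = \<infinity>"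
    by (simp only: top_unique infinity_ennreal_def)
  then have "(\<integral>\<^sup>+x. ennreal (f x * (norm (curvature x))\<^sup>2) \<partial>weight (varif 0)) = ennreal (1/2) * \<infinity>"
    by (subst nn_integral_weight) (measurable, simp only:)
  then show ?thesis by (simp add: ennreal_mult_top)
qed

lemma filterlim_delta: "p \<noteq> q \<Longrightarrow> filterlim delta (at 0) (at 0)"
proof -
  assume "p \<noteq> q"
  then have "delta t \<noteq> 0" if "t \<noteq> 0" for t using that p_pos q_pos by (simp add: delta_def)
  moreover have "(delta \<longlongrightarrow> - 2 * 0 * (real p - real q) / (real p * real q)) (at 0)"
    unfolding delta_def[abs_def] by (intro tendsto_intros) (use p_pos q_pos in auto)
  ultimately show ?thesis by (auto simp: filterlim_at eventually_at_filter)
qed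

lemma Limsup_ereal_eq:
  fixes g :: "real \<Rightarrow> real"
  assumes "(g \<longlongrightarrow> L) (at t)"
  shows "Limsup (at t) (\<lambda>s. ereal (g s)) = ereal L"
  by (rule lim_imp_Limsup) (use assms in auto)

lemma brakke_delta_integrable:
  assumes f: "brakke_test f" and "integrable (weight (varif d)) (\<lambda>x. f x * (norm (curvature x))\<^sup>2)"
  shows "brakke_delta (varif d) f curvature = ereal (dissipation f d)"
proof -
  have "(\<integral>\<^sup>+x. ennreal (f x * (norm (curvature x))\<^sup>2) \<partial>weight (varif d)) \<noteq> \<infinity>"
    using assms(2) by (simp add: real_integrable_def)
  then show ?thesis by (simp add: brakke_delta_def dissipation_def)
qed

text \<open>The truncations \<open>f min(\<bar>H\<bar>\<^sup>2, n)\<close> are tame, so their integrals converge to those over the cone, which are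
unbounded in \<open>n\<close>.\<close>

lemma curvature_square_at_top:
  assumes f: "brakke_test f" and "p \<noteq> q"
    and inf: "(\<integral>\<^sup>+x. ennreal (f x * (norm (curvature x))\<^sup>2) \<partial>weight (varif 0)) = \<infinity>"
  shows "filterlim (\<lambda>t. \<integral>x. f x * (norm (curvature x))\<^sup>2 \<partial>weight (varif (delta t))) at_top (at 0)"
  unfolding filterlim_at_top
proof
  fix K :: real
  note [measurable] = brakke_test_measurable(1)[OF f]
  have f0: "0 \<le> f x" for x using f unfolding brakke_test_def by blast
  have "continuous_on UNIV f" using Ck_1_continuous f unfolding brakke_test_def by blast
  then have cf: "continuous_on S f" for S by (rule continuous_on_subset) simp
  \<comment> \<open>Truncation makes the integrand tame, so that its integral passes to the limit.\<close>
  define F where "F n x = f x * min ((norm (curvature x))\<^sup>2) (real n)" for n x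
  have F0: "0 \<le> F n x" for n x by (simp add: F_def f0)
  have T: "tame (F n)" for n unfolding F_def[abs_def] by (rule brakke_test_tame(5)[OF f])
  have m[measurable]: "F n \<in> borel_measurable borel" for n unfolding F_def[abs_def] by measurable
  have "(SUP n. ennreal (F n x)) = ennreal (f x * (norm (curvature x))\<^sup>2)" for x
  proof (rule LIMSEQ_unique[OF LIMSEQ_SUP])
    show "incseq (\<lambda>n. ennreal (F n x))"
      by (auto simp: incseq_def F_def f0 intro!: ennreal_leI mult_left_mono)
    obtain k where "(norm (curvature x))\<^sup>2 \<le> real k" using real_arch_simple by blast
    then have "F n x = f x * (norm (curvature x))\<^sup>2" if "k \<le> n" for n
      using that by (auto simp: F_def min_def)
    then show "(\<lambda>n. ennreal (F n x)) \<longlonglongrightarrow> ennreal (f x * (norm (curvature x))\<^sup>2)"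
      by (intro tendsto_eventually eventually_sequentiallyI[of k]) simp
  qed
  then have "(SUP n. \<integral>\<^sup>+x. ennreal (F n x) \<partial>weight (varif 0)) = \<infinity>"
    by (subst nn_integral_monotone_convergence_SUP[symmetric])
       (auto simp: inf incseq_def le_fun_def F_def f0 intro!: ennreal_leI mult_left_mono)
  then have "ennreal \<bar>K\<bar> < (SUP n. \<integral>\<^sup>+x. ennreal (F n x) \<partial>weight (varif 0))"
    by (simp only: infinity_ennreal_def ennreal_less_top)
  then obtain n where n: "ennreal \<bar>K\<bar> < (\<integral>\<^sup>+x. ennreal (F n x) \<partial>weight (varif 0))"
    by (auto simp: less_SUP_iff)
  have "(\<integral>\<^sup>+x. ennreal (F n x) \<partial>weight (varif 0)) = ennreal (\<integral>x. F n x \<partial>weight (varif 0))"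
    by (rule nn_integral_eq_integral[OF tame_integrable_weight[OF T m]]) (simp add: F0)
  with n have "K < (\<integral>x. F n x \<partial>weight (varif 0))"
    by (smt (verit) ennreal_less_iff)
  moreover have "((\<lambda>t. \<integral>x. F n x \<partial>weight (varif (delta t))) \<longlongrightarrow> (\<integral>x. F n x \<partial>weight (varif 0))) (at 0)"
  proof (rule filterlim_compose[OF weight_tendsto_cone[OF T m] filterlim_delta[OF assms(2)]])
    show "continuous_on (- {0}) (F n)"
      unfolding F_def[abs_def] by (intro continuous_intros continuous_on_curvature cf)
  qed
  ultimately have "eventually (\<lambda>t. K < (\<integral>x. F n x \<partial>weight (varif (delta t)))) (at 0)"
    by (rule order_tendstoD(1)[rotated])
  moreover have "eventually (\<lambda>t::real. t \<noteq> 0) (at 0)" by (simp add: eventually_at_filter)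
  ultimately show "eventually (\<lambda>t. K \<le> (\<integral>x. f x * (norm (curvature x))\<^sup>2 \<partial>weight (varif (delta t)))) (at 0)"
  proof eventually_elim
    case (elim t)
    have "(\<integral>x. F n x \<partial>weight (varif (delta t))) \<le> (\<integral>x. f x * (norm (curvature x))\<^sup>2 \<partial>weight (varif (delta t)))"
      using tame_integrable_weight[OF T m] curvature_square_integral(1)[OF f elim(2)]
      by (rule integral_mono) (auto simp: F_def f0 intro!: mult_left_mono)
    then show ?case using elim by linarith
  qed
qed

text \<open>For \<open>t \<noteq> 0\<close> the mass is differentiable. At \<open>t = 0\<close> it is continuous, and l'Hopital's rule gives the limit of the
difference quotient, finite or \<open>-\<infinity>\<close>, as the limit of the derivatives.\<close>

theorem mass_upper_derivative_eq:
  assumes f: "brakke_test f"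
  shows "mass_upper_derivative (\<lambda>t. varif (delta t)) f t = brakke_delta (varif (delta t)) f curvature"
proof (cases "p = q")
  case True
  then have d: "delta s = 0" "curvature x = 0" for s x
  proof -
    have "real p - real q = 0" using True by simp
    then show "delta s = 0" "curvature x = 0" unfolding delta_def curvature_def by (simp_all add: zero_prod_def)
  qed
  have "frechet_derivative f (at x) 0 = 0" for x
    using Ck_1_differentiable[of f] f linear_frechet_derivative linear_0 by (metis brakke_test_def)
  then have "brakke_delta (varif (delta t)) f curvature = 0"
    unfolding brakke_delta_def d(2) by simp
  moreover have "mass_upper_derivative (\<lambda>t. varif (delta t)) f t = 0"
    unfolding mass_upper_derivative_def d(1) by (simp add: Limsup_const)
  ultimately show ?thesis by simp
next
  case False
  note m = brakke_test_measurable[OF f] and T = brakke_test_tame[OF f]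
  show ?thesis
  proof (cases "t = 0")
    case t: False
    show ?thesis
      unfolding brakke_delta_integrable[OF f curvature_square_integral(1)[OF f t]] mass_upper_derivative_def
      by (rule Limsup_ereal_eq) (rule mass_derivative[OF f t False, unfolded has_field_derivative_iff])
  next
    case True
    have d0: "delta 0 = 0" by (simp add: delta_def)
    let ?M = "\<lambda>t. \<integral>x. f x \<partial>weight (varif (delta t))"
    let ?A = "\<lambda>t. \<integral>x. frechet_derivative f (at x) (curvature x) \<partial>weight (varif (delta t))"
    let ?B = "\<lambda>t. \<integral>x. f x * (norm (curvature x))\<^sup>2 \<partial>weight (varif (delta t))"
    have C1: "Ck_on 1 f UNIV" using f by (simp add: brakke_test_def)
    have cf: "continuous_on S f" for S using Ck_1_continuous[OF C1] continuous_on_subset by blast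
    note lim = filterlim_compose[OF weight_tendsto_cone filterlim_delta[OF False]]
    have M: "((\<lambda>t. ?M t - ?M 0) \<longlongrightarrow> 0) (at 0)"
      using tendsto_diff[OF lim[OF T(1) m(1) cf] tendsto_const[of "?M 0"]] by (simp add: d0)
    have A: "(?A \<longlongrightarrow> ?A 0) (at 0)" unfolding d0
      by (rule lim[OF T(2) m(2)]) (intro continuous_on_frechet_derivative[OF C1] continuous_intros continuous_on_curvature)
    \<comment> \<open>The filter G is left general to cover both a finite limit and minus infinity.\<close>
    have lh: "filterlim (\<lambda>t. (?M t - ?M 0) / (t - 0)) G (at 0)" if "filterlim (\<lambda>t. dissipation f (delta t)) G (at 0)" for G
    proof (rule lhopital[where g' = "\<lambda>_. 1"])
      show "eventually (\<lambda>t. ((\<lambda>t. ?M t - ?M 0) has_real_derivative dissipation f (delta t)) (at t)) (at 0)"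
        unfolding eventually_at_filter
        using DERIV_diff[OF mass_derivative[OF f _ False] DERIV_const] by (intro always_eventually) auto
      show "((\<lambda>t::real. t - 0) \<longlongrightarrow> 0) (at 0)" by (simp add: tendsto_ident_at)
      show "eventually (\<lambda>t::real. t - 0 \<noteq> 0) (at 0)" by (simp add: eventually_at_filter)
      show "eventually (\<lambda>t::real. ((\<lambda>t. t - 0) has_real_derivative 1) (at t)) (at 0)"
        by (intro always_eventually) (auto intro!: derivative_eq_intros)
    qed (use M that in auto)
    show ?thesis
    proof (cases "(\<integral>\<^sup>+x. ennreal (f x * (norm (curvature x))\<^sup>2) \<partial>weight (varif 0)) = \<infinity>")
      case inf: True
      have "filterlim (\<lambda>t. ?A t + - ?B t) at_bot (at 0)"
        unfolding filterlim_tendsto_add_at_bot_iff[OF A]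
        by (rule filterlim_uminus_at_top[THEN iffD1, OF curvature_square_at_top[OF f False inf]])
      then have "filterlim (\<lambda>t. dissipation f (delta t)) at_bot (at 0)" by (simp add: dissipation_def)
      from lh[OF this] have "((\<lambda>t. ereal ((?M t - ?M 0) / (t - 0))) \<longlongrightarrow> - \<infinity>) (at 0)"
        by (simp add: tendsto_MInfty filterlim_at_bot_dense)
      then have "Limsup (at 0) (\<lambda>t. ereal ((?M t - ?M 0) / (t - 0))) = - \<infinity>"
        by (intro lim_imp_Limsup) auto
      then show ?thesis unfolding mass_upper_derivative_def brakke_delta_def True d0 using inf by simp
    next
      case fin: False
      have f0: "f 0 = 0" using curvature_square_cone_infinite[OF f _ False] fin by blast
      note T' = curvature_square_tame[OF f f0]
      have m': "(\<lambda>x. f x * (norm (curvature x))\<^sup>2) \<in> borel_measurable borel" using m(1) by measurable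
      have B: "(?B \<longlongrightarrow> ?B 0) (at 0)" unfolding d0
        by (rule lim[OF T' m']) (intro continuous_intros continuous_on_curvature cf)
      have "((\<lambda>t. dissipation f (delta t)) \<longlongrightarrow> dissipation f (delta 0)) (at 0)"
        unfolding dissipation_def by (intro tendsto_diff A B)
      from Limsup_ereal_eq[OF lh[OF this]] show ?thesis
        using brakke_delta_integrable[OF f tame_integrable_weight[OF T' m', of 0]]
        unfolding mass_upper_derivative_def True d0 by simp
    qed
  qed
qed

theorem brakke_motion_varif:
  "brakke_motion (\<lambda>t. varif (delta t))" "without_mass_loss (\<lambda>t. varif (delta t))"
  unfolding brakke_motion_def without_mass_loss_def
  using is_varifold_varif gen_mean_curvature_varif mass_upper_derivative_eq by (blast intro: eq_refl)+

end

section \<open>Smoothness and surfaces inside a Euclidean space\<close>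

lemma Ck_on_cong:
  assumes "open S" "\<And>x. x \<in> S \<Longrightarrow> f x = g x" "Ck_on k f S"
  shows "Ck_on k g S"
  using assms(2,3)
proof (induction k arbitrary: f g)
  case 0
  then show ?case by (simp cong: continuous_on_cong)
next
  case (Suc k)
  have d: "(g has_derivative frechet_derivative f (at x)) (at x)" if "x \<in> S" for x
  proof (rule has_derivative_transform_within_open[OF _ assms(1) that])
    show "(f has_derivative frechet_derivative f (at x)) (at x)"
      using Suc.prems(2) that by (simp add: frechet_derivative_works)
  qed (use Suc.prems(1) in auto)
  then have eq: "frechet_derivative f (at x) = frechet_derivative g (at x)" if "x \<in> S" for x
    using that frechet_derivative_at by blast
  have "Ck_on k (\<lambda>x. frechet_derivative g (at x) v) S" for v
    by (rule Suc.IH[of "\<lambda>x. frechet_derivative f (at x) v"]) (use eq Suc.prems(2) in auto)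
  then show ?case using d by (auto simp: differentiable_def)
qed

lemma Ck_on_local:
  assumes "\<And>x. x \<in> S \<Longrightarrow> \<exists>W. open W \<and> x \<in> W \<and> Ck_on k f W"
  shows "Ck_on k f S"
  using assms
proof (induction k arbitrary: f)
  case 0
  show ?case unfolding Ck_on.simps
  proof (rule continuous_at_imp_continuous_on, rule ballI)
    fix x assume "x \<in> S"
    with 0 obtain W where "open W" "x \<in> W" "continuous_on W f" by auto
    then show "isCont f x" by (simp add: continuous_on_eq_continuous_at)
  qed
next
  case (Suc k)
  have "f differentiable (at x)" if "x \<in> S" for x using Suc.prems[OF that] by auto
  moreover have "Ck_on k (\<lambda>x. frechet_derivative f (at x) v) S" for v
    by (rule Suc.IH) (use Suc.prems in fastforce)
  ultimately show ?case by simp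
qed

lemma Ck_on_const: "Ck_on k (\<lambda>_. c) S"
  by (induction k arbitrary: c) simp_all

lemma smooth_on_affine:
  assumes "bounded_linear L"
  shows "smooth_on (\<lambda>x. c + L x) S"
  unfolding smooth_on_def
proof
  fix k
  have d: "((\<lambda>x. c + L x) has_derivative L) (at x)" for x
    using has_derivative_add[OF has_derivative_const bounded_linear.has_derivative[OF assms has_derivative_ident]] by simp
  then have f: "frechet_derivative (\<lambda>x. c + L x) (at x) = L" for x
    using frechet_derivative_at by metis
  show "Ck_on k (\<lambda>x. c + L x) S"
  proof (cases k)
    case 0
    have "continuous_on S (\<lambda>x. c + L x)"
      by (intro continuous_intros bounded_linear.continuous_on[OF assms])
    then show ?thesis using 0 by simp
  next
    case (Suc n)
    have "(\<lambda>x. c + L x) differentiable (at x)" for x using d[of x] unfolding differentiable_def by blast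
    then show ?thesis unfolding Suc by (simp add: f Ck_on_const)
  qed
qed

lemma second_countable_euclidean:
  "second_countable (euclidean :: 'a::second_countable_topology topology)"
proof -
  obtain B :: "'a set set" where B: "countable B" "\<And>C. C \<in> B \<Longrightarrow> open C" "\<And>S. open S \<Longrightarrow> \<exists>U. U \<subseteq> B \<and> S = \<Union>U"
    using univ_second_countable by metis
  have "\<exists>V\<in>B. x \<in> V \<and> V \<subseteq> U" if "open U" "x \<in> U" for U x
    using B(3)[OF that(1)] that(2) by blast
  then show ?thesis unfolding second_countable_def using B(1,2)
    by (intro exI[of _ B]) (auto simp: open_openin[symmetric])
qed

text \<open>For a subset of a Euclidean space the topological conditions are inherited. A transition map is smooth as soon as
it agrees, near each point, with a globally smooth map \<open>T\<close> that satisfies \<open>\<psi> \<circ> T = \<phi>\<close>; in the applications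
\<open>T\<close> is affine.\<close>

lemma smooth_surface_subset:
  fixes S :: "'m::{second_countable_topology, metric_space} set"
  assumes cover: "S = (\<Union>(U, \<phi>)\<in>A. \<phi> ` U)"
    and chart: "\<And>U \<phi>. (U, \<phi>) \<in> A \<Longrightarrow> open U \<and> openin (top_of_set S) (\<phi> ` U) \<and> continuous_on U \<phi>
      \<and> (\<exists>g. continuous_on (\<phi> ` U) g \<and> (\<forall>u\<in>U. g (\<phi> u) = u))"
    and trans: "\<And>U \<phi> W \<psi> u w. (U, \<phi>) \<in> A \<Longrightarrow> (W, \<psi>) \<in> A \<Longrightarrow> u \<in> U \<Longrightarrow> w \<in> W \<Longrightarrow> \<phi> u = \<psi> w
      \<Longrightarrow> \<exists>T. (\<forall>Q. smooth_on T Q) \<and> T u = w \<and> (\<forall>v. \<psi> (T v) = \<phi> v)"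
  shows "smooth_surface (top_of_set S) A"
  unfolding smooth_surface_def
proof (intro conjI ballI)
  show "Hausdorff_space (top_of_set S)"
    by (intro Hausdorff_space_subtopology Hausdorff_space_euclidean)
  show "second_countable (top_of_set S)"
    by (intro second_countable_subtopology second_countable_euclidean)
  show "topspace (top_of_set S) = (\<Union>(U, \<phi>)\<in>A. \<phi> ` U)" using cover by simp
next
  fix X assume "X \<in> A"
  then obtain U \<phi> where X: "X = (U, \<phi>)" "(U, \<phi>) \<in> A" by (cases X) auto
  from chart[OF X(2)] obtain g where c: "open U" "openin (top_of_set S) (\<phi> ` U)" "continuous_on U \<phi>"
    and g: "continuous_on (\<phi> ` U) g" "\<forall>u\<in>U. g (\<phi> u) = u" by auto
  have sub: "subtopology (top_of_set S) (\<phi> ` U) = top_of_set (\<phi> ` U)"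
    using openin_imp_subset[OF c(2)] by (simp add: subtopology_subtopology inf.absorb2)
  have "homeomorphic_maps (top_of_set U) (top_of_set (\<phi> ` U)) \<phi> g"
    unfolding homeomorphic_maps_def using c(3) g by auto
  then have "homeomorphic_map (top_of_set U) (subtopology (top_of_set S) (\<phi> ` U)) \<phi>"
    unfolding sub homeomorphic_map_maps by blast
  then show "case X of (U, \<phi>) \<Rightarrow> open U \<and> openin (top_of_set S) (\<phi> ` U)
      \<and> homeomorphic_map (top_of_set U) (subtopology (top_of_set S) (\<phi> ` U)) \<phi>"
    using c X by simp
next
  fix X assume "X \<in> A"
  then obtain U \<phi> where X: "X = (U, \<phi>)" "(U, \<phi>) \<in> A" by (cases X) auto
  have "smooth_on (\<lambda>u. the_inv_into W \<psi> (\<phi> u)) {u \<in> U. \<phi> u \<in> \<psi> ` W}" if W: "(W, \<psi>) \<in> A" for W \<psi>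
    unfolding smooth_on_def
  proof (intro allI Ck_on_local)
    fix k u assume "u \<in> {u \<in> U. \<phi> u \<in> \<psi> ` W}"
    then obtain w where w: "u \<in> U" "w \<in> W" "\<phi> u = \<psi> w" by auto
    from trans[OF X(2) W w] obtain T where T: "\<And>Q. smooth_on T Q" "T u = w" "\<And>v. \<psi> (T v) = \<phi> v" by blast
    have inj: "inj_on \<psi> W" using chart[OF W] by (metis inj_on_inverseI)
    have "Ck_on 0 T UNIV" using T(1) unfolding smooth_on_def by blast
    then have op: "open (T -` W)" using chart[OF W] by (simp add: open_vimage)
    have "the_inv_into W \<psi> (\<phi> v) = T v" if "v \<in> T -` W" for v
      using the_inv_into_f_f[OF inj, of "T v"] that T(3) by simp
    note eq = this
    have "Ck_on k T (T -` W)" using T(1)[of "T -` W"] unfolding smooth_on_def by blast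
    then have "Ck_on k (\<lambda>u. the_inv_into W \<psi> (\<phi> u)) (T -` W)"
      by (rule Ck_on_cong[OF op, rotated]) (rule eq[symmetric])
    then show "\<exists>Q. open Q \<and> u \<in> Q \<and> Ck_on k (\<lambda>u. the_inv_into W \<psi> (\<phi> u)) Q"
      using op w(2) T(2) by (intro exI[of _ "T -` W"] conjI) simp_all
  qed
  then show "case X of (U, \<phi>) \<Rightarrow> \<forall>(W, \<psi>)\<in>A. smooth_on (\<lambda>u. the_inv_into W \<psi> (\<phi> u)) {u \<in> U. \<phi> u \<in> \<psi> ` W}"
    using X by auto
qed

lemma proper_map_subset:
  fixes F :: "'a::metric_space \<Rightarrow> 'b::metric_space"
  assumes "continuous_on S F" "\<And>K. compact K \<Longrightarrow> compact {x \<in> S. F x \<in> K}"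
  shows "proper_map (top_of_set S) euclidean F"
proof (rule compact_imp_proper_map)
  show "k_space (euclidean :: 'b topology)"
    by (simp add: metrizable_imp_k_space metrizable_space_euclidean)
  show "kc_space (euclidean :: 'b topology)" by (rule kc_space_euclidean)
  show "continuous_map (top_of_set S) euclidean F \<or> kc_space (top_of_set S)" using assms(1) by simp
  show "compactin (top_of_set S) {x \<in> topspace (top_of_set S). F x \<in> K}" if "compactin euclidean K" for K
    using assms(2)[of K] that by (simp add: compactin_subtopology)
qed auto

lemma sets_restrict_borel:
  assumes "S \<in> sets borel"
  shows "sets (restrict_space borel S) = sigma_sets S {N. openin (top_of_set S) N}"
proof -
  have "sets (restrict_space borel S) = (\<inter>) S ` sigma_sets UNIV {T. open T}"
    by (simp add: sets_restrict_space borel_def)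
  also have "\<dots> = sigma_sets S ((\<inter>) S ` {T. open T})"
    by (rule sigma_sets_Int) (use assms in \<open>simp_all add: borel_def\<close>)
  also have "(\<inter>) S ` {T. open T} = {N. openin (top_of_set S) N}"
    by (auto simp: openin_open)
  finally show ?thesis .
qed

lemma continuous_on_locally:
  assumes "\<And>x. x \<in> S \<Longrightarrow> \<exists>N. openin (top_of_set S) N \<and> x \<in> N \<and> continuous_on N f"
  shows "continuous_on S f"
  unfolding continuous_on_def
proof
  fix x assume "x \<in> S"
  from assms[OF this] obtain N where N: "openin (top_of_set S) N" "x \<in> N" "continuous_on N f" by blast
  then obtain T where T: "open T" "N = S \<inter> T" by (auto simp: openin_open)
  then have "at x within S = at x within N"
    using N(2) by (intro at_within_nhd[of x T]) auto
  then show "(f \<longlongrightarrow> f x) (at x within S)" using N unfolding continuous_on_def by simp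
qed

text \<open>A change of coordinates with surjective derivative does not change the image of the derivative.\<close>

lemma tangent_space_reparametrize:
  assumes "\<And>v. Y (T v) = X v" "(T has_derivative T') (at u)" "surj T'" "Y differentiable (at (T u))"
  shows "tangent_space X u = tangent_space Y (T u)"
proof -
  have "(X has_derivative (\<lambda>h. frechet_derivative Y (at (T u)) (T' h))) (at u)"
    using has_derivative_compose[OF assms(2), of Y "frechet_derivative Y (at (T u))"] assms(1,4)
    by (simp add: frechet_derivative_works)
  then have "frechet_derivative X (at u) = (\<lambda>h. frechet_derivative Y (at (T u)) (T' h))"
    using frechet_derivative_at by metis
  then have "range (frechet_derivative X (at u)) = frechet_derivative Y (at (T u)) ` range T'"
    by (simp add: image_image)
  then show ?thesis using assms(3) unfolding tangent_space_def by simp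
qed

context sw
begin

section \<open>The smooth leaves as immersed surfaces\<close>

text \<open>A class of maps that contains the leaves and is closed under partial differentiation, so that smoothness follows by
induction without computing higher derivatives.\<close>

definition expc :: "complex \<Rightarrow> complex \<Rightarrow> complex \<Rightarrow> complex \<Rightarrow> R2 \<Rightarrow> C2" where
  "expc A B C D u = ((A * of_real (exp (fst u)) + B * of_real (exp (- fst u))) * cis (real p * snd u),
     (C * of_real (exp (fst u)) + D * of_real (exp (- fst u))) * cis (- (real q * snd u)))"

lemma has_derivative_expc:
  "(expc A B C D has_derivative (\<lambda>h. expc (A * (of_real (fst h) + \<i> * of_real (real p) * of_real (snd h))) (B * (- of_real (fst h) + \<i> * of_real (real p) * of_real (snd h)))
      (C * (of_real (fst h) - \<i> * of_real (real q) * of_real (snd h))) (D * (- of_real (fst h) - \<i> * of_real (real q) * of_real (snd h))) u)) (at u)"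
proof -
  have "((\<lambda>u::R2. exp (fst u)) has_derivative (\<lambda>h. fst h * exp (fst u))) (at u)"
    "((\<lambda>u::R2. exp (- fst u)) has_derivative (\<lambda>h. - fst h * exp (- fst u))) (at u)"
    by (auto intro!: derivative_eq_intros)
  note e = this[THEN has_derivative_of_real[where 'a = complex]]
  have c: "((\<lambda>u::R2. cis (k * snd u)) has_derivative (\<lambda>h. \<i> * of_real k * of_real (snd h) * cis (k * snd u))) (at u)" for k
  proof -
    have 1: "((\<lambda>u::R2. k * snd u) has_derivative (\<lambda>h. k * snd h)) (at u)"
      by (auto intro!: derivative_eq_intros)
    show ?thesis
      using has_derivative_compose[OF 1 has_derivative_cis[OF has_derivative_ident]]
      by (simp add: scaleR_conv_of_real mult_ac)
  qed
  have comp: "((\<lambda>u. (A * of_real (exp (fst u)) + B * of_real (exp (- fst u))) * cis (k * snd u)) has_derivative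
     (\<lambda>h. (A * (of_real (fst h) + \<i> * of_real k * of_real (snd h)) * of_real (exp (fst u)) + B * (- of_real (fst h) + \<i> * of_real k * of_real (snd h)) * of_real (exp (- fst u))) * cis (k * snd u))) (at u)"
    for A B :: complex and k :: real
    by (rule has_derivative_eq_rhs[OF has_derivative_mult[OF has_derivative_add[OF
          has_derivative_mult_right[OF e(1)] has_derivative_mult_right[OF e(2)]] c]])
       (simp add: fun_eq_iff algebra_simps)
  show ?thesis unfolding expc_def
    using has_derivative_Pair[OF comp[of A B "real p"] comp[of C D "- real q"]] by simp
qed

lemma Ck_on_expc: "Ck_on k (expc A B C D) S"
proof (induction k arbitrary: A B C D)
  case 0
  show ?case unfolding Ck_on.simps expc_def[abs_def] by (intro continuous_intros)
next
  case (Suc k)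
  have "frechet_derivative (expc A B C D) (at x) v = expc (A * (of_real (fst v) + \<i> * of_real (real p) * of_real (snd v))) (B * (- of_real (fst v) + \<i> * of_real (real p) * of_real (snd v)))
      (C * (of_real (fst v) - \<i> * of_real (real q) * of_real (snd v))) (D * (- of_real (fst v) - \<i> * of_real (real q) * of_real (snd v))) x" for x v
    by (rule fun_cong[OF frechet_derivative_at[OF has_derivative_expc, symmetric]])
  moreover have "expc A B C D differentiable (at x)" for x
    using has_derivative_expc unfolding differentiable_def by blast
  ultimately show ?case using Suc by simp
qed

lemma smooth_on_leaf: "smooth_on (leaf d \<sigma>) S"
proof -
  have "leaf d \<sigma> = expc (fst \<sigma> * rq) (fst \<sigma> * rq * (d / 4)) (\<i> * (snd \<sigma> * rp)) (- (\<i> * (snd \<sigma> * rp * (d / 4))))"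
    by (simp add: fun_eq_iff leaf_def expc_def phi_def psi_def algebra_simps)
  then show ?thesis unfolding smooth_on_def using Ck_on_expc by simp
qed

text \<open>The coordinate \<open>e^(2is)\<close> determines \<open>s\<close> up to half turns. It separates the points of the core circle, where one
component of the leaf vanishes, and still identifies the points that a half turn identifies.\<close>

definition lift :: "real \<Rightarrow> real \<Rightarrow> R2 \<Rightarrow> complex \<times> C2" where
  "lift d e u = (cis (2 * snd u), leaf d (e, e) u)"

text \<open>Half a period, on which \<open>e^(2is)\<close> is injective.\<close>

definition slit :: "real \<Rightarrow> R2 set" where "slit a = UNIV \<times> {a<..<a + pi}"

definition surf :: "real \<Rightarrow> (complex \<times> C2) set" where
  "surf d = range (lift d 1) \<union> range (lift d (-1))"

definition charts :: "real \<Rightarrow> (complex \<times> C2) atlas" where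
  "charts d = {(slit a, lift d e) |a e. e = 1 \<or> e = -1}"

text \<open>The deck transformations. A translation of \<open>s\<close> by \<open>k \<pi>\<close> multiplies the components by \<open>(-1)^(pk)\<close> and \<open>(-1)^(qk)\<close>.
Equal signs are absorbed by the sheet sign \<open>e\<close>. Opposite signs are compensated by the reflection of \<open>x\<close>, which
changes the relative sign of \<open>\<phi>\<close> and \<open>\<psi>\<close>.\<close>

lemma lift_shift:
  fixes k :: int
  assumes "d \<noteq> 0"
  obtains g \<kappa> b where "g = 1 \<or> g = -1" "\<kappa> = 1 \<or> \<kappa> = -1"
    "\<And>e u. lift d (g * e) (b + \<kappa> * fst u, of_int k * pi + snd u) = lift d e u"
    "\<And>x. energy d (b + \<kappa> * x) = energy d x"
proof -
  \<comment> \<open>The signs of the two components under the shift, (-1)^(pk) and (-1)^(qk).\<close>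
  define \<eta> \<theta> where "\<eta> = cos (of_int (int p * k) * pi)" and "\<theta> = cos (of_int (int q * k) * pi)"
  have sin0: "sin (of_int n * pi) = 0" for n :: int using sin_npi_int[of n] by (simp add: mult.commute)
  have sg: "cos (of_int n * pi) = 1 \<or> cos (of_int n * pi) = -1" for n :: int
    using sin_cos_squared_add2[of "of_int n * pi"] sin0[of n] by (simp add: power2_eq_1_iff flip: power2_eq_square)
  have signs: "\<eta> = 1 \<or> \<eta> = -1" "\<theta> = 1 \<or> \<theta> = -1" unfolding \<eta>_def \<theta>_def using sg by blast+
  have cis\<eta>: "cis (real p * (of_int k * pi + s)) = of_real \<eta> * cis (real p * s)" for s
  proof -
    have "cis (real p * (of_int k * pi + s)) = cis (of_int (int p * k) * pi) * cis (real p * s)"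
      by (simp add: cis_mult algebra_simps)
    also have "cis (of_int (int p * k) * pi) = of_real \<eta>" using sin0[of "int p * k"] by (simp add: complex_eq_iff \<eta>_def)
    finally show ?thesis .
  qed
  have cis\<theta>: "cis (- (real q * (of_int k * pi + s))) = of_real \<theta> * cis (- (real q * s))" for s
  proof -
    have "cis (- (real q * (of_int k * pi + s))) = cis (- (of_int (int q * k) * pi)) * cis (- (real q * s))"
      by (simp add: cis_mult algebra_simps)
    also have "cis (- (of_int (int q * k) * pi)) = of_real \<theta>" using sin0[of "int q * k"] by (simp add: complex_eq_iff \<theta>_def)
    finally show ?thesis .
  qed
  have cis2: "cis (2 * (of_int k * pi + s)) = cis (2 * s)" for s
  proof -
    have "cis (2 * (of_int k * pi + s)) = cis (2 * pi * of_int k) * cis (2 * s)"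
      by (simp add: cis_mult algebra_simps)
    then show ?thesis by (simp add: cis_multiple_2pi)
  qed
  have lift: "lift d (g * e) (x, of_int k * pi + s) = lift d e (y, s)"
    if "g * \<eta> * phi d x = phi d y" "g * \<theta> * psi d x = psi d y" for g e x y s
  proof -
    have "g * e * rq * phi d x * \<eta> = e * rq * phi d y" "g * e * rp * psi d x * \<theta> = e * rp * psi d y"
      unfolding that[symmetric] by simp_all
    then have "complex_of_real (g * e * rq * phi d x) * of_real \<eta> = of_real (e * rq * phi d y)"
      "complex_of_real (g * e * rp * psi d x) * of_real \<theta> = of_real (e * rp * psi d y)"
      by (metis of_real_mult)+
    then show ?thesis unfolding lift_def leaf_def fst_conv snd_conv cis\<eta> cis\<theta> cis2
      by (metis mult.assoc)
  qed
  show thesis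
  proof (cases "\<eta> = \<theta>")
    case True
    show thesis
    proof (rule that[of \<eta> 1 0])
      show "lift d (\<eta> * e) (0 + 1 * fst u, of_int k * pi + snd u) = lift d e u" for e u
        using lift[of \<eta> "fst u" "fst u" e "snd u"] signs True by auto
    qed (use signs in auto)
  next
    case False
    then have \<theta>: "\<theta> = - \<eta>" using signs by auto
    have 1: "exp (ln (\<bar>d\<bar> / 4) + (-1) * x) = \<bar>d\<bar> / 4 * exp (- x)"
      "exp (- (ln (\<bar>d\<bar> / 4) + (-1) * x)) = 4 / \<bar>d\<bar> * exp x" for x
      using assms by (simp_all add: exp_add exp_diff exp_minus field_simps)
    have *: "phi d (ln (\<bar>d\<bar> / 4) + (-1) * x) = sgn d * phi d x" "psi d (ln (\<bar>d\<bar> / 4) + (-1) * x) = - sgn d * psi d x" for x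
      unfolding phi_def psi_def 1 using assms by (auto simp: sgn_if field_simps)
    have s: "sgn d = 1 \<or> sgn d = -1" using assms by (auto simp: sgn_if)
    show thesis
    proof (rule that[of "\<eta> * sgn d" "-1" "ln (\<bar>d\<bar> / 4)"])
      show "lift d (\<eta> * sgn d * e) (ln (\<bar>d\<bar> / 4) + - 1 * fst u, of_int k * pi + snd u) = lift d e u" for e u
        using lift[of "\<eta> * sgn d" "ln (\<bar>d\<bar> / 4) + - 1 * fst u" "fst u" e "snd u"] signs s unfolding * \<theta> by auto
      show "energy d (ln (\<bar>d\<bar> / 4) + - 1 * x) = energy d x" for x
        using s unfolding energy_def * by auto
    qed (use signs s in auto)
  qed
qed

text \<open>The branch of half the argument that takes values in \<open>(a, a + \<pi>)\<close>.\<close>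

definition ang :: "real \<Rightarrow> complex \<Rightarrow> real" where
  "ang a z = a + pi / 2 + Arg (z * cis (- (2 * a) - pi)) / 2"

text \<open>Rotating the point back by the angle \<open>s\<close> gives the real numbers \<open>e \<phi>(x)\<close> and \<open>e \<psi>(x)\<close>. Their sum is \<open>2 e e^x\<close>, whose
sign is that of the sheet and whose size determines \<open>x\<close>; this inverts the charts continuously.\<close>

definition level :: "real \<Rightarrow> complex \<times> C2 \<Rightarrow> real" where
  "level s m = Re (fst (snd m) * cis (- (real p * s))) / rq + Im (snd (snd m) * cis (real q * s)) / rp"

lemma level_lift: "level (snd u) (lift d e u) = 2 * e * exp (fst u)"
proof -
  have "of_real x * cis t * cis (- t) = of_real x" "\<i> * of_real x * cis (- t) * cis t = \<i> * of_real x" for x t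
    by (simp_all add: mult.assoc cis_mult)
  then have "level (snd u) (lift d e u) = e * rq * phi d (fst u) / rq + e * rp * psi d (fst u) / rp"
    by (simp only: level_def lift_def leaf_def fst_conv snd_conv Re_complex_of_real) simp
  also have "\<dots> = e * (phi d (fst u) + psi d (fst u))" using p_pos q_pos by (simp add: distrib_left)
  finally show ?thesis by (simp add: phi_def psi_def)
qed

lemma ang_cis:
  assumes "a < s" "s < a + pi"
  shows "ang a (cis (2 * s)) = s"
proof -
  have "cis (2 * s) * cis (- (2 * a) - pi) = cis (2 * s - 2 * a - pi)"
    by (simp add: cis_mult algebra_simps)
  then have "Arg (cis (2 * s) * cis (- (2 * a) - pi)) = 2 * s - 2 * a - pi"
    using Arg_cis[of "2 * s - 2 * a - pi"] assms by simp
  then show ?thesis by (simp add: ang_def field_simps)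
qed

lemma lift_inj:
  assumes "lift d e u = lift d e' u'" "snd u = snd u'" "e = 1 \<or> e = -1" "e' = 1 \<or> e' = -1"
  shows "e = e' \<and> u = u'"
proof -
  have eq: "e * exp (fst u) = e' * exp (fst u')"
    using level_lift[of u d e] level_lift[of u' d e'] assms(1,2) by simp
  have "e = e'"
    using eq assms(3,4) exp_gt_zero[of "fst u"] exp_gt_zero[of "fst u'"] by (auto simp del: exp_gt_zero)
  with eq assms(2,3) show ?thesis by (auto simp: prod_eq_iff)
qed

lemma lift_angle:
  assumes "lift d e u = lift d e' u'"
  obtains k :: int where "snd u' = of_int k * pi + snd u"
proof -
  have "cis (2 * snd u) = cis (2 * snd u')" using assms by (simp add: lift_def)
  then have "sin (2 * snd u') = sin (2 * snd u) \<and> cos (2 * snd u') = cos (2 * snd u)"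
    by (simp add: complex_eq_iff)
  then obtain k :: int where "2 * snd u' = 2 * snd u + 2 * pi * k" by (auto simp: sin_cos_eq_iff)
  then show thesis by (intro that[of k]) (simp add: algebra_simps)
qed

lemma lift_deck:
  assumes "d \<noteq> 0" "lift d e u = lift d e' u'" "e = 1 \<or> e = -1" "e' = 1 \<or> e' = -1"
  obtains \<kappa> b and k :: int where "\<kappa> = 1 \<or> \<kappa> = -1" "u' = (b + \<kappa> * fst u, of_int k * pi + snd u)"
    "\<And>v. lift d e' (b + \<kappa> * fst v, of_int k * pi + snd v) = lift d e v"
proof -
  obtain k :: int where k: "snd u' = of_int k * pi + snd u" using lift_angle[OF assms(2)] by blast
  obtain g \<kappa> b where g: "g = 1 \<or> g = -1" "\<kappa> = 1 \<or> \<kappa> = -1"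
    "\<And>e u. lift d (g * e) (b + \<kappa> * fst u, of_int k * pi + snd u) = lift d e u"
    using lift_shift[OF assms(1)] by metis
  have "lift d (g * e) (b + \<kappa> * fst u, of_int k * pi + snd u) = lift d e' u'" using g(3) assms(2) by simp
  from lift_inj[OF this] k g(1) assms(3,4)
  have "g * e = e'" "(b + \<kappa> * fst u, of_int k * pi + snd u) = u'" by auto
  then show thesis using that[of \<kappa> b k] g by auto
qed

lemma lift_slit_inj:
  assumes "d \<noteq> 0" "lift d e u = lift d e' u'" "e = 1 \<or> e = -1" "e' = 1 \<or> e' = -1"
    "\<bar>snd u' - snd u\<bar> < pi"
  shows "e = e' \<and> u = u'"
proof -
  obtain k :: int where k: "snd u' = of_int k * pi + snd u" using lift_angle[OF assms(2)] by blast
  have "\<bar>of_int k\<bar> * pi < 1 * pi" using assms(5) k by (simp add: abs_mult)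
  then have "\<bar>of_int k :: real\<bar> < 1" by (simp only: mult_less_cancel_right_pos[OF pi_gt_zero])
  then have "k = 0" by linarith
  then show ?thesis using lift_inj[OF assms(2) _ assms(3,4)] k by simp
qed

lemma lift_normalize:
  assumes "d \<noteq> 0" "m \<in> surf d"
  obtains e u where "e = 1 \<or> e = -1" "m = lift d e u" "a \<le> snd u" "snd u < a + pi"
proof -
  obtain e u where u: "e = 1 \<or> e = -1" "m = lift d e u" using assms(2) by (auto simp: surf_def)
  obtain n :: int where n: "of_int n \<le> (snd u - a) / pi" "(snd u - a) / pi < of_int n + 1"
    using that[OF of_int_floor_le] by linarith
  define k where "k = - n"
  have k: "a \<le> of_int k * pi + snd u" "of_int k * pi + snd u < a + pi"
    using n by (simp_all add: k_def pos_le_divide_eq pos_divide_less_eq algebra_simps)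
  obtain g \<kappa> b where g: "g = 1 \<or> g = -1" "\<kappa> = 1 \<or> \<kappa> = -1"
    "\<And>e u. lift d (g * e) (b + \<kappa> * fst u, of_int k * pi + snd u) = lift d e u"
    using lift_shift[OF assms(1)] by metis
  show thesis
    by (rule that[of "g * e" "(b + \<kappa> * fst u, of_int k * pi + snd u)"]) (use u g k in auto)
qed

definition slit_domain :: "real \<Rightarrow> (complex \<times> C2) set" where
  "slit_domain a = {m. fst m * cis (- (2 * a) - pi) \<notin> \<real>\<^sub>\<le>\<^sub>0}"

lemma open_slit_domain: "open (slit_domain a)"
proof -
  have "slit_domain a = (\<lambda>m. fst m * cis (- (2 * a) - pi)) -` (- \<real>\<^sub>\<le>\<^sub>0)"
    by (auto simp: slit_domain_def)
  also have "open \<dots>"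
    by (intro open_vimage continuous_intros open_Compl closed_nonpos_Reals_complex)
  finally show ?thesis .
qed

lemma lift_slit_domain:
  assumes "u \<in> slit a"
  shows "lift d e u \<in> slit_domain a"
proof -
  let ?t = "2 * snd u - 2 * a - pi"
  have t: "- pi < ?t" "?t < pi" using assms by (auto simp: slit_def)
  have "cis ?t \<notin> \<real>\<^sub>\<le>\<^sub>0"
  proof
    assume "cis ?t \<in> \<real>\<^sub>\<le>\<^sub>0"
    then have "cos ?t \<le> 0" "sin ?t = 0" by (auto simp: complex_nonpos_Reals_iff)
    then have "?t = 0" using t by (metis abs_less_iff minus_less_iff sin_eq_0_pi)
    then show False using \<open>cos ?t \<le> 0\<close> by simp
  qed
  moreover have "cis (2 * snd u) * cis (- (2 * a) - pi) = cis ?t"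
    by (simp add: cis_mult algebra_simps)
  ultimately show ?thesis by (simp add: slit_domain_def lift_def)
qed

lemma continuous_on_ang: "continuous_on (slit_domain a) (\<lambda>m. ang a (fst m))"
  unfolding ang_def by (intro continuous_intros) (auto simp: slit_domain_def)

lemma continuous_on_level: "continuous_on (slit_domain a) (\<lambda>m. level (ang a (fst m)) m)"
  unfolding level_def using p_pos q_pos by (intro continuous_intros continuous_on_ang) auto

definition lift_inverse :: "real \<Rightarrow> complex \<times> C2 \<Rightarrow> R2" where
  "lift_inverse a m = (ln (\<bar>level (ang a (fst m)) m\<bar> / 2), ang a (fst m))"

lemma lift_inverse:
  assumes "u \<in> slit a" "e = 1 \<or> e = -1"
  shows "level (ang a (fst (lift d e u))) (lift d e u) = 2 * e * exp (fst u)" "lift_inverse a (lift d e u) = u"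
proof -
  have "ang a (fst (lift d e u)) = snd u" using assms by (simp add: lift_def ang_cis slit_def mem_Times_iff)
  then show 1: "level (ang a (fst (lift d e u))) (lift d e u) = 2 * e * exp (fst u)"
    "lift_inverse a (lift d e u) = u"
    using assms(2) by (auto simp: lift_inverse_def level_lift abs_mult prod_eq_iff)
qed

lemma continuous_on_lift: "continuous_on S (lift d e)"
  unfolding lift_def[abs_def] by (intro continuous_intros)

lemma continuous_on_lift_inverse:
  assumes "e = 1 \<or> e = -1"
  shows "continuous_on (lift d e ` slit a) (lift_inverse a)"
proof -
  have sub: "lift d e ` slit a \<subseteq> slit_domain a" using lift_slit_domain by auto
  show ?thesis unfolding lift_inverse_def
    by (intro continuous_intros continuous_on_subset[OF continuous_on_ang sub] continuous_on_subset[OF continuous_on_level sub])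
       (use lift_inverse(1)[OF _ assms] assms in auto)
qed

text \<open>Within the slit domain the sign of \<open>level\<close> tells the two sheets apart, and this is an open condition.\<close>

lemma openin_lift:
  assumes "d \<noteq> 0" "e = 1 \<or> e = -1"
  shows "openin (top_of_set (surf d)) (lift d e ` slit a)"
proof -
  let ?O = "slit_domain a \<inter> (\<lambda>m. e * level (ang a (fst m)) m) -` {0<..}"
  have "open ?O"
    by (intro continuous_open_preimage continuous_intros continuous_on_level open_slit_domain)
  moreover have "lift d e ` slit a = surf d \<inter> ?O"
  proof (intro equalityI subsetI)
    fix m assume "m \<in> lift d e ` slit a"
    then obtain u where u: "u \<in> slit a" "m = lift d e u" by auto
    then show "m \<in> surf d \<inter> ?O"
      using lift_inverse(1)[OF u(1) assms(2), of d] lift_slit_domain[OF u(1)] assms(2) by (auto simp: surf_def)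
  next
    fix m assume m: "m \<in> surf d \<inter> ?O"
    obtain e' u where u: "e' = 1 \<or> e' = -1" "m = lift d e' u" "a \<le> snd u" "snd u < a + pi"
      using lift_normalize[OF assms(1)] m by blast
    have "snd u \<noteq> a"
    proof
      assume "snd u = a"
      then have "fst m * cis (- (2 * a) - pi) = -1" using u(2) by (simp add: lift_def cis_mult complex_eq_iff)
      then show False using m by (auto simp: slit_domain_def)
    qed
    then have us: "u \<in> slit a" using u by (auto simp: slit_def mem_Times_iff)
    have "0 < e * (2 * e' * exp (fst u))" using m lift_inverse(1)[OF us u(1), of d] u(2) by simp
    then have "e = e'" using assms(2) u(1) by auto
    then show "m \<in> lift d e ` slit a" using us u(2) by auto
  qed
  ultimately show ?thesis by (auto simp: openin_open)
qed

lemma smooth_surface_surf: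
  assumes "d \<noteq> 0"
  shows "smooth_surface (top_of_set (surf d)) (charts d)"
proof (rule smooth_surface_subset)
  show "surf d = (\<Union>(U, \<phi>)\<in>charts d. \<phi> ` U)"
  proof (intro equalityI subsetI)
    fix m assume "m \<in> surf d"
    then obtain e u where u: "e = 1 \<or> e = -1" "m = lift d e u" by (auto simp: surf_def)
    have "u \<in> slit (snd u - pi / 2)" by (simp add: slit_def mem_Times_iff)
    then show "m \<in> (\<Union>(U, \<phi>)\<in>charts d. \<phi> ` U)" using u by (auto simp: charts_def)
  qed (auto simp: charts_def surf_def)
next
  fix U \<phi> assume "(U, \<phi>) \<in> charts d"
  then obtain a e where ae: "U = slit a" "\<phi> = lift d e" "e = 1 \<or> e = -1" by (auto simp: charts_def)
  show "open U \<and> openin (top_of_set (surf d)) (\<phi> ` U) \<and> continuous_on U \<phi>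
      \<and> (\<exists>g. continuous_on (\<phi> ` U) g \<and> (\<forall>u\<in>U. g (\<phi> u) = u))"
    unfolding ae(1,2)
  proof (intro conjI exI[of _ "lift_inverse a"] ballI)
    show "open (slit a)" by (simp add: slit_def open_Times)
  qed (use openin_lift[OF assms ae(3)] continuous_on_lift_inverse[OF ae(3)] lift_inverse(2)[OF _ ae(3)]
        continuous_on_lift in auto)
next
  fix U \<phi> W \<psi> u w
  assume "(U, \<phi>) \<in> charts d" "(W, \<psi>) \<in> charts d" "u \<in> U" "w \<in> W" "\<phi> u = \<psi> w"
  then obtain e e' where e: "\<phi> = lift d e" "\<psi> = lift d e'" "e = 1 \<or> e = -1" "e' = 1 \<or> e' = -1" "lift d e u = lift d e' w"
    by (auto simp: charts_def)
  obtain \<kappa> b and k :: int where k: "w = (b + \<kappa> * fst u, of_int k * pi + snd u)"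
    "\<And>v. lift d e' (b + \<kappa> * fst v, of_int k * pi + snd v) = lift d e v"
    using lift_deck[OF assms e(5,3,4)] by metis
  have "bounded_linear (\<lambda>v::R2. (\<kappa> * fst v, snd v))" by (intro bounded_linear_intros)
  from smooth_on_affine[OF this, of "(b, of_int k * pi)"]
  show "\<exists>T. (\<forall>Q. smooth_on T Q) \<and> T u = w \<and> (\<forall>v. \<psi> (T v) = \<phi> v)"
    using k unfolding e by (intro exI[of _ "\<lambda>v. (b + \<kappa> * fst v, of_int k * pi + snd v)"]) simp
qed

end

section \<open>Geometry and area of the immersed leaves\<close>

text \<open>An additive interval function that is invariant under the period \<open>T\<close> has the same value on all half-open intervals
of length \<open>T\<close>: cut \<open>[r, r + T)\<close> at \<open>T\<close> and shift the second piece to \<open>[0, r)\<close>.\<close>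

lemma half_open_interval_period:
  fixes J :: "real \<Rightarrow> real \<Rightarrow> ennreal"
  assumes T: "0 < T" and add: "\<And>x y z. x \<le> y \<Longrightarrow> y \<le> z \<Longrightarrow> J x z = J x y + J y z"
    and shift: "\<And>x y k::int. J (of_int k * T + x) (of_int k * T + y) = J x y"
  shows "J a (a + T) = J 0 T"
proof -
  obtain m :: int where m: "of_int m \<le> a / T" "a / T < of_int m + 1"
    using that[OF of_int_floor_le] by linarith
  define r where "r = a - of_int m * T"
  have r: "0 \<le> r" "r < T" using m T by (simp_all add: r_def pos_le_divide_eq pos_divide_less_eq algebra_simps)
  have "J a (a + T) = J r (r + T)" using shift[of m r "r + T"] by (simp add: r_def algebra_simps)
  also have "\<dots> = J r T + J T (r + T)" using r by (intro add) auto
  also have "J T (r + T) = J 0 r" using shift[of 1 0 r] by (simp add: add.commute)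
  also have "J r T + J 0 r = J 0 T" using add[of 0 r T] r by (simp add: add.commute)
  finally show ?thesis .
qed

lemma half_open_interval_doubling:
  fixes J :: "real \<Rightarrow> real \<Rightarrow> ennreal"
  assumes add: "\<And>x y z. x \<le> y \<Longrightarrow> y \<le> z \<Longrightarrow> J x z = J x y + J y z"
    and shift: "\<And>x y k::int. J (of_int k * pi + x) (of_int k * pi + y) = J x y"
  shows "J 0 (2 * pi) = 2 * J a (a + pi)"
proof -
  have "J 0 (2 * pi) = J 0 pi + J pi (2 * pi)" by (rule add) auto
  also have "J pi (2 * pi) = J 0 pi" using shift[of 1 0 pi] by simp
  finally have 2: "J 0 (2 * pi) = J 0 pi + J 0 pi" .
  have 1: "J a (a + pi) = J 0 pi" by (rule half_open_interval_period[OF pi_gt_zero add shift])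
  show ?thesis unfolding 1 2 mult_2[of "J 0 pi"] ..
qed

context sw
begin

lemma diagonal_signs [simp]: "(1, 1) \<in> signs" "(-1, -1) \<in> signs"
  by (auto simp: signs_def)

lemma snd_lift: "snd \<circ> lift d e = leaf d (e, e)"
  by (simp add: fun_eq_iff lift_def)

lemma charts_cases:
  assumes "(U, \<phi>) \<in> charts d"
  obtains a e where "U = slit a" "\<phi> = lift d e" "e = 1 \<or> e = -1" "(e, e) \<in> signs" "snd \<circ> \<phi> = leaf d (e, e)"
  using assms by (auto simp: charts_def signs_def snd_lift)

text \<open>A bound on the leaf bounds \<open>x\<close> from both sides, as \<open>d \<noteq> 0\<close>, and \<open>s\<close> may be normalized to a half period; the preimage
is closed in a compact set.\<close>

lemma compact_surf_preimage:
  assumes "d \<noteq> 0" "compact K"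
  shows "compact {m \<in> surf d. snd m \<in> K}"
proof -
  obtain r where r: "\<And>x. x \<in> K \<Longrightarrow> norm x \<le> r"
    using compact_imp_bounded[OF assms(2)] unfolding bounded_iff by blast
  define x1 where "x1 = ln (max r 1)"
  define c where "c = 8 * r\<^sup>2 / \<bar>d\<bar> * max r 1 / \<bar>d\<bar> + 1"
  have c: "0 < c" by (simp add: c_def add_nonneg_pos)
  have div: "x \<le> y / z" if "z * x \<le> y" "0 < z" for x y z :: real
    using that by (simp add: pos_le_divide_eq mult.commute)
  let ?Q = "\<Union>e\<in>{1, -1}. lift d e ` ({- ln c..x1} \<times> {0..pi})"
  have "{m \<in> surf d. snd m \<in> K} = ?Q \<inter> snd -` K"
  proof (intro equalityI subsetI)
    fix m assume m: "m \<in> {m \<in> surf d. snd m \<in> K}"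
    then obtain e u where u: "e = 1 \<or> e = -1" "m = lift d e u" "0 \<le> snd u" "snd u < 0 + pi"
      using lift_normalize[OF assms(1), of m 0] by auto
    have \<sigma>: "(e, e) \<in> signs" using u(1) by (auto simp: signs_def)
    have n: "norm (leaf d (e, e) u) \<le> r" using m u(2) r by (auto simp: lift_def)
    have "exp (fst u) \<le> max r 1" using leaf_bounds(1)[OF \<sigma>, of u d] n by linarith
    then have 1: "fst u \<le> x1" by (simp add: x1_def ln_ge_iff)
    define E where "E = exp (- fst u)"
    have "\<bar>d\<bar> * E \<le> 8 * r\<^sup>2 / \<bar>d\<bar> * max r 1" unfolding E_def
      using order.trans[OF leaf_bounds(2)[OF \<sigma> n] mult_left_mono[OF \<open>exp (fst u) \<le> max r 1\<close>]] by simp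
    then have "E \<le> 8 * r\<^sup>2 / \<bar>d\<bar> * max r 1 / \<bar>d\<bar>"
      by (rule div) (use assms(1) in simp)
    then have "exp (- fst u) \<le> c" unfolding c_def E_def by linarith
    then have "- fst u \<le> ln c" using ln_ge_iff[OF c] by blast
    then have "- ln c \<le> fst u" by linarith
    then show "m \<in> ?Q \<inter> snd -` K" using 1 u m by (cases u) auto
  qed (auto simp: surf_def)
  moreover have "compact (?Q \<inter> snd -` K)"
  proof (rule compact_Int_closed)
    show "compact ?Q"
      by (intro compact_UN compact_continuous_image continuous_on_lift compact_Times) auto
    show "closed (snd -` K :: (complex \<times> C2) set)"
      by (intro closed_vimage compact_imp_closed[OF assms(2)] continuous_intros)
  qed
  ultimately show ?thesis by simp
qed

lemma proper_immersion_surf: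
  assumes "d \<noteq> 0"
  shows "proper_immersion (top_of_set (surf d)) (charts d) snd"
  unfolding proper_immersion_def
proof (intro conjI ballI)
  show "proper_map (top_of_set (surf d)) euclidean snd"
    by (intro proper_map_subset continuous_intros compact_surf_preimage[OF assms])
  fix X assume "X \<in> charts d"
  then obtain U \<phi> where X: "X = (U, \<phi>)" "(U, \<phi>) \<in> charts d" by (cases X) auto
  obtain a e where e: "U = slit a" "\<phi> = lift d e" "(e, e) \<in> signs" "snd \<circ> \<phi> = leaf d (e, e)"
    using charts_cases[OF X(2)] by metis
  have "inj (frechet_derivative (leaf d (e, e)) (at u))" for u
  proof (rule injI)
    fix v w assume "frechet_derivative (leaf d (e, e)) (at u) v = frechet_derivative (leaf d (e, e)) (at u) w"
    then have eq: "fst v *\<^sub>R leaf1 d (e, e) u + snd v *\<^sub>R leaf2 d (e, e) u = fst w *\<^sub>R leaf1 d (e, e) u + snd w *\<^sub>R leaf2 d (e, e) u"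
      by (simp add: frechet_leaf)
    have i: "leaf2 d (e, e) u \<bullet> leaf1 d (e, e) u = 0" using leaf_inner(1)[OF e(3)] by (simp add: inner_commute)
    have "fst v = fst w" using arg_cong[OF eq, of "\<lambda>x. x \<bullet> leaf1 d (e, e) u"] leaf_nonzero(1)[OF e(3), of d u]
      by (simp add: inner_add_left i)
    moreover have "snd v = snd w" using arg_cong[OF eq, of "\<lambda>x. x \<bullet> leaf2 d (e, e) u"] leaf_nonzero(2)[OF e(3), of d u]
      by (simp add: inner_add_left leaf_inner(1)[OF e(3)])
    ultimately show "v = w" by (simp add: prod_eq_iff)
  qed
  then show "case X of (U, \<phi>) \<Rightarrow> smooth_on (snd \<circ> \<phi>) U \<and> (\<forall>u\<in>U. inj (frechet_derivative (snd \<circ> \<phi>) (at u)))"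
    using X e(4) smooth_on_leaf by simp
qed

lemma lagrangian_immersion_surf: "lagrangian_immersion (charts d) snd"
  unfolding lagrangian_immersion_def
proof (intro ballI, clarify)
  fix U \<phi> u v w
  assume "(U, \<phi>) \<in> charts d" and vw: "v \<in> tangent_space (snd \<circ> \<phi>) u" "w \<in> tangent_space (snd \<circ> \<phi>) u"
  then obtain e where e: "(e, e) \<in> signs" "snd \<circ> \<phi> = leaf d (e, e)" using charts_cases by metis
  let ?a = "leaf1 d (e, e) u" and ?b = "leaf2 d (e, e) u"
  obtain h k where vw': "v = fst h *\<^sub>R ?a + snd h *\<^sub>R ?b" "w = fst k *\<^sub>R ?a + snd k *\<^sub>R ?b"
    using vw unfolding e(2) tangent_space_def frechet_leaf by auto
  have J: "cpx_J (x *\<^sub>R y + z *\<^sub>R t) = x *\<^sub>R cpx_J y + z *\<^sub>R cpx_J t" for x z and y t :: C2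
    by (simp add: cpx_J_def prod_eq_iff algebra_simps)
  have JJ: "cpx_J y \<bullet> y = 0" "cpx_J y \<bullet> t = - (y \<bullet> cpx_J t)" for y t
    by (simp_all add: cpx_J_def inner_prod_def inner_complex_def)
  have "cpx_J ?a \<bullet> ?b = 0" "cpx_J ?b \<bullet> ?a = 0"
    using inner_J_leaf2(1)[OF e(1), of d u] JJ(2)[of ?a ?b] by (simp_all add: inner_commute)
  then show "omega v w = 0"
    unfolding omega_eq_inner vw' J by (simp add: inner_add_left inner_add_right JJ(1))
qed

text \<open>The Lagrangian angle; charts on overlapping slits may differ in it by a constant.\<close>

definition angle :: "R2 \<Rightarrow> real" where "angle u = (real p - real q) * snd u"

lemma pd_angle: "pd1 angle u = 0" "pd2 angle u = real p - real q"
proof -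
  have "(angle has_derivative (\<lambda>h. (real p - real q) * snd h)) (at u)"
    unfolding angle_def[abs_def] by (auto intro!: derivative_eq_intros)
  from frechet_derivative_at[OF this, symmetric]
  show "pd1 angle u = 0" "pd2 angle u = real p - real q" by (simp_all add: pd1_def pd2_def)
qed

lemma lagrangian_angle_leaf:
  assumes "(e, e) \<in> signs"
  shows "lagrangian_angle (leaf d (e, e)) W angle"
  unfolding lagrangian_angle_def
proof (intro conjI ballI)
  have "smooth_on (\<lambda>u::R2. 0 + (real p - real q) * snd u) W"
    by (intro smooth_on_affine bounded_linear_intros)
  then show "smooth_on angle W" by (simp add: angle_def[abs_def])
  fix u :: R2
  have "sqrt (real p * real q) * energy d (fst u) \<noteq> 0" using p_pos q_pos energy_pos[of d "fst u"] by simp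
  then show "dz1_dz2 (pd1 (leaf d (e, e)) u) (pd2 (leaf d (e, e)) u) / complex_of_real (area_el (leaf d (e, e)) u) = cis (angle u)"
  proof -
    have dz: "dz1_dz2 (leaf1 d (e, e) u) (leaf2 d (e, e) u)
       = of_real (sqrt (real p * real q) * energy d (fst u)) * cis ((real p - real q) * snd u)"
      by (rule dz1_dz2_leaf[OF assms]) simp
    show ?thesis unfolding pd_leaf dz metric_leaf[OF assms] angle_def
      using \<open>_ \<noteq> 0\<close> by (simp del: of_real_mult)
  qed
qed

lemma grad_angle:
  assumes "(e, e) \<in> signs"
  shows "grad1 (leaf d (e, e)) angle u = 0"
    "grad2 (leaf d (e, e)) angle u = (real p - real q) / (real p * real q * energy d (fst u))"
  using energy_pos[of d "fst u"]
  by (simp_all add: grad1_def grad2_def metric_leaf[OF assms] pd_angle power2_eq_square)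

text \<open>The gradient of the angle has no \<open>x\<close>-component, and its \<open>s\<close>-component times the area element is constant.\<close>

lemma hamiltonian_stationary_surf: "hamiltonian_stationary (charts d) snd"
  unfolding hamiltonian_stationary_def
proof (intro ballI, clarify)
  fix U \<phi> u assume c: "(U, \<phi>) \<in> charts d" and u: "u \<in> U"
  obtain a e where e: "U = slit a" "(e, e) \<in> signs" "snd \<circ> \<phi> = leaf d (e, e)" using charts_cases[OF c] by metis
  have "surf_laplacian (leaf d (e, e)) angle w = 0" for w
  proof -
    have "area_el (leaf d (e, e)) w * grad2 (leaf d (e, e)) angle w = sqrt (real p * real q) * ((real p - real q) / (real p * real q))" for w
      unfolding grad_angle[OF e(2)] metric_leaf[OF e(2)] using energy_pos[of d "fst w"] by simp
    then show ?thesis by (simp add: surf_laplacian_def grad_angle(1)[OF e(2)] pd1_def pd2_def frechet_derivative_const)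
  qed
  then show "\<exists>W \<beta>. open W \<and> u \<in> W \<and> W \<subseteq> U \<and> lagrangian_angle (snd \<circ> \<phi>) W \<beta> \<and> (\<forall>w\<in>W. surf_laplacian (snd \<circ> \<phi>) \<beta> w = 0)"
    using u lagrangian_angle_leaf[OF e(2)] unfolding e(3) e(1)
    by (intro exI[of _ "slit a"] exI[of _ angle]) (auto simp: slit_def open_Times)
qed

lemma self_similar_surf: "self_similar t (charts (delta t)) snd"
  unfolding self_similar_def
proof (intro ballI, clarify)
  fix U \<phi> u assume c: "(U, \<phi>) \<in> charts (delta t)" and u: "u \<in> U"
  obtain a e where e: "U = slit a" "\<phi> = lift (delta t) e" "(e, e) \<in> signs" "snd \<circ> \<phi> = leaf (delta t) (e, e)"
    using charts_cases[OF c] by metis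
  have "normal_part (leaf (delta t) (e, e)) w (leaf (delta t) (e, e) w)
     = (2 * t) *\<^sub>R cpx_J (surf_grad (leaf (delta t) (e, e)) angle w)" for w
  proof -
    have "closest_point (tangent_space (leaf (delta t) (e, e)) w) = blinfun_apply (leaf_proj (delta t) (e, e) w)"
      unfolding leaf_proj_apply[OF e(3)] tangent_space_leaf
      by (rule closest_point_orthogonal_span) (use leaf_inner(1) leaf_nonzero e(3) in auto)
    then have "normal_part (leaf (delta t) (e, e)) w (leaf (delta t) (e, e) w) = (2 * t) *\<^sub>R curvature (leaf (delta t) (e, e) w)"
      unfolding normal_part_def using leaf_normal_component(1)[OF e(3)] by simp
    moreover have "cpx_J (surf_grad (leaf (delta t) (e, e)) angle w) = curvature (leaf (delta t) (e, e) w)"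
      unfolding curvature_leaf[OF e(3)] surf_grad_def grad_angle[OF e(3)] pd_leaf
      by (simp add: cpx_J_def scaleR_conv_of_real mult.left_commute)
    ultimately show ?thesis by simp
  qed
  moreover have "snd (\<phi> w) = leaf (delta t) (e, e) w" for w
    using fun_cong[OF e(4), of w] by simp
  ultimately show "\<exists>W \<beta>. open W \<and> u \<in> W \<and> W \<subseteq> U \<and> lagrangian_angle (snd \<circ> \<phi>) W \<beta>
     \<and> (\<forall>w\<in>W. normal_part (snd \<circ> \<phi>) w (snd (\<phi> w)) = (2 * t) *\<^sub>R cpx_J (surf_grad (snd \<circ> \<phi>) \<beta> w))"
    using u lagrangian_angle_leaf[OF e(3)] unfolding e(4) e(1)
    by (intro exI[of _ "slit a"] exI[of _ angle]) (auto simp: slit_def open_Times)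
qed

lemma surf_borel [measurable]: "surf d \<in> sets borel"
proof -
  have "range (lift d e) = (\<Union>n. lift d e ` cball 0 (real n))" for e
  proof -
    have "(\<Union>n. cball (0::R2) (real n)) = UNIV" using real_arch_simple by (auto simp: dist_norm)
    then show ?thesis by (metis image_UN)
  qed
  moreover have "(\<Union>n. lift d e ` cball 0 (real n)) \<in> sets borel" for e
    by (intro sets.countable_UN) (auto intro!: borel_compact compact_continuous_image continuous_on_lift)
  ultimately show ?thesis unfolding surf_def by auto
qed

lemma lift_measurable [measurable]:
  assumes "e = 1 \<or> e = -1"
  shows "lift d e \<in> measurable borel (restrict_space borel (surf d))"
  by (rule measurable_restrict_space2)
     (use assms in \<open>auto simp: surf_def intro: borel_measurable_continuous_onI continuous_on_lift\<close>)

text \<open>Push-forward of one full period of both sheets, with the factor \<open>1/2\<close> because every point is then hit twice.\<close>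

definition surf_measure :: "real \<Rightarrow> (complex \<times> C2) measure" where
  "surf_measure d = sum_measure (1/2) {1, -1} (restrict_space borel (surf d))
     (\<lambda>e. distr (density lborel (area_density d)) (restrict_space borel (surf d)) (lift d e))"

text \<open>For a set \<open>C\<close> in the image of a chart, the total area in \<open>\<alpha> \<le> s < \<beta>\<close> of the parts of the two sheets that are mapped into \<open>C\<close>
is additive in the interval, and invariant under shifts by \<open>\<pi>\<close> since the deck transformations preserve area.
Hence a full period counts twice the half period on which the chart is injective.\<close>

lemma emeasure_surf_measure:
  assumes d: "d \<noteq> 0" and e0: "e0 = 1 \<or> e0 = -1" and B[measurable]: "B \<in> sets borel" and BU: "B \<subseteq> slit a"
  shows "emeasure (surf_measure d) (lift d e0 ` B) = (\<integral>\<^sup>+u\<in>B. ennreal (sqrt (real p * real q) * energy d (fst u)) \<partial>lborel)"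
proof -
  let ?C = "lift d e0 ` B"
  define w where "w u = ennreal (sqrt (real p * real q) * energy d (fst u))" for u :: R2
  have [measurable]: "w \<in> borel_measurable borel" unfolding w_def[abs_def] by measurable
  have CR: "?C \<in> sets (restrict_space borel (surf d))"
  proof -
    let ?O = "lift d e0 ` slit a"
    obtain T where T: "open T" "?O = surf d \<inter> T" using openin_lift[OF d e0] by (auto simp: openin_open)
    have O[measurable]: "?O \<in> sets borel" unfolding T(2) using T(1) by (intro sets.Int surf_borel borel_open)
    have "lift_inverse a \<in> borel_measurable (restrict_space borel ?O)"
      by (rule borel_measurable_continuous_on_restrict[OF continuous_on_lift_inverse[OF e0]])
    from measurable_sets[OF this B] have "lift_inverse a -` B \<inter> ?O \<in> sets (restrict_space borel ?O)"
      by (simp add: space_restrict_space)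
    moreover have "lift_inverse a -` B \<inter> ?O = ?C" using BU lift_inverse(2)[OF _ e0] by force
    ultimately have "?C \<in> sets borel" using O by (simp add: sets_restrict_space_iff)
    moreover have "?C \<subseteq> surf d" using e0 by (auto simp: surf_def)
    ultimately show ?thesis by (simp add: sets_restrict_space_iff)
  qed
  then have C[measurable]: "?C \<in> sets borel" by (simp add: sets_restrict_space_iff)
  have [measurable]: "lift d e \<in> borel_measurable borel" for e
    by (intro borel_measurable_continuous_onI continuous_on_lift)
  define h where "h e u = w u * indicator ?C (lift d e u)" for e u
  have [measurable]: "h e \<in> borel_measurable borel" for e unfolding h_def[abs_def] by measurable
  define J where "J x y = (\<Sum>e\<in>{1, -1}. \<integral>\<^sup>+u. indicator {x..<y} (snd u) * h e u \<partial>lborel)" for x y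
  have "emeasure (surf_measure d) ?C = ennreal (1/2) * (\<Sum>e\<in>{1, -1}. emeasure (distr (density lborel (area_density d)) (restrict_space borel (surf d)) (lift d e)) ?C)"
    unfolding surf_measure_def by (rule emeasure_sum_measure) (use CR in auto)
  also have "(\<Sum>e\<in>{1, -1}. emeasure (distr (density lborel (area_density d)) (restrict_space borel (surf d)) (lift d e)) ?C) = J 0 (2 * pi)"
    unfolding J_def
  proof (rule sum.cong[OF refl])
    fix e :: real assume "e \<in> {1, -1}"
    then have e: "e = 1 \<or> e = -1" by auto
    have pre: "lift d e -` ?C \<in> sets borel"
      using measurable_sets[of "lift d e" borel borel ?C] by simp
    have "emeasure (distr (density lborel (area_density d)) (restrict_space borel (surf d)) (lift d e)) ?C
      = emeasure (density lborel (area_density d)) (lift d e -` ?C)"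
      using lift_measurable[OF e, of d] CR by (subst emeasure_distr) auto
    also have "\<dots> = (\<integral>\<^sup>+u. ennreal (area_density d u) * indicator (lift d e -` ?C) u \<partial>lborel)"
      using pre by (subst emeasure_density) auto
    also have "\<dots> = (\<integral>\<^sup>+u. indicator {0..<2 * pi} (snd u) * h e u \<partial>lborel)"
      by (intro nn_integral_cong) (auto simp: h_def w_def area_density_def indicator_def strip_def)
    finally show "emeasure (distr (density lborel (area_density d)) (restrict_space borel (surf d)) (lift d e)) ?C
       = (\<integral>\<^sup>+u. indicator {0..<2 * pi} (snd u) * h e u \<partial>lborel)" .
  qed
  also have "J 0 (2 * pi) = 2 * J a (a + pi)"
  proof (rule half_open_interval_doubling)
    fix x y z :: real assume "x \<le> y" "y \<le> z"
    then have "indicator {x..<z} t * v = indicator {x..<y} t * v + indicator {y..<z} t * v" for t :: real and v :: ennreal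
      by (auto simp: indicator_def)
    then show "J x z = J x y + J y z" unfolding J_def
      by (simp add: nn_integral_add sum.distrib)
  next
    fix x y :: real and k :: int
    obtain g \<kappa> b where g: "g = 1 \<or> g = -1" "\<kappa> = 1 \<or> \<kappa> = -1"
      and l: "\<And>e u. lift d (g * e) (b + \<kappa> * fst u, of_int k * pi + snd u) = lift d e u"
        "\<And>x. energy d (b + \<kappa> * x) = energy d x"
      using lift_shift[OF d] by metis
    have "(\<integral>\<^sup>+u. indicator {of_int k * pi + x..<of_int k * pi + y} (snd u) * h (g * e) u \<partial>lborel)
       = (\<integral>\<^sup>+u. indicator {x..<y} (snd u) * h e u \<partial>lborel)" for e
    proof -
      have "(\<integral>\<^sup>+u. indicator {of_int k * pi + x..<of_int k * pi + y} (snd u) * h (g * e) u \<partial>lborel)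
        = (\<integral>\<^sup>+u. indicator {of_int k * pi + x..<of_int k * pi + y} (snd (b + \<kappa> * fst u, of_int k * pi + snd u))
            * h (g * e) (b + \<kappa> * fst u, of_int k * pi + snd u) \<partial>lborel)"
        using g(2) by (intro nn_integral_R2_affine[symmetric]) auto
      also have "\<dots> = (\<integral>\<^sup>+u. indicator {x..<y} (snd u) * h e u \<partial>lborel)"
        unfolding h_def l(1) w_def fst_conv l(2) by (auto intro!: nn_integral_cong simp: indicator_def)
      finally show ?thesis .
    qed
    from this[of 1] this[of "-1"] show "J (of_int k * pi + x) (of_int k * pi + y) = J x y"
      using g(1) unfolding J_def by (auto simp: add.commute)
  qed
  also have "J a (a + pi) = (\<integral>\<^sup>+u\<in>B. w u \<partial>lborel)"
  proof -
    have key: "lift d e u \<in> ?C \<longleftrightarrow> e = e0 \<and> u \<in> B" if "a \<le> snd u" "snd u < a + pi" "e = 1 \<or> e = -1" for e u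
    proof
      assume "lift d e u \<in> ?C"
      then obtain u0 where u0: "u0 \<in> B" "lift d e u = lift d e0 u0" by auto
      then have "a < snd u0" "snd u0 < a + pi" using BU by (auto simp: slit_def)
      then have "\<bar>snd u0 - snd u\<bar> < pi" using that by linarith
      then show "e = e0 \<and> u \<in> B" using lift_slit_inj[OF d u0(2) that(3) e0] u0(1) by blast
    qed auto
    have "J a (a + pi) = (\<integral>\<^sup>+u. indicator {a..<a+pi} (snd u) * h 1 u + indicator {a..<a+pi} (snd u) * h (-1) u \<partial>lborel)"
      unfolding J_def by (simp add: nn_integral_add)
    also have "\<dots> = (\<integral>\<^sup>+u. w u * indicator B u \<partial>lborel)"
    proof (rule nn_integral_cong)
      fix u :: R2
      show "indicator {a..<a+pi} (snd u) * h 1 u + indicator {a..<a+pi} (snd u) * h (-1) u = w u * indicator B u"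
      proof (cases "a \<le> snd u \<and> snd u < a + pi")
        case True
        have "h e u = (if e = e0 \<and> u \<in> B then w u else 0)" if "e = 1 \<or> e = -1" for e
          using key[of u e] True that by (simp add: h_def indicator_def)
        then show ?thesis using True e0 by (auto simp: indicator_def)
      next
        case False
        then have "u \<notin> B" using BU by (auto simp: slit_def)
        then show ?thesis using False by (auto simp: indicator_def)
      qed
    qed
    finally show ?thesis .
  qed
  also have "ennreal (1/2) * (2 * (\<integral>\<^sup>+u\<in>B. w u \<partial>lborel)) = (\<integral>\<^sup>+u\<in>B. w u \<partial>lborel)"
  proof -
    have "ennreal (1/2) * 2 = 1" using ennreal_mult[of "1/2" 2] by simp
    then show ?thesis by (simp flip: mult.assoc)
  qed
  finally show ?thesis by (simp add: w_def)
qed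

lemma area_measure_surf:
  assumes "d \<noteq> 0"
  shows "area_measure (top_of_set (surf d)) (charts d) snd (surf_measure d)"
  unfolding area_measure_def
proof (intro conjI ballI)
  show "space (surf_measure d) = topspace (top_of_set (surf d))"
    by (simp add: surf_measure_def space_restrict_space)
  show "sets (surf_measure d) = sigma_sets (topspace (top_of_set (surf d))) {N. openin (top_of_set (surf d)) N}"
    using sets_restrict_borel[OF surf_borel] by (simp add: surf_measure_def)
  fix X assume "X \<in> charts d"
  then obtain U \<phi> where X: "X = (U, \<phi>)" "(U, \<phi>) \<in> charts d" by (cases X) auto
  obtain a e where e: "U = slit a" "\<phi> = lift d e" "e = 1 \<or> e = -1" "(e, e) \<in> signs" "snd \<circ> \<phi> = leaf d (e, e)"
    using charts_cases[OF X(2)] by metis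
  show "case X of (U, \<phi>) \<Rightarrow> \<forall>B\<in>sets borel. B \<subseteq> U \<longrightarrow> emeasure (surf_measure d) (\<phi> ` B) = (\<integral>\<^sup>+u\<in>B. ennreal (area_el (snd \<circ> \<phi>) u) \<partial>lborel)"
    using emeasure_surf_measure[OF assms e(3)] unfolding X split e(5) metric_leaf[OF e(4)] unfolding e(1,2) by blast
qed

text \<open>Two parameters of the same point differ by a deck transformation, so they give the same tangent plane.\<close>

lemma tangent_plane_lift:
  assumes "d \<noteq> 0" "e = 1 \<or> e = -1"
  shows "tangent_plane (charts d) snd (lift d e u) = tangent_space (leaf d (e, e)) u"
proof -
  have "tangent_space (snd \<circ> \<phi>) w = tangent_space (leaf d (e, e)) u" if c: "(U, \<phi>) \<in> charts d" "\<phi> w = lift d e u" for U \<phi> w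
  proof -
    obtain e' where e': "\<phi> = lift d e'" "e' = 1 \<or> e' = -1" "snd \<circ> \<phi> = leaf d (e', e')" using charts_cases[OF c(1)] by metis
    obtain \<kappa> b and k :: int where k: "\<kappa> = 1 \<or> \<kappa> = -1" "w = (b + \<kappa> * fst u, of_int k * pi + snd u)"
      "\<And>v. lift d e' (b + \<kappa> * fst v, of_int k * pi + snd v) = lift d e v"
      using lift_deck[OF assms(1) _ assms(2) e'(2)] c(2) e'(1) by metis
    let ?T = "\<lambda>v::R2. (b + \<kappa> * fst v, of_int k * pi + snd v)"
    have "tangent_space (leaf d (e, e)) u = tangent_space (leaf d (e', e')) (?T u)"
    proof (rule tangent_space_reparametrize)
      show "leaf d (e', e') (?T v) = leaf d (e, e) v" for v using k(3)[of v] by (simp add: lift_def)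
      show "(?T has_derivative (\<lambda>h. (\<kappa> * fst h, snd h))) (at u)" by (auto intro!: derivative_eq_intros)
      show "surj (\<lambda>h::R2. (\<kappa> * fst h, snd h))"
        by (rule surjI[of _ "\<lambda>h. (\<kappa> * fst h, snd h)"]) (use k(1) in auto)
      show "leaf d (e', e') differentiable at (?T u)" using has_derivative_leaf unfolding differentiable_def by blast
    qed
    then show ?thesis using e'(3) k(2) by simp
  qed
  moreover have "\<exists>U \<phi> w. (U, \<phi>) \<in> charts d \<and> w \<in> U \<and> \<phi> w = lift d e u"
  proof (intro exI conjI)
    show "(slit (snd u - pi / 2), lift d e) \<in> charts d" using assms(2) by (auto simp: charts_def)
    show "u \<in> slit (snd u - pi / 2)" by (simp add: slit_def mem_Times_iff)
  qed simp
  ultimately have "{tangent_space (snd \<circ> \<phi>) w |U \<phi> w. (U, \<phi>) \<in> charts d \<and> w \<in> U \<and> \<phi> w = lift d e u} = {tangent_space (leaf d (e, e)) u}"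
    by blast
  then show ?thesis unfolding tangent_plane_def by simp
qed

lemma immersion_varifold_surf:
  assumes "d \<noteq> 0"
  shows "immersion_varifold (top_of_set (surf d)) (charts d) snd (varif d)"
  unfolding immersion_varifold_def
proof (intro exI conjI)
  show "area_measure (top_of_set (surf d)) (charts d) snd (surf_measure d)" by (rule area_measure_surf[OF assms])
  let ?g = "\<lambda>m. (snd m, orth_proj (tangent_plane (charts d) snd m))"
  have gl: "?g (lift d e u) = (leaf d (e, e) u, leaf_proj d (e, e) u)" if "e = 1 \<or> e = -1" for e u
    by (simp add: tangent_plane_lift[OF assms that] leaf_proj_def) (simp add: lift_def)
  \<comment> \<open>Continuity of the tangent plane gives the measurability needed for the push-forward; it is local, hence checked in one chart.\<close>
  have "continuous_on (surf d) ?g"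
  proof (rule continuous_on_locally)
    fix m assume "m \<in> surf d"
    then obtain e u where u: "e = 1 \<or> e = -1" "m = lift d e u" by (auto simp: surf_def)
    let ?a = "snd u - pi / 2"
    have us: "u \<in> slit ?a" by (simp add: slit_def mem_Times_iff)
    have \<sigma>: "(e, e) \<in> signs" using u(1) by (auto simp: signs_def)
    have "continuous_on (lift d e ` slit ?a) (\<lambda>m. (leaf d (e, e) (lift_inverse ?a m), leaf_proj d (e, e) (lift_inverse ?a m)))"
      by (intro continuous_on_Pair continuous_on_compose2[OF continuous_on_leaf(1)[of UNIV] continuous_on_lift_inverse[OF u(1)]]
          continuous_on_compose2[OF continuous_on_leaf_proj[OF \<sigma>, of UNIV] continuous_on_lift_inverse[OF u(1)]]) auto
    moreover have "(leaf d (e, e) (lift_inverse ?a m), leaf_proj d (e, e) (lift_inverse ?a m)) = ?g m" if "m \<in> lift d e ` slit ?a" for m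
      using that gl[OF u(1)] lift_inverse(2)[OF _ u(1)] by force
    ultimately have "continuous_on (lift d e ` slit ?a) ?g" by (simp cong: continuous_on_cong)
    then show "\<exists>N. openin (top_of_set (surf d)) N \<and> m \<in> N \<and> continuous_on N ?g"
      using openin_lift[OF assms u(1)] us u(2) by blast
  qed
  then have g: "?g \<in> borel_measurable (restrict_space borel (surf d))"
    by (rule borel_measurable_continuous_on_restrict)
  have "distr (surf_measure d) borel ?g
    = sum_measure (1/2) {1, -1} borel (\<lambda>e. distr (distr (density lborel (area_density d)) (restrict_space borel (surf d)) (lift d e)) borel ?g)"
    unfolding surf_measure_def by (rule distr_sum_measure) (use g in auto)
  also have "\<dots> = varif d"
  proof -
    have "distr (distr (density lborel (area_density d)) (restrict_space borel (surf d)) (lift d e)) borel ?g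
       = param_varifold strip (leaf d (e, e))" if "e = 1 \<or> e = -1" for e
    proof -
      have \<sigma>: "(e, e) \<in> signs" using that by (auto simp: signs_def)
      have "distr (distr (density lborel (area_density d)) (restrict_space borel (surf d)) (lift d e)) borel ?g
        = distr (density lborel (area_density d)) borel (?g \<circ> lift d e)"
        using g lift_measurable[OF that, of d] by (subst distr_distr) auto
      also have "?g \<circ> lift d e = (\<lambda>u. (leaf d (e, e) u, leaf_proj d (e, e) u))"
        using gl[OF that] by (simp add: fun_eq_iff)
      finally show ?thesis by (simp add: param_varifold_leaf[OF \<sigma>])
    qed
    from this[of 1] this[of "-1"] show ?thesis unfolding varif_def sum_measure_def using assms by (simp add: sheets_def)
  qed
  finally show "varif d = distr (surf_measure d) borel ?g" by simp
qed

theorem smooth_ham_stat_self_similar_leaf: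
  assumes "p \<noteq> q" "t \<noteq> 0"
  shows "smooth_ham_stat_self_similar t (varif (delta t))"
proof -
  have "delta t \<noteq> 0" using assms p_pos q_pos by (simp add: delta_def)
  then show ?thesis unfolding smooth_ham_stat_self_similar_def
    using smooth_surface_surf proper_immersion_surf lagrangian_immersion_surf hamiltonian_stationary_surf
      self_similar_surf immersion_varifold_surf by blast
qed

end

section \<open>Polar coordinates\<close>

text \<open>The substitution rule on compact intervals, exhausted monotonically; \<open>g\<close> is nondecreasing, and where it is
constant the factor \<open>g'\<close> vanishes.\<close>

lemma nn_integral_substitution_range:
  fixes f :: "real \<Rightarrow> ennreal" and g g' :: "real \<Rightarrow> real"
  assumes f: "f \<in> borel_measurable borel" and g: "\<And>x. (g has_real_derivative g' x) (at x)"
    and g': "continuous_on UNIV g'" "\<And>x. 0 \<le> g' x"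
  shows "(\<integral>\<^sup>+x. f x * indicator (range g) x \<partial>lborel) = (\<integral>\<^sup>+x. f (g x) * ennreal (g' x) \<partial>lborel)"
proof -
  have [measurable]: "f \<in> borel_measurable borel" by fact
  have cg: "continuous_on S g" for S
    using g DERIV_isCont continuous_at_imp_continuous_on by blast
  have [measurable]: "g \<in> borel_measurable borel" "g' \<in> borel_measurable borel"
    using cg g'(1) by (auto intro: borel_measurable_continuous_onI)
  have mono: "g x \<le> g y" if "x \<le> y" for x y
    using DERIV_nonneg_imp_nondecreasing[OF that] g g'(2) by blast
  let ?I = "\<lambda>n::nat. {- real (Suc n)..real (Suc n)}"
  let ?G = "\<lambda>n::nat. {g (- real (Suc n))..g (real (Suc n))}"
  have sup: "(SUP n. c * indicator (A n) x) = c * indicator (\<Union>n. A n) x"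
    if "incseq A" for A :: "nat \<Rightarrow> real set" and c :: ennreal and x
  proof (rule LIMSEQ_unique[OF LIMSEQ_SUP])
    show "incseq (\<lambda>n. c * indicator (A n) x)"
      using that by (auto simp: incseq_def indicator_def)
    show "(\<lambda>n. c * indicator (A n) x) \<longlonglongrightarrow> c * indicator (\<Union>n. A n) x"
    proof (cases "x \<in> (\<Union>n. A n)")
      case True
      then obtain N where "x \<in> A N" by blast
      then have "x \<in> A n" if "N \<le> n" for n using that \<open>incseq A\<close> by (auto simp: incseq_def)
      then show ?thesis using True by (intro tendsto_eventually eventually_sequentiallyI[of N]) auto
    qed (auto intro!: tendsto_eventually always_eventually)
  qed
  have mon: "incseq (\<lambda>n x. c x * indicator (A n) x)"
    if "incseq A" for A :: "nat \<Rightarrow> real set" and c :: "real \<Rightarrow> ennreal"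
    unfolding incseq_def le_fun_def
  proof (intro allI impI mult_left_mono)
    fix m n :: nat and x assume "m \<le> n"
    then have "A m \<subseteq> A n" using that by (simp add: incseq_def)
    then show "indicator (A m) x \<le> (indicator (A n) x :: ennreal)" by (auto simp: indicator_def)
  qed simp
  have UI: "(\<Union>n. ?I n) = UNIV"
  proof -
    have "\<exists>n. x \<in> ?I n" for x
    proof -
      obtain n where "\<bar>x\<bar> \<le> real n" using real_arch_simple by blast
      then show ?thesis by (intro exI[of _ n]) auto
    qed
    then show ?thesis by blast
  qed
  have UG: "(\<Union>n. ?G n) = range g"
  proof (intro equalityI subsetI)
    fix y assume "y \<in> (\<Union>n. ?G n)"
    then obtain n where n: "g (- real (Suc n)) \<le> y" "y \<le> g (real (Suc n))" by auto
    then obtain x where "g x = y" using IVT'[of g "- real (Suc n)" y "real (Suc n)"] cg by auto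
    then show "y \<in> range g" by auto
  next
    fix y assume "y \<in> range g"
    then obtain x where x: "y = g x" by auto
    then obtain n where "x \<in> ?I n" using UI by blast
    then have "y \<in> ?G n" unfolding x using mono by auto
    then show "y \<in> (\<Union>n. ?G n)" by blast
  qed
  have incG: "incseq ?G" and incI: "incseq ?I"
    by (auto simp: incseq_def intro: order.trans mono)
  have "(\<integral>\<^sup>+x. f x * indicator (range g) x \<partial>lborel) = (\<integral>\<^sup>+x. (SUP n. f x * indicator (?G n) x) \<partial>lborel)"
    using sup[OF incG] unfolding UG by simp
  also have "\<dots> = (SUP n. \<integral>\<^sup>+x. f x * indicator (?G n) x \<partial>lborel)"
    by (rule nn_integral_monotone_convergence_SUP[OF mon[OF incG]]) auto
  also have "\<dots> = (SUP n. \<integral>\<^sup>+x. f (g x) * ennreal (g' x) * indicator (?I n) x \<partial>lborel)"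
    by (intro SUP_cong refl nn_integral_substitution_aux f g continuous_on_subset[OF g'(1)] g'(2)) auto
  also have "\<dots> = (\<integral>\<^sup>+x. (SUP n. f (g x) * ennreal (g' x) * indicator (?I n) x) \<partial>lborel)"
    by (rule nn_integral_monotone_convergence_SUP[OF mon[OF incI], symmetric]) auto
  also have "\<dots> = (\<integral>\<^sup>+x. f (g x) * ennreal (g' x) \<partial>lborel)"
    using sup[OF incI] unfolding UI by simp
  finally show ?thesis .
qed

lemma nn_integral_exp_substitution:
  fixes f :: "real \<Rightarrow> ennreal"
  assumes "f \<in> borel_measurable borel" "0 < c"
  shows "(\<integral>\<^sup>+x. f x * indicator {0<..} x \<partial>lborel) = (\<integral>\<^sup>+x. f (c * exp x) * ennreal (c * exp x) \<partial>lborel)"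
proof -
  have "range (\<lambda>x. c * exp x) = {0<..}"
  proof (intro equalityI subsetI)
    fix y :: real assume "y \<in> {0<..}"
    then have "y = c * exp (ln (y / c))" using assms(2) by simp
    then show "y \<in> range (\<lambda>x. c * exp x)" by blast
  qed (use assms(2) in auto)
  moreover have "(\<integral>\<^sup>+x. f x * indicator (range (\<lambda>x. c * exp x)) x \<partial>lborel) = (\<integral>\<^sup>+x. f (c * exp x) * ennreal (c * exp x) \<partial>lborel)"
    by (rule nn_integral_substitution_range)
       (use assms in \<open>auto intro!: derivative_eq_intros continuous_intros\<close>)
  ultimately show ?thesis by simp
qed

lemma nn_integral_arctan_substitution:
  fixes f :: "real \<Rightarrow> ennreal"
  assumes "f \<in> borel_measurable borel"
  shows "(\<integral>\<^sup>+x. f x * indicator {- (pi/2)<..<pi/2} x \<partial>lborel) = (\<integral>\<^sup>+x. f (arctan x) * ennreal (inverse (1 + x\<^sup>2)) \<partial>lborel)"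
proof -
  have "range arctan = {- (pi/2)<..<pi/2}"
  proof (intro equalityI subsetI)
    fix y :: real assume "y \<in> {- (pi/2)<..<pi/2}"
    then have "y = arctan (tan y)" by (simp add: arctan_tan)
    then show "y \<in> range arctan" by blast
  next
    fix y :: real assume "y \<in> range arctan"
    then obtain x where "y = arctan x" by blast
    then show "y \<in> {- (pi/2)<..<pi/2}" using arctan_lbound[of x] arctan_ubound[of x] by simp
  qed
  moreover have "(\<integral>\<^sup>+x. f x * indicator (range arctan) x \<partial>lborel) = (\<integral>\<^sup>+x. f (arctan x) * ennreal (inverse (1 + x\<^sup>2)) \<partial>lborel)"
  proof (rule nn_integral_substitution_range[OF assms DERIV_arctan])
    show "continuous_on UNIV (\<lambda>x::real. inverse (1 + x\<^sup>2))"
      by (intro continuous_intros) (auto simp: add_nonneg_eq_0_iff)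
  qed (auto intro: add_nonneg_nonneg)
  ultimately show ?thesis by simp
qed

text \<open>In logarithmic radius \<open>x\<close>, to match the coordinates of the cone; the Jacobian is \<open>e^(2x)\<close>.\<close>

definition polar :: "R2 \<Rightarrow> R2" where
  "polar u = (exp (fst u) * cos (snd u), exp (fst u) * sin (snd u))"

lemma measurable_polar [measurable]: "polar \<in> borel_measurable borel"
  unfolding polar_def[abs_def] by (intro borel_measurable_continuous_onI continuous_intros)

lemma nn_integral_R2_iterated:
  fixes f :: "R2 \<Rightarrow> ennreal"
  assumes "f \<in> borel_measurable borel"
  shows "(\<integral>\<^sup>+u. f u \<partial>lborel) = (\<integral>\<^sup>+x. \<integral>\<^sup>+y. f (x, y) \<partial>lborel \<partial>lborel)"
    and "(\<integral>\<^sup>+u. f u \<partial>lborel) = (\<integral>\<^sup>+y. \<integral>\<^sup>+x. f (x, y) \<partial>lborel \<partial>lborel)"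
  using lborel.nn_integral_fst[of f lborel] lborel_pair.nn_integral_snd[of f] assms
  by (simp_all add: lborel_prod)

text \<open>On the half plane substitute \<open>y = x m\<close> for fixed \<open>x\<close>, then \<open>x = e^r cos (arctan m)\<close> for fixed \<open>m\<close>, and
finally \<open>m = tan s\<close>. All three are one-dimensional.\<close>

lemma nn_integral_polar_half_plane:
  fixes h :: "R2 \<Rightarrow> ennreal"
  assumes [measurable]: "h \<in> borel_measurable borel"
  shows "(\<integral>\<^sup>+u. indicator {0<..} (fst u) * h u \<partial>lborel)
    = (\<integral>\<^sup>+u. indicator {- (pi/2)<..<pi/2} (snd u) * (ennreal (exp (2 * fst u)) * h (polar u)) \<partial>lborel)"
proof -
  have [measurable]: "(\<lambda>u::R2. (fst u, fst u * snd u)) \<in> borel_measurable borel"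
    by (intro borel_measurable_continuous_onI continuous_intros)
  have [measurable]: "(\<lambda>z. h (a z, b z)) \<in> borel_measurable borel"
    if [measurable]: "a \<in> borel_measurable borel" "b \<in> borel_measurable borel" for a b :: "real \<Rightarrow> real"
    by measurable
  have m: "(\<lambda>u. indicator {0<..} (fst u) * (ennreal (fst u) * h (fst u, fst u * snd u))) \<in> borel_measurable borel"
    by measurable
  have "(\<integral>\<^sup>+u. indicator {0<..} (fst u) * h u \<partial>lborel)
     = (\<integral>\<^sup>+x. \<integral>\<^sup>+y. indicator {0<..} x * h (x, y) \<partial>lborel \<partial>lborel)"
    by (subst nn_integral_R2_iterated(1)) auto
  also have "\<dots> = (\<integral>\<^sup>+x. \<integral>\<^sup>+y. indicator {0<..} x * (ennreal x * h (x, x * y)) \<partial>lborel \<partial>lborel)"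
  proof (rule nn_integral_cong)
    fix x :: real
    show "(\<integral>\<^sup>+y. indicator {0<..} x * h (x, y) \<partial>lborel) = (\<integral>\<^sup>+y. indicator {0<..} x * (ennreal x * h (x, x * y)) \<partial>lborel)"
    proof (cases "0 < x")
      case True
      then show ?thesis using nn_integral_real_affine[of "\<lambda>y. h (x, y)" x 0] by (simp add: nn_integral_cmult)
    qed simp
  qed
  also have "\<dots> = (\<integral>\<^sup>+y. \<integral>\<^sup>+x. indicator {0<..} x * (ennreal x * h (x, x * y)) \<partial>lborel \<partial>lborel)"
    using nn_integral_R2_iterated[OF m] by simp
  also have "\<dots> = (\<integral>\<^sup>+y. (\<integral>\<^sup>+x. ennreal (exp (2 * x)) * h (polar (x, arctan y)) \<partial>lborel) * ennreal (inverse (1 + y\<^sup>2)) \<partial>lborel)"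
  proof (rule nn_integral_cong)
    fix y :: real
    define k where "k = sqrt (1 + y\<^sup>2)"
    have k: "0 < k" "k\<^sup>2 = 1 + y\<^sup>2" by (simp_all add: k_def add_pos_nonneg)
    have "(\<integral>\<^sup>+x. indicator {0<..} x * (ennreal x * h (x, x * y)) \<partial>lborel)
       = (\<integral>\<^sup>+x. (ennreal x * h (x, x * y)) * indicator {0<..} x \<partial>lborel)" by (simp add: mult.commute)
    also have "\<dots> = (\<integral>\<^sup>+x. ennreal (inverse k * exp x) * h (inverse k * exp x, inverse k * exp x * y) * ennreal (inverse k * exp x) \<partial>lborel)"
      by (rule nn_integral_exp_substitution) (use k in auto)
    also have "\<dots> = (\<integral>\<^sup>+x. ennreal (exp (2 * x)) * h (polar (x, arctan y)) * ennreal (inverse (1 + y\<^sup>2)) \<partial>lborel)"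
    proof (rule nn_integral_cong)
      fix x
      have "(inverse k * exp x) * (inverse k * exp x) = exp (2 * x) * inverse (k\<^sup>2)"
        by (simp add: power2_eq_square exp_double)
      then have "ennreal (inverse k * exp x) * ennreal (inverse k * exp x) = ennreal (exp (2 * x)) * ennreal (inverse (1 + y\<^sup>2))"
        using k by (simp flip: ennreal_mult)
      moreover have "polar (x, arctan y) = (inverse k * exp x, inverse k * exp x * y)"
        by (simp add: polar_def cos_arctan sin_arctan k_def divide_inverse mult_ac)
      ultimately show "ennreal (inverse k * exp x) * h (inverse k * exp x, inverse k * exp x * y) * ennreal (inverse k * exp x)
        = ennreal (exp (2 * x)) * h (polar (x, arctan y)) * ennreal (inverse (1 + y\<^sup>2))"
        by (metis mult.assoc mult.commute)
    qed
    finally show "(\<integral>\<^sup>+x. indicator {0<..} x * (ennreal x * h (x, x * y)) \<partial>lborel)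
       = (\<integral>\<^sup>+x. ennreal (exp (2 * x)) * h (polar (x, arctan y)) \<partial>lborel) * ennreal (inverse (1 + y\<^sup>2))"
      by (simp add: nn_integral_multc)
  qed
  also have "\<dots> = (\<integral>\<^sup>+s. (\<integral>\<^sup>+x. ennreal (exp (2 * x)) * h (polar (x, s)) \<partial>lborel) * indicator {- (pi/2)<..<pi/2} s \<partial>lborel)"
    by (rule nn_integral_arctan_substitution[symmetric]) measurable
  also have "\<dots> = (\<integral>\<^sup>+u. indicator {- (pi/2)<..<pi/2} (snd u) * (ennreal (exp (2 * fst u)) * h (polar u)) \<partial>lborel)"
    by (subst nn_integral_R2_iterated(2)) (simp_all add: nn_integral_cmult mult.commute[of _ "indicator _ _"])
  finally show ?thesis .
qed

lemma nn_integral_R2_uminus: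
  fixes f :: "R2 \<Rightarrow> ennreal"
  assumes [measurable]: "f \<in> borel_measurable borel"
  shows "(\<integral>\<^sup>+u. f (- u) \<partial>lborel) = (\<integral>\<^sup>+u. f u \<partial>lborel)"
proof -
  have "(\<integral>\<^sup>+u. f u \<partial>lborel) = (\<integral>\<^sup>+u. f u \<partial>distr lborel borel uminus)"
    using lborel_affine[of "-1" "0 :: R2"] by (simp add: density_1)
  then show ?thesis by (simp add: nn_integral_distr)
qed

lemma AE_R2_snd_neq: "AE u :: R2 in lborel. snd u \<noteq> c"
proof (rule AE_I)
  show "{u \<in> space lborel. \<not> snd u \<noteq> c} \<subseteq> UNIV \<times> {c}" by auto
  show "emeasure lborel ((UNIV :: real set) \<times> {c}) = 0"
    unfolding lborel_prod[symmetric] by (subst lborel.emeasure_pair_measure_Times) auto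
  show "(UNIV :: real set) \<times> {c} \<in> sets lborel" by (simp add: borel_closed closed_Times)
qed

lemma AE_R2_fst_neq: "AE u :: R2 in lborel. fst u \<noteq> c"
proof (rule AE_I)
  show "{u \<in> space lborel. \<not> fst u \<noteq> c} \<subseteq> {c} \<times> UNIV" by auto
  show "emeasure lborel ({c} \<times> (UNIV :: real set)) = 0"
    unfolding lborel_prod[symmetric] by (subst lborel.emeasure_pair_measure_Times) auto
  show "{c} \<times> (UNIV :: real set) \<in> sets lborel" by (simp add: borel_closed closed_Times)
qed

lemma nn_integral_strip_shift:
  fixes F :: "R2 \<Rightarrow> ennreal"
  assumes [measurable]: "F \<in> borel_measurable borel" and per: "\<And>x s. F (x, s + 2 * pi) = F (x, s)"
  shows "(\<integral>\<^sup>+u. indicator {a..<a + 2 * pi} (snd u) * F u \<partial>lborel) = (\<integral>\<^sup>+u. indicator {0..<2 * pi} (snd u) * F u \<partial>lborel)"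
proof -
  define J where "J x y = (\<integral>\<^sup>+u. indicator {x..<y} (snd u) * F u \<partial>lborel)" for x y
  have per1: "F (x, real n * (2 * pi) + s) = F (x, s)" for n x s
    by (induction n) (use per[of x "real n * (2 * pi) + s" for n] in \<open>auto simp: algebra_simps\<close>)
  have perk: "F (x, of_int k * (2 * pi) + s) = F (x, s)" for k :: int and x s
  proof (cases "0 \<le> k")
    case True
    then show ?thesis using per1[of x "nat k" s] by simp
  next
    case False
    then show ?thesis using per1[of x "nat (- k)" "of_int k * (2 * pi) + s"] by (simp add: algebra_simps)
  qed
  have "J a (a + 2 * pi) = J 0 (2 * pi)"
  proof (rule half_open_interval_period)
    fix x y z :: real assume "x \<le> y" "y \<le> z"
    then have "indicator {x..<z} t * v = indicator {x..<y} t * v + indicator {y..<z} t * v" for t :: real and v :: ennreal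
      by (auto simp: indicator_def)
    then show "J x z = J x y + J y z" unfolding J_def by (simp add: nn_integral_add)
  next
    fix x y :: real and k :: int
    have "J (of_int k * (2 * pi) + x) (of_int k * (2 * pi) + y)
      = (\<integral>\<^sup>+u. indicator {of_int k * (2 * pi) + x..<of_int k * (2 * pi) + y} (snd (0 + 1 * fst u, of_int k * (2 * pi) + snd u))
            * F (0 + 1 * fst u, of_int k * (2 * pi) + snd u) \<partial>lborel)"
      unfolding J_def by (rule nn_integral_R2_affine[symmetric]) auto
    also have "\<dots> = J x y" unfolding J_def perk
      by (auto intro!: nn_integral_cong simp: indicator_def)
    finally show "J (of_int k * (2 * pi) + x) (of_int k * (2 * pi) + y) = J x y" .
  qed simp
  then show ?thesis by (simp add: J_def)
qed

text \<open>The left half plane is the image of the right one under the half turn, and the vertical axis is negligible.\<close>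

theorem nn_integral_polar:
  fixes h :: "R2 \<Rightarrow> ennreal"
  assumes [measurable]: "h \<in> borel_measurable borel"
  shows "(\<integral>\<^sup>+u. indicator strip u * (ennreal (exp (2 * fst u)) * h (polar u)) \<partial>lborel) = (\<integral>\<^sup>+u. h u \<partial>lborel)"
proof -
  let ?k = "\<lambda>u. ennreal (exp (2 * fst u)) * h (polar u)"
  have neg: "polar (fst u, pi + snd u) = - polar u" for u by (simp add: polar_def)
  have "(\<integral>\<^sup>+u. h u \<partial>lborel) = (\<integral>\<^sup>+u. indicator {0<..} (fst u) * h u + indicator {0<..} (- fst u) * h u \<partial>lborel)"
    by (rule nn_integral_cong_AE) (use AE_R2_fst_neq[of 0] in \<open>eventually_elim, auto simp: indicator_def\<close>)
  also have "\<dots> = (\<integral>\<^sup>+u. indicator {0<..} (fst u) * h u \<partial>lborel) + (\<integral>\<^sup>+u. indicator {0<..} (- fst u) * h u \<partial>lborel)"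
    by (rule nn_integral_add) auto
  also have "(\<integral>\<^sup>+u. indicator {0<..} (- fst u) * h u \<partial>lborel) = (\<integral>\<^sup>+u. indicator {0<..} (fst u) * h (- u) \<partial>lborel)"
    using nn_integral_R2_uminus[of "\<lambda>u. indicator {0<..} (fst u) * h (- u)"] by simp
  also have "\<dots> = (\<integral>\<^sup>+u. indicator {- (pi/2)<..<pi/2} (snd u) * (ennreal (exp (2 * fst u)) * h (- polar u)) \<partial>lborel)"
    by (rule nn_integral_polar_half_plane) auto
  also have "\<dots> = (\<integral>\<^sup>+u. indicator {pi/2<..<3*pi/2} (snd (0 + 1 * fst u, pi + snd u)) * ?k (0 + 1 * fst u, pi + snd u) \<partial>lborel)"
    by (rule nn_integral_cong) (auto simp: neg indicator_def)
  also have "\<dots> = (\<integral>\<^sup>+u. indicator {pi/2<..<3*pi/2} (snd u) * ?k u \<partial>lborel)"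
    by (rule nn_integral_R2_affine) auto
  also have "(\<integral>\<^sup>+u. indicator {0<..} (fst u) * h u \<partial>lborel) = (\<integral>\<^sup>+u. indicator {- (pi/2)<..<pi/2} (snd u) * ?k u \<partial>lborel)"
    by (rule nn_integral_polar_half_plane) auto
  also have "(\<integral>\<^sup>+u. indicator {- (pi/2)<..<pi/2} (snd u) * ?k u \<partial>lborel) + (\<integral>\<^sup>+u. indicator {pi/2<..<3*pi/2} (snd u) * ?k u \<partial>lborel)
     = (\<integral>\<^sup>+u. indicator {- (pi/2)<..<pi/2} (snd u) * ?k u + indicator {pi/2<..<3*pi/2} (snd u) * ?k u \<partial>lborel)"
    by (rule nn_integral_add[symmetric]) auto
  also have "\<dots> = (\<integral>\<^sup>+u. indicator {- (pi/2)..<- (pi/2) + 2 * pi} (snd u) * ?k u \<partial>lborel)"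
    by (rule nn_integral_cong_AE)
       (use AE_R2_snd_neq[of "- (pi/2)"] AE_R2_snd_neq[of "pi/2"] in \<open>eventually_elim, auto simp: indicator_def\<close>)
  also have "\<dots> = (\<integral>\<^sup>+u. indicator {0..<2 * pi} (snd u) * ?k u \<partial>lborel)"
    by (rule nn_integral_strip_shift) (auto simp: polar_def)
  also have "\<dots> = (\<integral>\<^sup>+u. indicator strip u * ?k u \<partial>lborel)"
    by (rule nn_integral_cong) (auto simp: strip_def indicator_def mem_Times_iff)
  finally show ?thesis by simp
qed

context sw
begin

section \<open>The cones\<close>

text \<open>One sheet of the cone in the exponential coordinate \<open>y = sqrt (p + q) e^x\<close>.\<close>

definition cone_weight :: "real \<times> real \<Rightarrow> C2 measure" where
  "cone_weight \<sigma> = distr (density lborel (area_density 0)) borel (leaf 0 \<sigma>)"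

lemma sets_cone_weight [simp, measurable_cong]: "sets (cone_weight \<sigma>) = sets borel"
  by (simp add: cone_weight_def)

lemma nn_integral_cone_weight:
  assumes [measurable]: "F \<in> borel_measurable borel"
  shows "(\<integral>\<^sup>+x. F x \<partial>cone_weight \<sigma>) = (\<integral>\<^sup>+u. ennreal (area_density 0 u) * F (leaf 0 \<sigma> u) \<partial>lborel)"
  unfolding cone_weight_def by (subst nn_integral_distr) (auto simp: nn_integral_density)

lemma measure_borel_eqI:
  assumes "sets M = sets borel" "sets N = sets borel"
    and "\<And>F. F \<in> borel_measurable borel \<Longrightarrow> (\<integral>\<^sup>+x. F x \<partial>M) = (\<integral>\<^sup>+x. F x \<partial>N)"
  shows "M = N"
proof (rule measure_eqI)
  fix A assume "A \<in> sets M"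
  then show "emeasure M A = emeasure N A"
    using assms(3)[of "indicator A"] assms(1,2) by simp
qed (use assms in simp)

lemma cone_map_eq:
  defines "k \<equiv> sqrt (real p + real q)"
  shows "(of_real (fst \<sigma>) * fst (sw_cone_map p q u), of_real (snd \<sigma>) * snd (sw_cone_map p q u)) = (fst u / k) *\<^sub>R leaf 0 \<sigma> (0, snd u)"
proof -
  have "sqrt (real q / real (p + q)) = rq / k" "sqrt (real p / real (p + q)) = rp / k"
    by (simp_all add: k_def real_sqrt_divide)
  then show ?thesis
    by (simp add: sw_cone_map_def sw_curve_def leaf_def phi_def psi_def scaleR_conv_of_real mult_ac)
qed

text \<open>The substitution \<open>y = sqrt (p + q) e^x\<close> takes the parametrization \<open>y \<gamma>(\<theta>)\<close> of the cone to the leaf with \<open>d = 0\<close>; a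
diagonal map with entries \<open>\<plusminus>1\<close> becomes a choice of signs.\<close>

lemma weight_sw_cone:
  assumes T: "\<And>x. T x = (of_real (fst \<sigma>) * fst x, of_real (snd \<sigma>) * snd x)" and \<sigma>: "\<sigma> \<in> signs"
  shows "weight (sw_cone_varifold T p q) = cone_weight \<sigma>"
proof (rule measure_borel_eqI)
  define k where "k = sqrt (real p + real q)"
  have k: "0 < k" "k * k = real p + real q" using p_pos by (simp_all add: k_def add_nonneg_pos)
  let ?X = "T \<circ> sw_cone_map p q"
  define S :: "R2 set" where "S = {0<..} \<times> {0..<2 * pi}"
  have S[measurable]: "S \<in> sets borel" unfolding S_def borel_prod[symmetric] by measurable
  have X: "?X u = (fst u / k) *\<^sub>R leaf 0 \<sigma> (0, snd u)" for u
    using cone_map_eq[of \<sigma> u] by (simp add: T k_def)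
  have l1: "leaf1 0 \<sigma> u = leaf 0 \<sigma> u" for u by (simp add: leaf1_eq_leaf)
  have dX: "(?X has_derivative (\<lambda>h. fst h *\<^sub>R ((1 / k) *\<^sub>R leaf1 0 \<sigma> (0, snd u)) + snd h *\<^sub>R ((fst u / k) *\<^sub>R leaf2 0 \<sigma> (0, snd u)))) (at u)" for u
  proof -
    have 1: "((\<lambda>u::R2. leaf 0 \<sigma> (0, snd u)) has_derivative (\<lambda>h. snd h *\<^sub>R leaf2 0 \<sigma> (0, snd u))) (at u)"
    proof -
      have "((\<lambda>u::R2. (0::real, snd u)) has_derivative (\<lambda>h. (0, snd h))) (at u)" by (auto intro!: derivative_eq_intros)
      from has_derivative_compose[OF this has_derivative_leaf[of 0 \<sigma> "(0, snd u)"]] show ?thesis by simp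
    qed
    have 2: "((\<lambda>u::R2. fst u / k) has_derivative (\<lambda>h. fst h / k)) (at u)"
      unfolding divide_inverse by (auto intro!: derivative_eq_intros)
    show ?thesis unfolding comp_def X[unfolded comp_def]
      by (rule has_derivative_eq_rhs[OF has_derivative_scaleR[OF 2 1]]) (simp add: fun_eq_iff l1 add.commute)
  qed
  have fX: "frechet_derivative ?X (at u) = (\<lambda>h. fst h *\<^sub>R ((1 / k) *\<^sub>R leaf1 0 \<sigma> (0, snd u)) + snd h *\<^sub>R ((fst u / k) *\<^sub>R leaf2 0 \<sigma> (0, snd u)))" for u
    by (rule frechet_derivative_at[OF dX, symmetric])
  have e0: "energy 0 x = (real p + real q) * exp (2 * x)" for x
    unfolding energy_def phi_def psi_def exp_double by (simp add: algebra_simps)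
  have area: "area_el ?X u = sqrt (real p * real q) * fst u" if "u \<in> S" for u
  proof -
    have "g11 ?X u = 1" "g12 ?X u = 0" "g22 ?X u = (fst u)\<^sup>2 * (real p * real q)"
      unfolding g11_def g12_def g22_def pd1_def pd2_def fX using k
      by (simp_all add: leaf_inner[OF \<sigma>] e0 flip: k(2)) (simp_all add: power2_eq_square)
    then show ?thesis using that by (simp add: area_el_def gdet_def real_sqrt_mult S_def mem_Times_iff)
  qed
  have tan: "tangent_space ?X u = tangent_space (leaf 0 \<sigma>) (0, snd u)" if "u \<in> S" for u
  proof -
    have y: "fst u \<noteq> 0" using that by (auto simp: S_def)
    have "range (frechet_derivative ?X (at u)) = range (frechet_derivative (leaf 0 \<sigma>) (at (0, snd u)))"
    proof (intro equalityI subsetI)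
      fix v assume "v \<in> range (frechet_derivative ?X (at u))"
      then obtain h where "v = fst h *\<^sub>R ((1 / k) *\<^sub>R leaf1 0 \<sigma> (0, snd u)) + snd h *\<^sub>R ((fst u / k) *\<^sub>R leaf2 0 \<sigma> (0, snd u))"
        by (auto simp: fX)
      then have "v = frechet_derivative (leaf 0 \<sigma>) (at (0, snd u)) (fst h / k, snd h * fst u / k)"
        by (simp add: frechet_leaf)
      then show "v \<in> range (frechet_derivative (leaf 0 \<sigma>) (at (0, snd u)))" by blast
    next
      fix v assume "v \<in> range (frechet_derivative (leaf 0 \<sigma>) (at (0, snd u)))"
      then obtain h where "v = fst h *\<^sub>R leaf1 0 \<sigma> (0, snd u) + snd h *\<^sub>R leaf2 0 \<sigma> (0, snd u)" by (auto simp: frechet_leaf)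
      then have "v = frechet_derivative ?X (at u) (fst h * k, snd h * k / fst u)" using k y by (simp add: fX)
      then show "v \<in> range (frechet_derivative ?X (at u))" by blast
    qed
    then show ?thesis by (simp add: tangent_space_def)
  qed
  show "sets (weight (sw_cone_varifold T p q)) = sets borel" by simp
  fix F :: "C2 \<Rightarrow> ennreal" assume F[measurable]: "F \<in> borel_measurable borel"
  have [measurable]: "(\<lambda>u::R2. (0::real, snd u)) \<in> borel_measurable borel"
    by (intro borel_measurable_continuous_onI continuous_intros)
  have [measurable]: "?X \<in> borel_measurable borel" unfolding comp_def X[unfolded comp_def] by measurable
  have FX: "(\<lambda>u. F (?X u)) \<in> borel_measurable borel" by measurable
  let ?M = "density (restrict_space lborel S) (\<lambda>u. ennreal (area_el ?X u))"
  have pair: "(\<lambda>u. (?X u, orth_proj (tangent_space ?X u))) \<in> measurable (restrict_space lborel S) borel"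
  proof -
    have "(\<lambda>u. (?X u, leaf_proj 0 \<sigma> (0, snd u))) \<in> borel_measurable borel"
      unfolding comp_def X[unfolded comp_def]
      by (intro borel_measurable_continuous_onI continuous_intros continuous_on_divide
          continuous_on_compose2[OF continuous_on_leaf(1)[of UNIV]]
          continuous_on_compose2[OF continuous_on_leaf_proj[OF \<sigma>, of UNIV]])
        (use k in auto)
    then have "(\<lambda>u. (?X u, leaf_proj 0 \<sigma> (0, snd u))) \<in> measurable (restrict_space lborel S) borel"
      by (intro measurable_restrict_space1) simp
    then show ?thesis
      by (rule measurable_cong[THEN iffD1, rotated]) (simp add: space_restrict_space tan leaf_proj_def)
  qed
  have aM: "(\<lambda>u. ennreal (area_el ?X u)) \<in> borel_measurable (restrict_space lborel S)"
  proof (rule measurable_cong[THEN iffD2])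
    show "(\<lambda>u. ennreal (sqrt (real p * real q) * fst u)) \<in> borel_measurable (restrict_space lborel S)"
      by (intro measurable_restrict_space1) measurable
  qed (simp add: space_restrict_space area)
  have "(\<integral>\<^sup>+x. F x \<partial>weight (sw_cone_varifold T p q)) = (\<integral>\<^sup>+z. F (fst z) \<partial>sw_cone_varifold T p q)"
    unfolding weight_def by (rule nn_integral_distr) (auto simp: sw_cone_varifold_def param_varifold_def)
  also have "\<dots> = (\<integral>\<^sup>+u. F (?X u) \<partial>?M)"
    unfolding sw_cone_varifold_def param_varifold_def S_def[symmetric]
    by (subst nn_integral_distr) (use pair in auto)
  also have "\<dots> = (\<integral>\<^sup>+u. ennreal (area_el ?X u) * F (?X u) \<partial>restrict_space lborel S)"
    by (rule nn_integral_density[OF aM]) (rule measurable_restrict_space1, use FX in simp)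
  also have "\<dots> = (\<integral>\<^sup>+u. ennreal (area_el ?X u) * F (?X u) * indicator S u \<partial>lborel)"
    by (rule nn_integral_restrict_space) simp
  also have "\<dots> = (\<integral>\<^sup>+u. indicator {0..<2*pi} (snd u) * (indicator {0<..} (fst u) *
      (ennreal (sqrt (real p * real q) * fst u) * F ((fst u / k) *\<^sub>R leaf 0 \<sigma> (0, snd u)))) \<partial>lborel)"
  proof (rule nn_integral_cong)
    fix u
    show "ennreal (area_el ?X u) * F (?X u) * indicator S u = indicator {0..<2*pi} (snd u) * (indicator {0<..} (fst u) *
      (ennreal (sqrt (real p * real q) * fst u) * F ((fst u / k) *\<^sub>R leaf 0 \<sigma> (0, snd u))))"
    proof (cases "u \<in> S")
      case True
      then show ?thesis using area[OF True] X[of u] by (auto simp: S_def)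
    qed (auto simp: S_def indicator_def mem_Times_iff)
  qed
  also have "\<dots> = (\<integral>\<^sup>+s. \<integral>\<^sup>+y. indicator {0..<2*pi} s * (indicator {0<..} y *
      (ennreal (sqrt (real p * real q) * y) * F ((y / k) *\<^sub>R leaf 0 \<sigma> (0, s)))) \<partial>lborel \<partial>lborel)"
    by (subst nn_integral_R2_iterated(2)) auto
  also have "\<dots> = (\<integral>\<^sup>+s. \<integral>\<^sup>+x. ennreal (area_density 0 (x, s)) * F (leaf 0 \<sigma> (x, s)) \<partial>lborel \<partial>lborel)"
  proof (rule nn_integral_cong)
    fix s :: real
    have "(\<integral>\<^sup>+y. indicator {0..<2*pi} s * (indicator {0<..} y *
        (ennreal (sqrt (real p * real q) * y) * F ((y / k) *\<^sub>R leaf 0 \<sigma> (0, s)))) \<partial>lborel)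
      = (\<integral>\<^sup>+y. (indicator {0..<2*pi} s * (ennreal (sqrt (real p * real q) * y) * F ((y / k) *\<^sub>R leaf 0 \<sigma> (0, s)))) * indicator {0<..} y \<partial>lborel)"
      by (intro nn_integral_cong) (simp add: mult_ac)
    also have "\<dots> = (\<integral>\<^sup>+x. (indicator {0..<2*pi} s * (ennreal (sqrt (real p * real q) * (k * exp x)) * F (((k * exp x) / k) *\<^sub>R leaf 0 \<sigma> (0, s))))
        * ennreal (k * exp x) \<partial>lborel)"
      by (rule nn_integral_exp_substitution) (use k in auto)
    also have "\<dots> = (\<integral>\<^sup>+x. ennreal (area_density 0 (x, s)) * F (leaf 0 \<sigma> (x, s)) \<partial>lborel)"
    proof (rule nn_integral_cong)
      fix x
      have "((k * exp x) / k) *\<^sub>R leaf 0 \<sigma> (0, s) = leaf 0 \<sigma> (x, s)"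
        using k by (simp add: leaf_def phi_def psi_def scaleR_conv_of_real mult_ac)
      moreover have "sqrt (real p * real q) * (k * exp x) * (k * exp x) = sqrt (real p * real q) * energy 0 x"
        unfolding e0 k(2)[symmetric] by (simp add: exp_double power2_eq_square)
      then have "ennreal (sqrt (real p * real q) * (k * exp x)) * ennreal (k * exp x) = ennreal (sqrt (real p * real q) * energy 0 x)"
        using ennreal_mult[of "sqrt (real p * real q) * (k * exp x)" "k * exp x"] k by (metis less_imp_le exp_ge_zero mult_nonneg_nonneg of_nat_0_le_iff real_sqrt_ge_zero)
      moreover have "ennreal (area_density 0 (x, s)) = indicator {0..<2*pi} s * ennreal (sqrt (real p * real q) * energy 0 x)"
        by (simp add: area_density_def strip_def indicator_def)
      moreover have "(i * (a * f)) * b = i * c * f" if "a * b = c" for i a f b c :: ennreal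
        unfolding that[symmetric] by (simp add: mult_ac)
      ultimately show "(indicator {0..<2*pi} s * (ennreal (sqrt (real p * real q) * (k * exp x)) * F (((k * exp x) / k) *\<^sub>R leaf 0 \<sigma> (0, s))))
        * ennreal (k * exp x) = ennreal (area_density 0 (x, s)) * F (leaf 0 \<sigma> (x, s))"
        by presburger
    qed
    finally show "(\<integral>\<^sup>+y. indicator {0..<2*pi} s * (indicator {0<..} y *
        (ennreal (sqrt (real p * real q) * y) * F ((y / k) *\<^sub>R leaf 0 \<sigma> (0, s)))) \<partial>lborel)
      = (\<integral>\<^sup>+x. ennreal (area_density 0 (x, s)) * F (leaf 0 \<sigma> (x, s)) \<partial>lborel)" .
  qed
  also have "\<dots> = (\<integral>\<^sup>+x. F x \<partial>cone_weight \<sigma>)"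
    by (subst nn_integral_cone_weight, simp, subst nn_integral_R2_iterated(2)) auto
  finally show "(\<integral>\<^sup>+x. F x \<partial>weight (sw_cone_varifold T p q)) = (\<integral>\<^sup>+x. F x \<partial>cone_weight \<sigma>)" .
qed simp

text \<open>The half turn \<open>s \<mapsto> s + \<pi>\<close> is a bijection of the period that multiplies the signs by \<open>((-1)^p, (-1)^q)\<close>.\<close>

lemma cone_weight_shift: "cone_weight ((-1) ^ p * a, (-1) ^ q * b) = cone_weight (a, b)"
proof (rule measure_borel_eqI)
  fix F :: "C2 \<Rightarrow> ennreal" assume F[measurable]: "F \<in> borel_measurable borel"
  define w where "w u = ennreal (sqrt (real p * real q) * energy 0 (fst u))" for u :: R2
  have [measurable]: "w \<in> borel_measurable borel" unfolding w_def[abs_def] by measurable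
  have split: "(\<integral>\<^sup>+x. F x \<partial>cone_weight \<sigma>) = (\<integral>\<^sup>+u. indicator {0..<2 * pi} (snd u) * (w u * F (leaf 0 \<sigma> u)) \<partial>lborel)" for \<sigma>
    unfolding nn_integral_cone_weight[OF F]
    by (intro nn_integral_cong) (auto simp: area_density_def w_def strip_def indicator_def mem_Times_iff)
  have c1: "cis (real n * (pi + s)) = (-1) ^ n * cis (real n * s)" "cis (- (real n * (pi + s))) = (-1) ^ n * cis (- (real n * s))" for n s
  proof -
    have 1: "cis (real n * pi) = (-1) ^ n" using Complex.DeMoivre[of pi n] by simp
    have "cis (real n * pi) * cis (- (real n * pi)) = 1" by (simp add: cis_mult)
    then have 2: "cis (- (real n * pi)) = (-1) ^ n" unfolding 1
      by (metis mult_cancel_left power_mult_distrib mult_minus1 minus_minus power_one power_eq_0_iff neg_equal_0_iff_equal zero_neq_one)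
    have "cis (real n * (pi + s)) = cis (real n * pi) * cis (real n * s)"
      "cis (- (real n * (pi + s))) = cis (- (real n * pi)) * cis (- (real n * s))"
      by (simp_all add: cis_mult algebra_simps)
    then show "cis (real n * (pi + s)) = (-1) ^ n * cis (real n * s)" "cis (- (real n * (pi + s))) = (-1) ^ n * cis (- (real n * s))"
      unfolding 1 2 .
  qed
  have shift: "leaf 0 (a, b) (x, pi + s) = leaf 0 ((-1) ^ p * a, (-1) ^ q * b) (x, s)" for a b x s
    unfolding leaf_def fst_conv snd_conv c1 by (simp add: mult_ac)
  have per: "leaf 0 (a, b) (x, s + 2 * pi) = leaf 0 (a, b) (x, s)" for a b x s
  proof -
    have "leaf 0 (a, b) (x, s + 2 * pi) = leaf 0 (a, b) (x, pi + (pi + s))" by (simp add: add.commute)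
    also have "\<dots> = leaf 0 (a, b) (x, s)" unfolding shift
      by (simp flip: power_mult_distrib mult.assoc)
    finally show ?thesis .
  qed
  have "(\<integral>\<^sup>+x. F x \<partial>cone_weight (a, b)) = (\<integral>\<^sup>+u. indicator {pi..<pi + 2 * pi} (snd u) * (w u * F (leaf 0 (a, b) u)) \<partial>lborel)"
    unfolding split by (rule nn_integral_strip_shift[symmetric]) (auto simp: w_def per)
  also have "\<dots> = (\<integral>\<^sup>+u. indicator {pi..<pi + 2 * pi} (snd (0 + 1 * fst u, pi + snd u))
      * (w (0 + 1 * fst u, pi + snd u) * F (leaf 0 (a, b) (0 + 1 * fst u, pi + snd u))) \<partial>lborel)"
    by (rule nn_integral_R2_affine[symmetric]) auto
  also have "\<dots> = (\<integral>\<^sup>+u. indicator {0..<2 * pi} (snd u) * (w u * F (leaf 0 ((-1) ^ p * a, (-1) ^ q * b) u)) \<partial>lborel)"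
    unfolding shift by (intro nn_integral_cong) (auto simp: indicator_def w_def)
  finally show "(\<integral>\<^sup>+x. F x \<partial>cone_weight ((-1) ^ p * a, (-1) ^ q * b)) = (\<integral>\<^sup>+x. F x \<partial>cone_weight (a, b))"
    unfolding split[symmetric] by simp
qed simp_all

lemma nn_integral_varifold_sum_weight:
  assumes "sets A = sets borel" "sets B = sets borel" and [measurable]: "F \<in> borel_measurable borel"
  shows "(\<integral>\<^sup>+x. F x \<partial>weight (varifold_sum A B)) = (\<integral>\<^sup>+x. F x \<partial>weight A) + (\<integral>\<^sup>+x. F x \<partial>weight B)"
proof -
  have vs: "varifold_sum A B = sum_measure 1 {True, False} borel (\<lambda>b. if b then A else B)"
    by (simp add: varifold_sum_def sum_measure_def)
  have sA: "(\<integral>\<^sup>+x. F x \<partial>weight A) = (\<integral>\<^sup>+z. F (fst z) \<partial>A)" "(\<integral>\<^sup>+x. F x \<partial>weight B) = (\<integral>\<^sup>+z. F (fst z) \<partial>B)"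
    unfolding weight_def
    by (rule nn_integral_distr; simp add: measurable_cong_sets[OF assms(1) refl] measurable_cong_sets[OF assms(2) refl])+
  have "(\<integral>\<^sup>+x. F x \<partial>weight (varifold_sum A B)) = (\<integral>\<^sup>+z. F (fst z) \<partial>varifold_sum A B)"
    unfolding weight_def vs by (rule nn_integral_distr) auto
  also have "\<dots> = (\<integral>\<^sup>+z. F (fst z) \<partial>A) + (\<integral>\<^sup>+z. F (fst z) \<partial>B)"
    unfolding vs by (subst nn_integral_sum_measure) (use assms in auto)
  finally show ?thesis unfolding sA .
qed

text \<open>The signs that the half turn does not reach from \<open>(1, 1)\<close> give the second cone: \<open>(1, -1)\<close> represents them if \<open>p\<close> and
\<open>q\<close> are odd, and \<open>(-1, -1)\<close> if one of them is even. Each cone then appears twice among the four sheets.\<close>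

lemma cone_union_weight:
  assumes "coprime p q"
  obtains T where "T \<in> U2"
    "weight (varifold_sum (sw_cone_varifold id p q) (sw_cone_varifold T p q)) = weight (varif 0)"
proof -
  \<comment> \<open>The parity decides which sign pair the half turn does not identify with (1, 1).\<close>
  define \<tau> where "\<tau> = (if odd p \<and> odd q then (1, -1) else (-1, -1) :: real \<times> real)"
  define T :: "C2 \<Rightarrow> C2" where "T x = (of_real (fst \<tau>) * fst x, of_real (snd \<tau>) * snd x)" for x
  have \<tau>: "\<tau> \<in> signs" by (auto simp: \<tau>_def signs_def)
  have one: "(1, 1) \<in> signs" by simp
  have "T \<in> U2"
  proof -
    have "linear T" unfolding T_def by (rule linearI) (simp_all add: algebra_simps scaleR_conv_of_real)
    moreover have "T v \<bullet> T w = v \<bullet> w" for v w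
      using \<tau> by (cases "odd p \<and> odd q") (simp_all add: T_def \<tau>_def inner_prod_def)
    ultimately show ?thesis
      by (auto simp: U2_def orthogonal_transformation_def T_def cpx_J_def)
  qed
  moreover have "weight (varifold_sum (sw_cone_varifold id p q) (sw_cone_varifold T p q)) = weight (varif 0)"
  proof (rule measure_borel_eqI)
    fix F :: "C2 \<Rightarrow> ennreal" assume F[measurable]: "F \<in> borel_measurable borel"
    let ?I = "\<lambda>\<sigma>. \<integral>\<^sup>+x. F x \<partial>cone_weight \<sigma>"
    have id: "weight (sw_cone_varifold id p q) = cone_weight (1, 1)"
      by (rule weight_sw_cone) (use one in auto)
    have T': "weight (sw_cone_varifold T p q) = cone_weight \<tau>"
      by (rule weight_sw_cone[OF _ \<tau>]) (simp add: T_def)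
    have "(\<integral>\<^sup>+x. F x \<partial>weight (varifold_sum (sw_cone_varifold id p q) (sw_cone_varifold T p q))) = ?I (1, 1) + ?I \<tau>"
      unfolding id[symmetric] T'[symmetric]
      by (rule nn_integral_varifold_sum_weight) (simp_all add: sw_cone_varifold_def param_varifold_def)
    moreover have "(\<integral>\<^sup>+x. F x \<partial>weight (varif 0)) = ennreal (1/2) * (?I (1, 1) + ?I (1, -1) + ?I (-1, 1) + ?I (-1, -1))"
      unfolding nn_integral_weight[OF F] nn_integral_cone_weight[OF F, symmetric]
      by (simp add: sheets_def signs_def add_ac)
    moreover have "?I (1, 1) + ?I (1, -1) + ?I (-1, 1) + ?I (-1, -1) = 2 * (?I (1, 1) + ?I \<tau>)"
    proof -
      have "\<not> (even p \<and> even q)" using assms by (metis coprime_common_divisor even_prod_iff odd_one)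
      then consider "odd p" "odd q" | "even p" "odd q" | "odd p" "even q" by blast
      then show ?thesis
      proof cases
        case 1
        then have "cone_weight (-1, -1) = cone_weight (1, 1)" "cone_weight (-1, 1) = cone_weight (1, -1)"
          using cone_weight_shift[of 1 1] cone_weight_shift[of 1 "-1"] by simp_all
        then show ?thesis using 1 by (simp add: \<tau>_def mult_2 add_ac)
      next
        case 2
        then have "cone_weight (1, -1) = cone_weight (1, 1)" "cone_weight (-1, 1) = cone_weight (-1, -1)"
          using cone_weight_shift[of 1 1] cone_weight_shift[of "-1" "-1"] by simp_all
        then show ?thesis using 2 by (simp add: \<tau>_def mult_2 add_ac)
      next
        case 3
        then have "cone_weight (-1, 1) = cone_weight (1, 1)" "cone_weight (1, -1) = cone_weight (-1, -1)"
          using cone_weight_shift[of 1 1] cone_weight_shift[of "-1" "-1"] by simp_all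
        then show ?thesis using 3 by (simp add: \<tau>_def mult_2 add_ac)
      qed
    qed
    moreover have "ennreal (1/2) * (2 * x) = x" for x
    proof -
      have "ennreal (1/2) * 2 = 1" using ennreal_mult[of "1/2" 2] by simp
      then show ?thesis by (simp flip: mult.assoc)
    qed
    ultimately show "(\<integral>\<^sup>+x. F x \<partial>weight (varifold_sum (sw_cone_varifold id p q) (sw_cone_varifold T p q))) = (\<integral>\<^sup>+x. F x \<partial>weight (varif 0))"
      by (simp only:)
  qed simp_all
  ultimately show thesis by (rule that)
qed

lemma weights_converge_varif:
  assumes "weight V0 = weight (varif 0)"
  shows "weights_converge (\<lambda>t. varif (delta t)) V0 (at 0)"
  unfolding weights_converge_def
proof (intro allI impI)
  fix f :: "C2 \<Rightarrow> real" assume f: "continuous_on UNIV f \<and> compact_supp f"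
  obtain C r where C: "\<And>x. norm (f x) \<le> C" "\<And>x. r < norm x \<Longrightarrow> f x = 0"
    using continuous_compact_supp_bounds[of f] f by metis
  have t: "tame f" by (rule tame_bounded[OF C])
  have m: "f \<in> borel_measurable borel" using f by (auto intro: borel_measurable_continuous_onI)
  have c: "continuous_on (- {0}) f" using f continuous_on_subset by blast
  show "((\<lambda>t. \<integral>x. f x \<partial>weight (varif (delta t))) \<longlongrightarrow> (\<integral>x. f x \<partial>weight V0)) (at 0)"
  proof (cases "p = q")
    case True
    then have "real p - real q = 0" by simp
    then have "delta t = 0" for t unfolding delta_def by simp
    then show ?thesis by (simp only: assms tendsto_const)
  next
    case False
    show ?thesis unfolding assms
      by (rule filterlim_compose[OF weight_tendsto_cone[OF t m c] filterlim_delta[OF False]])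
  qed
qed

section \<open>The static pair of planes\<close>

text \<open>The graph of \<open>z \<mapsto> i e z\<^sup>*\<close> with \<open>e = \<plusminus>1\<close>, where \<open>z\<^sup>*\<close> is the complex conjugate. For \<open>p = q = 1\<close> these are the two cones.\<close>

definition plane :: "real \<Rightarrow> R2 \<Rightarrow> C2" where
  "plane e u = (Complex (fst u) (snd u), \<i> * of_real e * cnj (Complex (fst u) (snd u)))"

text \<open>The first component makes the two planes, which meet at the origin, disjoint.\<close>

definition plane_lift :: "real \<Rightarrow> R2 \<Rightarrow> complex \<times> C2" where
  "plane_lift e u = (of_real e, plane e u)"

definition plane_surf :: "(complex \<times> C2) set" where
  "plane_surf = range (plane_lift 1) \<union> range (plane_lift (-1))"

definition plane_charts :: "(complex \<times> C2) atlas" where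
  "plane_charts = {(UNIV, plane_lift e) |e. e = 1 \<or> e = -1}"

lemma bounded_linear_plane: "bounded_linear (plane e)"
proof -
  have "linear (plane e)"
    by (rule linearI) (simp_all add: plane_def complex_eq_iff algebra_simps)
  then show ?thesis by (rule linear_conv_bounded_linear[THEN iffD1])
qed

lemma frechet_plane: "frechet_derivative (plane e) (at u) = plane e"
  using frechet_derivative_at[OF bounded_linear.has_derivative[OF bounded_linear_plane has_derivative_ident]] by metis

lemma snd_plane_lift: "snd \<circ> plane_lift e = plane e"
  by (simp add: fun_eq_iff plane_lift_def)

lemma tangent_space_plane: "tangent_space (plane e) u = range (plane e)"
  by (simp add: tangent_space_def frechet_plane)

lemma continuous_on_plane_lift: "continuous_on S (plane_lift e)"
  unfolding plane_lift_def[abs_def]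
  by (intro continuous_intros bounded_linear.continuous_on[OF bounded_linear_plane])

lemma inj_plane: "inj (plane e)"
  by (rule injI) (auto simp: plane_def prod_eq_iff)

lemma pd_plane: "pd1 (plane e) u = (1, \<i> * of_real e)" "pd2 (plane e) u = (\<i>, of_real e)"
  by (simp_all add: pd1_def pd2_def frechet_plane plane_def complex_eq_iff)

lemma metric_plane:
  assumes "e = 1 \<or> e = -1"
  shows "gdet (plane e) u = 4" "area_el (plane e) u = 2"
proof -
  have g: "g11 (plane e) u = 2" "g12 (plane e) u = 0" "g22 (plane e) u = 2"
    using assms by (auto simp: g11_def g12_def g22_def pd_plane inner_prod_def inner_complex_def)
  show "gdet (plane e) u = 4" by (simp add: gdet_def g)
  then show "area_el (plane e) u = 2" by (simp add: area_el_def)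
qed

lemma plane_charts_cases:
  assumes "(U, \<phi>) \<in> plane_charts"
  obtains e where "U = UNIV" "\<phi> = plane_lift e" "e = 1 \<or> e = -1" "snd \<circ> \<phi> = plane e"
  using assms by (auto simp: plane_charts_def snd_plane_lift)

lemma openin_plane:
  assumes "e = 1 \<or> e = -1"
  shows "openin (top_of_set plane_surf) (range (plane_lift e))"
proof -
  have "open ((\<lambda>m :: complex \<times> C2. e * Re (fst m)) -` {0<..})"
    by (intro open_vimage continuous_intros)
  moreover have "range (plane_lift e) = plane_surf \<inter> (\<lambda>m. e * Re (fst m)) -` {0<..}"
    using assms by (auto simp: plane_surf_def plane_lift_def)
  ultimately show ?thesis by (auto simp: openin_open)
qed

definition plane_inverse :: "complex \<times> C2 \<Rightarrow> R2" where
  "plane_inverse m = (Re (fst (snd m)), Im (fst (snd m)))"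

lemma plane_inverse [simp]: "plane_inverse (plane_lift e u) = u"
  by (simp add: plane_inverse_def plane_lift_def plane_def)

lemma continuous_on_plane_inverse: "continuous_on S plane_inverse"
  unfolding plane_inverse_def[abs_def] by (intro continuous_intros)

lemma plane_lift_inj:
  assumes "plane_lift e u = plane_lift e' w"
  shows "e = e' \<and> u = w"
  using assms by (auto simp: plane_lift_def plane_def prod_eq_iff)

lemma smooth_surface_plane: "smooth_surface (top_of_set plane_surf) plane_charts"
proof (rule smooth_surface_subset)
  show "plane_surf = (\<Union>(U, \<phi>)\<in>plane_charts. \<phi> ` U)" by (auto simp: plane_surf_def plane_charts_def)
next
  fix U \<phi> assume "(U, \<phi>) \<in> plane_charts"
  then obtain e where e: "U = UNIV" "\<phi> = plane_lift e" "e = 1 \<or> e = -1" using plane_charts_cases by metis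
  show "open U \<and> openin (top_of_set plane_surf) (\<phi> ` U) \<and> continuous_on U \<phi>
      \<and> (\<exists>g. continuous_on (\<phi> ` U) g \<and> (\<forall>u\<in>U. g (\<phi> u) = u))"
    unfolding e(1,2)
  proof (intro conjI exI[of _ plane_inverse] ballI)
  qed (use openin_plane[OF e(3)] continuous_on_plane_lift continuous_on_plane_inverse in auto)
next
  fix U \<phi> W \<psi> and u w :: R2
  assume "(U, \<phi>) \<in> plane_charts" "(W, \<psi>) \<in> plane_charts" and uw: "\<phi> u = \<psi> w"
  then obtain e e' where e: "\<phi> = plane_lift e" "\<psi> = plane_lift e'" using plane_charts_cases by metis
  have eq: "\<phi> = \<psi>" "u = w" using plane_lift_inj[of e u e' w] uw unfolding e by auto
  have "smooth_on (\<lambda>v::R2. v) Q" for Q using smooth_on_affine[OF bounded_linear_ident, of 0] by simp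
  then show "\<exists>T. (\<forall>Q. smooth_on T Q) \<and> T u = w \<and> (\<forall>v. \<psi> (T v) = \<phi> v)"
    using eq by (intro exI[of _ "\<lambda>v. v"]) auto
qed

lemma proper_immersion_plane: "proper_immersion (top_of_set plane_surf) plane_charts snd"
  unfolding proper_immersion_def
proof (intro conjI ballI)
  show "proper_map (top_of_set plane_surf) euclidean snd"
  proof (intro proper_map_subset continuous_intros)
    fix K :: "C2 set" assume K: "compact K"
    have "{m \<in> plane_surf. snd m \<in> K} = (\<Union>e\<in>{1, -1}. {of_real e} \<times> (K \<inter> range (plane e)))"
      by (auto simp: plane_surf_def plane_lift_def)
    moreover have "compact \<dots>"
      by (intro compact_UN compact_Times compact_Int_closed[OF K])
         (auto intro!: closed_subspace linear_subspace_image bounded_linear.linear[OF bounded_linear_plane])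
    ultimately show "compact {m \<in> plane_surf. snd m \<in> K}" by simp
  qed
  fix X assume "X \<in> plane_charts"
  then obtain e where X: "X = (UNIV, plane_lift e)" by (auto simp: plane_charts_def)
  have "smooth_on (plane e) UNIV" using smooth_on_affine[OF bounded_linear_plane, of 0] by simp
  then show "case X of (U, \<phi>) \<Rightarrow> smooth_on (snd \<circ> \<phi>) U \<and> (\<forall>u\<in>U. inj (frechet_derivative (snd \<circ> \<phi>) (at u)))"
    unfolding X by (simp add: snd_plane_lift frechet_plane inj_plane)
qed

lemma lagrangian_immersion_plane: "lagrangian_immersion plane_charts snd"
  unfolding lagrangian_immersion_def
proof (intro ballI, clarify)
  fix U \<phi> u v w
  assume c: "(U, \<phi>) \<in> plane_charts" and vw: "v \<in> tangent_space (snd \<circ> \<phi>) u" "w \<in> tangent_space (snd \<circ> \<phi>) u"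
  obtain e where e: "e = 1 \<or> e = -1" "snd \<circ> \<phi> = plane e" using plane_charts_cases[OF c] by metis
  obtain h k where "v = plane e h" "w = plane e k" using vw unfolding e(2) tangent_space_plane by auto
  then show "omega v w = 0" using e(1) by (auto simp: omega_def plane_def algebra_simps)
qed

lemma lagrangian_angle_plane:
  assumes "e = 1 \<or> e = -1"
  shows "lagrangian_angle (plane e) W (\<lambda>_. if e = 1 then 0 else pi)"
  unfolding lagrangian_angle_def
proof (intro conjI ballI)
  show "smooth_on (\<lambda>_::R2. if e = 1 then 0 else pi) W" unfolding smooth_on_def by (simp add: Ck_on_const)
  show "dz1_dz2 (pd1 (plane e) u) (pd2 (plane e) u) / complex_of_real (area_el (plane e) u) = cis (if e = 1 then 0 else pi)" for u
    using assms by (auto simp: metric_plane dz1_dz2_def pd_plane)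
qed

lemma pd_const: "pd1 (\<lambda>_. c) u = 0" "pd2 (\<lambda>_. c) u = 0"
  by (simp_all add: pd1_def pd2_def frechet_derivative_const)

lemma hamiltonian_stationary_plane: "hamiltonian_stationary plane_charts snd"
  unfolding hamiltonian_stationary_def
proof (intro ballI, clarify)
  fix U \<phi> u assume c: "(U, \<phi>) \<in> plane_charts"
  obtain e where e: "U = UNIV" "e = 1 \<or> e = -1" "snd \<circ> \<phi> = plane e" using plane_charts_cases[OF c] by metis
  show "\<exists>W \<beta>. open W \<and> u \<in> W \<and> W \<subseteq> U \<and> lagrangian_angle (snd \<circ> \<phi>) W \<beta> \<and> (\<forall>w\<in>W. surf_laplacian (snd \<circ> \<phi>) \<beta> w = 0)"
    using lagrangian_angle_plane[OF e(2)] unfolding e(1,3)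
    by (intro exI[of _ UNIV] exI[of _ "\<lambda>_. if e = 1 then 0 else pi"])
       (auto simp: surf_laplacian_def grad1_def grad2_def pd_const)
qed

lemma self_similar_plane: "self_similar c plane_charts snd"
  unfolding self_similar_def
proof (intro ballI, clarify)
  fix U \<phi> u assume c: "(U, \<phi>) \<in> plane_charts"
  obtain e where e: "U = UNIV" "\<phi> = plane_lift e" "e = 1 \<or> e = -1" "snd \<circ> \<phi> = plane e" using plane_charts_cases[OF c] by metis
  have "snd (\<phi> w) = plane e w" for w using fun_cong[OF e(4), of w] by simp
  moreover have "normal_part (plane e) w (plane e w) = 0" for w
    unfolding normal_part_def tangent_space_plane by (simp add: closest_point_self)
  moreover have "surf_grad (plane e) (\<lambda>_. if e = 1 then 0 else pi) w = 0" for w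
    by (simp add: surf_grad_def grad1_def grad2_def pd_const)
  ultimately show "\<exists>W \<beta>. open W \<and> u \<in> W \<and> W \<subseteq> U \<and> lagrangian_angle (snd \<circ> \<phi>) W \<beta>
     \<and> (\<forall>w\<in>W. normal_part (snd \<circ> \<phi>) w (snd (\<phi> w)) = (2 * c) *\<^sub>R cpx_J (surf_grad (snd \<circ> \<phi>) \<beta> w))"
    using lagrangian_angle_plane[OF e(3)] unfolding e(1,4)
    by (intro exI[of _ UNIV] exI[of _ "\<lambda>_. if e = 1 then 0 else pi"]) (auto simp: cpx_J_def zero_prod_def)
qed

lemma plane_surf_borel [measurable]: "plane_surf \<in> sets borel"
proof -
  have "range (plane_lift e) = (\<Union>n. plane_lift e ` cball 0 (real n))" for e
  proof -
    have "(\<Union>n. cball (0::R2) (real n)) = UNIV" using real_arch_simple by (auto simp: dist_norm)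
    then show ?thesis by (metis image_UN)
  qed
  moreover have "(\<Union>n. plane_lift e ` cball 0 (real n)) \<in> sets borel" for e
    by (intro sets.countable_UN) (auto intro!: borel_compact compact_continuous_image continuous_on_plane_lift)
  ultimately show ?thesis unfolding plane_surf_def by auto
qed

definition plane_polar :: "real \<times> real \<Rightarrow> R2 \<Rightarrow> complex \<times> C2" where
  "plane_polar \<sigma> u = plane_lift (fst \<sigma> * snd \<sigma>) (fst \<sigma> *\<^sub>R polar u)"

lemma measurable_plane_polar:
  assumes "\<sigma> \<in> signs"
  shows "plane_polar \<sigma> \<in> measurable borel (restrict_space borel plane_surf)"
proof (rule measurable_restrict_space2)
  have "fst \<sigma> * snd \<sigma> = 1 \<or> fst \<sigma> * snd \<sigma> = -1" using assms by (auto simp: signs_def)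
  then show "plane_polar \<sigma> \<in> space borel \<rightarrow> plane_surf" by (auto simp: plane_polar_def plane_surf_def)
  have [measurable]: "plane_lift e \<in> borel_measurable borel" for e
    by (intro borel_measurable_continuous_onI continuous_on_plane_lift)
  show "plane_polar \<sigma> \<in> borel_measurable borel" unfolding plane_polar_def[abs_def] by measurable
qed

text \<open>Area in polar coordinates, covered twice by the four sheets; in this form the push-forward is \<open>varif 0\<close> by
definition.\<close>

definition plane_measure :: "(complex \<times> C2) measure" where
  "plane_measure = sum_measure (1/2) signs (restrict_space borel plane_surf)
     (\<lambda>\<sigma>. distr (density lborel (area_density 0)) (restrict_space borel plane_surf) (plane_polar \<sigma>))"

lemma plane_polar_leaf:
  assumes "p = 1" "q = 1" "\<sigma> \<in> signs"
  shows "snd (plane_polar \<sigma> u) = leaf 0 \<sigma> u"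
  unfolding plane_polar_def plane_lift_def plane_def polar_def leaf_def phi_def psi_def
  unfolding assms(1,2)
  using assms(3) by (auto simp: signs_def complex_eq_iff)

text \<open>For each \<open>e\<close>, two of the four sign pairs have product \<open>e\<close>, and each of them is a polar parametrization of the whole
plane up to a null set.\<close>

lemma emeasure_plane_measure:
  assumes pq: "p = 1" "q = 1" and e: "e = 1 \<or> e = -1" and B[measurable]: "B \<in> sets borel"
  shows "emeasure plane_measure (plane_lift e ` B) = (\<integral>\<^sup>+u\<in>B. ennreal 2 \<partial>lborel)"
proof -
  let ?C = "plane_lift e ` B"
  have [measurable]: "plane_inverse \<in> borel_measurable borel"
    by (intro borel_measurable_continuous_onI continuous_on_plane_inverse)
  obtain T where T: "open T" "range (plane_lift e) = plane_surf \<inter> T" using openin_plane[OF e] by (auto simp: openin_open)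
  have pre: "plane_inverse -` B \<in> sets borel" using measurable_sets[of plane_inverse borel borel B] by simp
  have "?C = range (plane_lift e) \<inter> plane_inverse -` B" by force
  also have "\<dots> \<in> sets borel" unfolding T(2)
    by (intro sets.Int plane_surf_borel borel_open T(1) pre)
  finally have C[measurable]: "?C \<in> sets borel" .
  have sub: "?C \<subseteq> plane_surf" using e unfolding plane_surf_def by auto
  then have CR: "?C \<in> sets (restrict_space borel plane_surf)"
    using sub by (simp add: sets_restrict_space_iff plane_surf_borel)
  have mem: "plane_polar \<sigma> u \<in> ?C \<longleftrightarrow> fst \<sigma> * snd \<sigma> = e \<and> fst \<sigma> *\<^sub>R polar u \<in> B" for \<sigma> u
    using plane_lift_inj unfolding plane_polar_def by blast
  have I: "emeasure (distr (density lborel (area_density 0)) (restrict_space borel plane_surf) (plane_polar \<sigma>)) ?C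
     = (if fst \<sigma> * snd \<sigma> = e then \<integral>\<^sup>+u\<in>B. ennreal 2 \<partial>lborel else 0)" if \<sigma>: "\<sigma> \<in> signs" for \<sigma>
  proof -
    have [measurable]: "plane_polar \<sigma> \<in> borel_measurable borel"
      using measurable_plane_polar[OF \<sigma>] by (simp add: measurable_restrict_space2_iff)
    have pre: "plane_polar \<sigma> -` ?C \<in> sets borel" using measurable_sets[of "plane_polar \<sigma>" borel borel ?C] by simp
    have "emeasure (distr (density lborel (area_density 0)) (restrict_space borel plane_surf) (plane_polar \<sigma>)) ?C
      = emeasure (density lborel (area_density 0)) (plane_polar \<sigma> -` ?C)"
      using measurable_plane_polar[OF \<sigma>] CR by (subst emeasure_distr) auto
    also have "\<dots> = (\<integral>\<^sup>+u. ennreal (area_density 0 u) * indicator (plane_polar \<sigma> -` ?C) u \<partial>lborel)"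
      using pre by (subst emeasure_density) auto
    also have "\<dots> = (if fst \<sigma> * snd \<sigma> = e then \<integral>\<^sup>+u\<in>B. ennreal 2 \<partial>lborel else 0)"
    proof (cases "fst \<sigma> * snd \<sigma> = e")
      case True
      define h :: "R2 \<Rightarrow> ennreal" where "h u = ennreal 2 * indicator B (fst \<sigma> *\<^sub>R u)" for u
      have [measurable]: "h \<in> borel_measurable borel" unfolding h_def[abs_def] by measurable
      have "(\<integral>\<^sup>+u. ennreal (area_density 0 u) * indicator (plane_polar \<sigma> -` ?C) u \<partial>lborel)
         = (\<integral>\<^sup>+u. indicator strip u * (ennreal (exp (2 * fst u)) * h (polar u)) \<partial>lborel)"
      proof (rule nn_integral_cong)
        fix u :: R2
        have "area_density 0 u = indicator strip u * (exp (2 * fst u) * 2)"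
          unfolding area_density_def energy_def phi_def psi_def exp_double unfolding pq by simp
        then have "ennreal (area_density 0 u) = indicator strip u * (ennreal (exp (2 * fst u)) * ennreal 2)"
          using ennreal_mult[of "exp (2 * fst u)" 2] by (auto simp: indicator_def)
        moreover have "indicator (plane_polar \<sigma> -` ?C) u = (indicator B (fst \<sigma> *\<^sub>R polar u) :: ennreal)"
          using mem[of \<sigma> u] True by (simp add: indicator_def)
        ultimately show "ennreal (area_density 0 u) * indicator (plane_polar \<sigma> -` ?C) u
            = indicator strip u * (ennreal (exp (2 * fst u)) * h (polar u))"
          by (simp add: h_def mult.assoc)
      qed
      also have "\<dots> = (\<integral>\<^sup>+u. h u \<partial>lborel)" by (rule nn_integral_polar) measurable
      also have "\<dots> = (\<integral>\<^sup>+u\<in>B. ennreal 2 \<partial>lborel)"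
      proof (cases "fst \<sigma> = 1")
        case False
        then have "h u = ennreal 2 * indicator B (- u)" for u using \<sigma> by (auto simp: h_def signs_def)
        then show ?thesis using nn_integral_R2_uminus[of "\<lambda>u. ennreal 2 * indicator B u"] by simp
      qed (simp add: h_def)
      finally show ?thesis using True by simp
    next
      case False
      then have "plane_polar \<sigma> -` ?C = {}" using mem[of \<sigma>] unfolding vimage_def by simp
      then show ?thesis using False by simp
    qed
    finally show ?thesis .
  qed
  have "emeasure plane_measure ?C = ennreal (1/2) * (\<Sum>\<sigma>\<in>signs. if fst \<sigma> * snd \<sigma> = e then \<integral>\<^sup>+u\<in>B. ennreal 2 \<partial>lborel else 0)"
    unfolding plane_measure_def by (subst emeasure_sum_measure) (use CR I in auto)
  also have "(\<Sum>\<sigma>\<in>signs. if fst \<sigma> * snd \<sigma> = e then \<integral>\<^sup>+u\<in>B. ennreal 2 \<partial>lborel else 0) = 2 * (\<integral>\<^sup>+u\<in>B. ennreal 2 \<partial>lborel)"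
    using e unfolding mult_2 by (auto simp: signs_def)
  also have "ennreal (1/2) * (2 * (\<integral>\<^sup>+u\<in>B. ennreal 2 \<partial>lborel)) = (\<integral>\<^sup>+u\<in>B. ennreal 2 \<partial>lborel)"
  proof -
    have "ennreal (1/2) * 2 = 1" using ennreal_mult[of "1/2" 2] by simp
    then show ?thesis by (simp only: mult_1 flip: mult.assoc)
  qed
  finally show ?thesis .
qed

lemma area_measure_plane:
  assumes "p = 1" "q = 1"
  shows "area_measure (top_of_set plane_surf) plane_charts snd plane_measure"
  unfolding area_measure_def
proof (intro conjI ballI)
  show "space plane_measure = topspace (top_of_set plane_surf)"
    by (simp add: plane_measure_def space_restrict_space)
  show "sets plane_measure = sigma_sets (topspace (top_of_set plane_surf)) {N. openin (top_of_set plane_surf) N}"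
    using sets_restrict_borel[OF plane_surf_borel] by (simp add: plane_measure_def)
  fix X assume "X \<in> plane_charts"
  then obtain e where X: "X = (UNIV, plane_lift e)" "e = 1 \<or> e = -1" by (auto simp: plane_charts_def)
  show "case X of (U, \<phi>) \<Rightarrow> \<forall>B\<in>sets borel. B \<subseteq> U \<longrightarrow> emeasure plane_measure (\<phi> ` B) = (\<integral>\<^sup>+u\<in>B. ennreal (area_el (snd \<circ> \<phi>) u) \<partial>lborel)"
    unfolding X(1) split snd_plane_lift metric_plane(2)[OF X(2)] using emeasure_plane_measure[OF assms X(2)] by blast
qed

lemma tangent_plane_plane:
  assumes "e = 1 \<or> e = -1"
  shows "tangent_plane plane_charts snd (plane_lift e u) = range (plane e)"
proof -
  have "tangent_space (snd \<circ> \<phi>) w = range (plane e)" if c: "(U, \<phi>) \<in> plane_charts" "\<phi> w = plane_lift e u" for U \<phi> w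
  proof -
    obtain e' where e': "\<phi> = plane_lift e'" using plane_charts_cases[OF c(1)] by metis
    then have "e' = e" using plane_lift_inj[of e' w e u] c(2) by simp
    then show ?thesis unfolding e' snd_plane_lift tangent_space_plane by simp
  qed
  moreover have "(UNIV, plane_lift e) \<in> plane_charts" using assms by (auto simp: plane_charts_def)
  ultimately have "{tangent_space (snd \<circ> \<phi>) w |U \<phi> w. (U, \<phi>) \<in> plane_charts \<and> w \<in> U \<and> \<phi> w = plane_lift e u} = {range (plane e)}"
    by blast
  then show ?thesis unfolding tangent_plane_def by simp
qed

text \<open>The leaf is the plane in polar coordinates, whose derivative is invertible.\<close>

lemma tangent_space_leaf_plane:
  assumes "p = 1" "q = 1" "\<sigma> \<in> signs"
  shows "tangent_space (leaf 0 \<sigma>) u = range (plane (fst \<sigma> * snd \<sigma>))"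
proof -
  let ?e = "fst \<sigma> * snd \<sigma>" and ?T = "\<lambda>u. fst \<sigma> *\<^sub>R polar u"
  let ?T' = "\<lambda>h::R2. (fst \<sigma> * (exp (fst u) * (fst h * cos (snd u) - snd h * sin (snd u))),
       fst \<sigma> * (exp (fst u) * (fst h * sin (snd u) + snd h * cos (snd u))))"
  have "tangent_space (leaf 0 \<sigma>) u = tangent_space (plane ?e) (?T u)"
  proof (rule tangent_space_reparametrize)
    show "plane ?e (?T v) = leaf 0 \<sigma> v" for v
      using plane_polar_leaf[OF assms, of v] by (simp add: plane_polar_def plane_lift_def)
    show "(?T has_derivative ?T') (at u)"
      unfolding polar_def by (auto intro!: derivative_eq_intros simp: fun_eq_iff algebra_simps)
    show "surj ?T'"
    proof (rule surjI)
      fix v :: R2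
      let ?a = "fst \<sigma> * exp (- fst u)"
      have s: "fst \<sigma> * fst \<sigma> = 1" using signs_square[OF assms(3)] by simp
      have x: "fst \<sigma> * (exp (fst u) * (fst \<sigma> * exp (- fst u) * r)) = r" for r
        using s exp_minus_inverse[of "fst u"] by (metis mult.assoc mult.commute mult.left_neutral)
      have cs: "r * cos (snd u) * cos (snd u) + r * sin (snd u) * sin (snd u) = r" for r
        by (metis distrib_left mult.assoc mult.right_neutral power2_eq_square sin_cos_squared_add2)
      define g where "g = (?a * (fst v * cos (snd u) + snd v * sin (snd u)), ?a * (snd v * cos (snd u) - fst v * sin (snd u)))"
      have "fst g * cos (snd u) - snd g * sin (snd u) = ?a * fst v" "fst g * sin (snd u) + snd g * cos (snd u) = ?a * snd v"
        using cs[of "?a * fst v"] cs[of "?a * snd v"] by (simp_all add: g_def algebra_simps)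
      then show "?T' (?a * (fst v * cos (snd u) + snd v * sin (snd u)), ?a * (snd v * cos (snd u) - fst v * sin (snd u))) = v"
        unfolding g_def[symmetric] using x by (simp add: prod_eq_iff)
    qed
    show "plane ?e differentiable at (?T u)"
      using bounded_linear.has_derivative[OF bounded_linear_plane has_derivative_ident] unfolding differentiable_def by blast
  qed
  then show ?thesis by (simp add: tangent_space_plane)
qed

lemma immersion_varifold_plane:
  assumes "p = 1" "q = 1"
  shows "immersion_varifold (top_of_set plane_surf) plane_charts snd (varif 0)"
  unfolding immersion_varifold_def
proof (intro exI conjI)
  show "area_measure (top_of_set plane_surf) plane_charts snd plane_measure" by (rule area_measure_plane[OF assms])
  let ?g = "\<lambda>m. (snd m, orth_proj (tangent_plane plane_charts snd m))"
  have "continuous_on plane_surf ?g"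
  proof (rule continuous_on_locally)
    fix m assume "m \<in> plane_surf"
    then obtain e u where u: "e = 1 \<or> e = -1" "m = plane_lift e u" by (auto simp: plane_surf_def)
    have "continuous_on (range (plane_lift e)) (\<lambda>m. (snd m, orth_proj (range (plane e))))"
      by (intro continuous_intros)
    moreover have "(snd m, orth_proj (range (plane e))) = ?g m" if "m \<in> range (plane_lift e)" for m
      using that tangent_plane_plane[OF u(1)] by auto
    ultimately have "continuous_on (range (plane_lift e)) ?g" by (simp cong: continuous_on_cong)
    then show "\<exists>N. openin (top_of_set plane_surf) N \<and> m \<in> N \<and> continuous_on N ?g"
      using openin_plane[OF u(1)] u(2) by blast
  qed
  then have g: "?g \<in> borel_measurable (restrict_space borel plane_surf)"
    by (rule borel_measurable_continuous_on_restrict)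
  have d: "distr (distr (density lborel (area_density 0)) (restrict_space borel plane_surf) (plane_polar \<sigma>)) borel ?g
     = param_varifold strip (leaf 0 \<sigma>)" if \<sigma>: "\<sigma> \<in> signs" for \<sigma>
  proof -
    have e: "fst \<sigma> * snd \<sigma> = 1 \<or> fst \<sigma> * snd \<sigma> = -1" using \<sigma> by (auto simp: signs_def)
    have "distr (distr (density lborel (area_density 0)) (restrict_space borel plane_surf) (plane_polar \<sigma>)) borel ?g
      = distr (density lborel (area_density 0)) borel (?g \<circ> plane_polar \<sigma>)"
      using g measurable_plane_polar[OF \<sigma>] by (subst distr_distr) auto
    also have "?g \<circ> plane_polar \<sigma> = (\<lambda>u. (leaf 0 \<sigma> u, leaf_proj 0 \<sigma> u))"
    proof
      fix u
      have "tangent_plane plane_charts snd (plane_polar \<sigma> u) = tangent_space (leaf 0 \<sigma>) u"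
        unfolding plane_polar_def tangent_plane_plane[OF e] tangent_space_leaf_plane[OF assms \<sigma>] ..
      then show "(?g \<circ> plane_polar \<sigma>) u = (leaf 0 \<sigma> u, leaf_proj 0 \<sigma> u)"
        using plane_polar_leaf[OF assms \<sigma>, of u] by (simp add: leaf_proj_def)
    qed
    finally show ?thesis by (simp add: param_varifold_leaf[OF \<sigma>])
  qed
  have "distr plane_measure borel ?g
    = sum_measure (1/2) signs borel (\<lambda>\<sigma>. distr (distr (density lborel (area_density 0)) (restrict_space borel plane_surf) (plane_polar \<sigma>)) borel ?g)"
    unfolding plane_measure_def by (rule distr_sum_measure) (use g in auto)
  also have "\<dots> = varif 0"
    unfolding varif_def sum_measure_def by (simp add: sheets_def d cong: sum.cong)
  finally show "varif 0 = distr plane_measure borel ?g" by simp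
qed

theorem smooth_ham_stat_self_similar_plane:
  assumes "p = 1" "q = 1"
  shows "smooth_ham_stat_self_similar c (varif 0)"
  unfolding smooth_ham_stat_self_similar_def
  using smooth_surface_plane proper_immersion_plane lagrangian_immersion_plane hamiltonian_stationary_plane
    self_similar_plane immersion_varifold_plane[OF assms] by blast

theorem smooth_ham_stat_self_similar_varif:
  assumes "coprime p q" "t \<noteq> 0"
  shows "smooth_ham_stat_self_similar t (varif (delta t))"
proof (cases "p = q")
  case True
  then have "p = 1" "q = 1" using assms(1) by auto
  then have "smooth_ham_stat_self_similar t (varif 0)" by (rule smooth_ham_stat_self_similar_plane)
  moreover have "real p - real q = 0" using True by simp
  then have "delta t = 0" unfolding delta_def by simp
  ultimately show ?thesis by metis
next
  case False
  then show ?thesis by (rule smooth_ham_stat_self_similar_leaf) (rule assms(2))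
qed

end

text \<open>The motion is \<open>t \<mapsto> varif (delta t)\<close> and the self-similarity constant at time \<open>t\<close> is \<open>t\<close> itself.\<close>

theorem theorem1p1:
  fixes p q :: nat
  assumes "0 < p" and "0 < q" and "coprime p q"
  shows "\<exists>T\<in>U2. \<exists>V :: real \<Rightarrow> varifold.
      brakke_motion V \<and> without_mass_loss V
    \<and> (\<forall>t<0. smooth_ham_stat_self_shrinker (V t))
    \<and> (\<forall>t>0. smooth_ham_stat_self_expander (V t))
    \<and> weights_converge V (varifold_sum (sw_cone_varifold id p q) (sw_cone_varifold T p q)) (at_left 0)
    \<and> weights_converge V (varifold_sum (sw_cone_varifold id p q) (sw_cone_varifold T p q)) (at_right 0)"
proof -
  interpret sw p q using assms(1,2) by unfold_locales
  let ?V = "\<lambda>t. varif (delta t)"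
  obtain T where T: "T \<in> U2"
    "weight (varifold_sum (sw_cone_varifold id p q) (sw_cone_varifold T p q)) = weight (varif 0)"
    using cone_union_weight[OF assms(3)] by blast
  have conv: "weights_converge ?V (varifold_sum (sw_cone_varifold id p q) (sw_cone_varifold T p q)) F" if "F \<le> at 0" for F
    using weights_converge_varif[OF T(2)] that unfolding weights_converge_def by (blast intro: tendsto_mono)
  have "smooth_ham_stat_self_shrinker (?V t)" if "t < 0" for t
    using smooth_ham_stat_self_similar_varif[OF assms(3), of t] that unfolding smooth_ham_stat_self_shrinker_def by blast
  moreover have "smooth_ham_stat_self_expander (?V t)" if "t > 0" for t
    using smooth_ham_stat_self_similar_varif[OF assms(3), of t] that unfolding smooth_ham_stat_self_expander_def by blast
  moreover have "weights_converge ?V (varifold_sum (sw_cone_varifold id p q) (sw_cone_varifold T p q)) (at_left 0)"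
    "weights_converge ?V (varifold_sum (sw_cone_varifold id p q) (sw_cone_varifold T p q)) (at_right 0)"
    by (intro conv at_le; simp)+
  ultimately show ?thesis using T(1) brakke_motion_varif by blast
qed

end
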